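(* Let $n\ge 1$, $\lambda=(\lambda_1,\dots,\lambda_n)\in\mathbb{R}^n$, $\mu\in\mathbb{R}$ and $\delta=\mu-\sum_{i=1}^n\lambda_i$. 1) If $2\delta\notin\mathbb{N}$, then $\mathrm{H}^1_{\mathrm{diff}}(\mathfrak{aff}(1|1),\mathfrak{D}_{\lambda,\mu})=0$. 2) If $\delta=k\in\mathbb{N}$, then $$\dim\mathrm{H}^1_{\mathrm{diff}}(\mathfrak{aff}(1|1);\mathfrak{D}_{\lambda,\mu})=\sum_{r=0}^{[\frac n2]}\binom{n}{2r}\binom{n+k-r-1}{k-r}.$$ 3) If $\delta=k+\frac12\in\mathbb{N}+\frac12$, then $$\dim\mathrm{H}^1_{\mathrm{diff}}(\mathfrak{aff}(1|1);\mathfrak{D}_{\lambda,\mu})=\sum_{r=0}^{[\frac{n-1}2]}\binom{n}{2r+1}\binom{n+k-r-1}{k-r}.$$ Moreover, a basis of $\mathrm{H}^1_{\mathrm{diff}}(\mathfrak{aff}(1|1);\mathfrak{D}_{\lambda,\mu})$ is given by the (classes of the) family of 1-cocycles $\Gamma^\alpha_\varepsilon$ defined on $\mathfrak{aff}(1)$ by $$\Gamma^\alpha_\varepsilon(X_h)=h'\,\Omega^\alpha_\varepsilon+\theta\sum_{i=1}^n\xi^i_\varepsilon\, h'\,\Omega^{\alpha^i_\varepsilon}_{\varepsilon^i},\qquad X_h\in\mathfrak{aff}(1),$$ where $\varepsilon\in\mathcal{E}$ and $\alpha\in\mathbb{N}^n$ with $|\alpha|=\delta_\varepsilon$ if $\delta\in\mathbb{N}$,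 and $\varepsilon\in\mathcal{O}$ and $\alpha\in\mathbb{N}^n$ with $|\alpha|=\delta_\varepsilon$ if $\delta\in\mathbb{N}+\frac12$.
   Context: $\mathbb{N}=\{0,1,2,\dots\}$; $[\cdot]$ is the integer part; $\binom{a}{b}=0$ if $b<0$; dimensions are total dimensions (even plus odd part) over $\mathbb{R}$. Superspace: $C^\infty(\mathbb{R}^{1|1})$ consists of $F(x,\theta)=f(x)+\theta g(x)$, $f,g\in C^\infty(\mathbb{R})$, with $x$ even, $\theta$ odd, $\theta^2=0$; $f(x)$ is even, $\theta g(x)$ is odd. Let $F'=\partial_xF$, $D=\partial_\theta+\theta\partial_x$, $\overline D=\partial_\theta-\theta\partial_x$, and $X_F=F\partial_x+\frac12D(F)\overline D$. $\mathfrak{aff}(1|1)=\mathrm{Span}(X_1,X_x,X_\theta)$ is the Lie superalgebra with even part $\mathfrak{aff}(1)=\mathrm{Span}(X_1,X_x)$, odd part $\mathrm{Span}(X_\theta)$, and $[X_x,X_\theta]=-\frac12X_\theta$, $[X_x,X_1]=-X_1$, $[X_\theta,X_\theta]=\frac12X_1$, $[X_1,X_\theta]=0$. Elements of $\mathfrak{aff}(1)$ are written $X_h$ with $h\in\mathrm{Span}(1,x)$. Densities: $\mathfrak{F}_\mu$ is the space of weighted densities of weight $\mu$ on $\mathbb{R}^{1|1}$, $F\cdot(dx+\theta d\theta)^\mu$ with $F\in C^\infty(\mathbb{R}^{1|1})$, identified with $C^\infty(\mathbb{R}^{1|1})$, with action $\mathfrak{L}^\mu_{X_F}(G)=X_F(G)+\mu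 F'G$. Notation: $\mathcal{E}$ (resp. $\mathcal{O}$) is the set of $\varepsilon=(\varepsilon_1,\dots,\varepsilon_n)$ with all $\varepsilon_i\in\{0,\frac12\}$ and $|\varepsilon|=\sum\varepsilon_i\in\mathbb{N}$ (resp. $\notin\mathbb{N}$). $\delta_\varepsilon=\mu-\sum_i(\lambda_i+\varepsilon_i)$. For $\alpha\in\mathbb{N}^n$, $|\alpha|=\sum\alpha_i$. For $F_i=f_i+\theta g_i$, $\Omega^\alpha_\varepsilon(F_1,\dots,F_n)=h_1^{(\alpha_1)}\cdots h_n^{(\alpha_n)}$ with $h_i=f_i$ if $\varepsilon_i=0$ and $h_i=g_i$ if $\varepsilon_i=\frac12$. $\varepsilon^i$ is obtained from $\varepsilon$ by changing only the $i$-th entry ($0\leftrightarrow\frac12$). $\xi^i_\varepsilon=(-1)^{2\sum_{j<i}\varepsilon_j}$. $\alpha^i_\varepsilon=\alpha$ if $\varepsilon_i=0$, and $\alpha^i_\varepsilon=(\alpha_1,\dots,\alpha_i+1,\dots,\alpha_n)$ if $\varepsilon_i=\frac12$. Operators: $\mathfrak{D}_{\lambda,\mu}$ is the superspace of $n$-ary differential operators $\mathfrak{F}_{\lambda_1}\otimes\cdots\otimes\mathfrak{F}_{\lambda_n}\to\mathfrak{F}_\mu$. The action of homogeneous $X\in\mathfrak{aff}(1|1)$ on homogeneous $A$ is $X\cdot A=\mathfrak{L}^\mu_X\circ A-(-1)^{|A||X|}A\circ\mathfrak{L}^\lambda_X$, where, for operators and vector fields, $|\cdot|$ denotes parity, and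 $\mathfrak{L}^\lambda_X$ is the Lie derivative on $\mathfrak{F}_{\lambda_1}\otimes\cdots\otimes\mathfrak{F}_{\lambda_n}$ defined by the Leibniz rule: $\mathfrak{L}^\lambda_X(F_1\otimes\cdots\otimes F_n)=\sum_i(-1)^{|X|(|F_1|+\cdots+|F_{i-1}|)}F_1\otimes\cdots\otimes\mathfrak{L}^{\lambda_i}_XF_i\otimes\cdots\otimes F_n$. Cohomology: 1-cochains are linear maps $\Omega:\mathfrak{aff}(1|1)\to\mathfrak{D}_{\lambda,\mu}$ given by differential operators. A homogeneous $\Omega$ is a 1-cocycle if $(-1)^{|g||\Omega|}g\cdot\Omega(h)-(-1)^{|h|(|g|+|\Omega|)}h\cdot\Omega(g)-\Omega([g,h])=0$ for all homogeneous $g,h$; coboundaries are $\partial v(g)=(-1)^{|g||v|}g\cdot v$, $v\in\mathfrak{D}_{\lambda,\mu}$ homogeneous, and their sums. $\mathrm{H}^1_{\mathrm{diff}}$ is the space of cocycles modulo coboundaries.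
   Formalization: For ε in 𝓞 (δ ∈ ℕ+1/2) the sign before θ∑ξ^i_ε… in Γ^α_ε is taken as −1, i.e. (−1)^{2|ε|}, instead of the printed +; with + it is not the restriction of a cocycle (e.g. n=1, μ=λ+1/2, ε=1/2, α=0 gives h'D). *)

theory Defs
  imports
    "HOL-Analysis.Analysis"
    "HOL-Library.Function_Algebras"
    "Jordan_Normal_Form.Missing_VectorSpace"
begin

section \<open>The ring of smooth functions on the real line\<close>

definition smooth_real :: "(real \<Rightarrow> real) \<Rightarrow> bool" where
  "smooth_real f \<longleftrightarrow> (\<forall>k x. (deriv ^^ k) f differentiable (at x))"

lemma smooth_real_differentiable: "smooth_real f \<Longrightarrow> f differentiable (at x)"
  unfolding smooth_real_def by (metis funpow_0)

lemma smooth_real_deriv: "smooth_real f \<Longrightarrow> smooth_real (deriv f)"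
  unfolding smooth_real_def by (metis funpow_Suc_right o_apply)

lemma smooth_real_has_deriv:
  "smooth_real f \<Longrightarrow> (f has_real_derivative deriv f x) (at x)"
  using smooth_real_differentiable DERIV_deriv_iff_real_differentiable by blast

fun diff_upto :: "nat \<Rightarrow> (real \<Rightarrow> real) \<Rightarrow> bool" where
  "diff_upto 0 f \<longleftrightarrow> (\<forall>x. f differentiable (at x))"
| "diff_upto (Suc k) f \<longleftrightarrow> (\<forall>x. f differentiable (at x)) \<and> diff_upto k (deriv f)"

lemma diff_upto_differentiable: "diff_upto k f \<Longrightarrow> f differentiable (at x)"
  by (cases k) auto

lemma diff_upto_deriv:
  "diff_upto k f \<Longrightarrow> (f has_real_derivative deriv f x) (at x)"
  using diff_upto_differentiable DERIV_deriv_iff_real_differentiable by blast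

lemma diff_upto_Suc: "diff_upto (Suc k) f \<Longrightarrow> diff_upto k f"
  by (induction k arbitrary: f) auto

lemma diff_upto_iff: "diff_upto k f \<longleftrightarrow> (\<forall>j\<le>k. \<forall>x. (deriv ^^ j) f differentiable (at x))"
proof (induction k arbitrary: f)
  case (Suc k)
  have "(\<forall>j\<le>Suc k. \<forall>x. (deriv ^^ j) f differentiable (at x)) \<longleftrightarrow>
     (\<forall>x. f differentiable (at x)) \<and> (\<forall>j\<le>k. \<forall>x. (deriv ^^ j) (deriv f) differentiable (at x))"
    (is "?L \<longleftrightarrow> ?R")
  proof
    assume L: ?L
    have "f differentiable (at x)" for x
      using L[rule_format, of 0] by simp
    moreover have "(deriv ^^ j) (deriv f) differentiable (at x)" if "j \<le> k" for j x
      using L[rule_format, of "Suc j"] that by (simp add: funpow_swap1)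
    ultimately show ?R by blast
  next
    assume R: ?R
    show ?L
    proof (intro allI impI)
      fix j x assume "j \<le> Suc k"
      then show "(deriv ^^ j) f differentiable (at x)"
        using R by (cases j) (auto simp: funpow_swap1)
    qed
  qed
  then show ?case by (simp add: Suc.IH)
qed simp

lemma smooth_real_iff: "smooth_real f \<longleftrightarrow> (\<forall>k. diff_upto k f)"
  by (auto simp: smooth_real_def diff_upto_iff)

lemma diff_upto_const: "diff_upto k (\<lambda>x. c)"
  by (induction k arbitrary: c) (auto intro: derivative_intros)

lemma diff_upto_add:
  "diff_upto k f \<Longrightarrow> diff_upto k g \<Longrightarrow> diff_upto k (\<lambda>x. f x + g x)"
proof (induction k arbitrary: f g)
  case (Suc k)
  have "deriv (\<lambda>x. f x + g x) = (\<lambda>x. deriv f x + deriv g x)"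
    by (intro ext DERIV_imp_deriv DERIV_add diff_upto_deriv[OF Suc.prems(1)]
        diff_upto_deriv[OF Suc.prems(2)])
  with Suc show ?case by simp
qed simp

lemma diff_upto_mult:
  "diff_upto k f \<Longrightarrow> diff_upto k g \<Longrightarrow> diff_upto k (\<lambda>x. f x * g x)"
proof (induction k arbitrary: f g)
  case (Suc k)
  have "deriv (\<lambda>x. f x * g x) = (\<lambda>x. deriv f x * g x + f x * deriv g x)"
  proof (intro ext DERIV_imp_deriv)
    fix x
    show "((\<lambda>x. f x * g x) has_real_derivative deriv f x * g x + f x * deriv g x) (at x)"
      using DERIV_mult[OF diff_upto_deriv[OF Suc.prems(1)] diff_upto_deriv[OF Suc.prems(2)]]
      by (simp add: algebra_simps)
  qed
  moreover have "diff_upto k (\<lambda>x. deriv f x * g x + f x * deriv g x)"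
    using Suc by (intro diff_upto_add Suc.IH) (auto intro: diff_upto_Suc)
  ultimately show ?case using Suc.prems by simp
qed simp

lemma smooth_real_const: "smooth_real (\<lambda>x. c)"
  by (simp add: smooth_real_iff diff_upto_const)

lemma smooth_real_add: "smooth_real f \<Longrightarrow> smooth_real g \<Longrightarrow> smooth_real (\<lambda>x. f x + g x)"
  by (simp add: smooth_real_iff diff_upto_add)

lemma smooth_real_mult: "smooth_real f \<Longrightarrow> smooth_real g \<Longrightarrow> smooth_real (\<lambda>x. f x * g x)"
  by (simp add: smooth_real_iff diff_upto_mult)

lemma smooth_real_uminus: "smooth_real f \<Longrightarrow> smooth_real (\<lambda>x. - f x)"
  using smooth_real_mult[OF smooth_real_const[of "-1"]] by simp

lemma smooth_real_minus: "smooth_real f \<Longrightarrow> smooth_real g \<Longrightarrow> smooth_real (\<lambda>x. f x - g x)"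
  using smooth_real_add[OF _ smooth_real_uminus] by simp

lemma smooth_real_ident: "smooth_real (\<lambda>x. x)"
proof -
  have "diff_upto k (\<lambda>x::real. x)" for k
    by (cases k) (auto simp: diff_upto_const)
  then show ?thesis by (simp add: smooth_real_iff)
qed

typedef smooth = "{f. smooth_real f}"
  morphisms apply_smooth Abs_smooth
  using smooth_real_const by auto

setup_lifting type_definition_smooth

instantiation smooth :: "{comm_ring_1, real_algebra_1}"
begin

lift_definition zero_smooth :: smooth is "\<lambda>x. 0" by (rule smooth_real_const)
lift_definition one_smooth :: smooth is "\<lambda>x. 1" by (rule smooth_real_const)
lift_definition plus_smooth :: "smooth \<Rightarrow> smooth \<Rightarrow> smooth" is "\<lambda>f g x. f x + g x"
  by (rule smooth_real_add)
lift_definition minus_smooth :: "smooth \<Rightarrow> smooth \<Rightarrow> smooth" is "\<lambda>f g x. f x - g x"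
  by (rule smooth_real_minus)
lift_definition uminus_smooth :: "smooth \<Rightarrow> smooth" is "\<lambda>f x. - f x"
  by (rule smooth_real_uminus)
lift_definition times_smooth :: "smooth \<Rightarrow> smooth \<Rightarrow> smooth" is "\<lambda>f g x. f x * g x"
  by (rule smooth_real_mult)
lift_definition scaleR_smooth :: "real \<Rightarrow> smooth \<Rightarrow> smooth" is "\<lambda>c f x. c * f x"
  by (intro smooth_real_mult smooth_real_const)

instance
  by standard (transfer; auto simp: algebra_simps fun_eq_iff)+

end

lift_definition coord :: smooth is "\<lambda>x. x" by (rule smooth_real_ident)

lift_definition sderiv :: "smooth \<Rightarrow> smooth" is deriv by (rule smooth_real_deriv)

lemma smooth_eqI: "(\<And>x. apply_smooth f x = apply_smooth g x) \<Longrightarrow> f = g"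
  by (metis apply_smooth_inject ext)

lemma apply_smooth_numeral: "apply_smooth (numeral n) x = numeral n"
proof -
  have "apply_smooth (of_nat m) x = of_nat m" for m
    by (induction m) (simp_all add: zero_smooth.rep_eq one_smooth.rep_eq plus_smooth.rep_eq)
  from this[of "numeral n"] show ?thesis by simp
qed

lemmas apply_smooth_simps = apply_smooth_numeral
  zero_smooth.rep_eq one_smooth.rep_eq plus_smooth.rep_eq minus_smooth.rep_eq uminus_smooth.rep_eq
  times_smooth.rep_eq scaleR_smooth.rep_eq coord.rep_eq

lemma sderiv_simps:
  "sderiv 0 = 0" "sderiv 1 = 0" "sderiv coord = 1"
  "sderiv (f + g) = sderiv f + sderiv g" "sderiv (f - g) = sderiv f - sderiv g"
  "sderiv (- f) = - sderiv f" "sderiv (c *\<^sub>R f) = c *\<^sub>R sderiv f"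
  "sderiv (f * g) = sderiv f * g + f * sderiv g"
proof -
  show "sderiv 0 = 0" "sderiv 1 = 0" "sderiv coord = 1"
    by (transfer; simp)+
  show "sderiv (f + g) = sderiv f + sderiv g"
    by transfer (intro ext DERIV_imp_deriv DERIV_add smooth_real_has_deriv)
  show "sderiv (f - g) = sderiv f - sderiv g"
    by transfer (intro ext DERIV_imp_deriv DERIV_diff smooth_real_has_deriv)
  show "sderiv (- f) = - sderiv f"
    by transfer (intro ext DERIV_imp_deriv DERIV_minus smooth_real_has_deriv)
  show "sderiv (c *\<^sub>R f) = c *\<^sub>R sderiv f"
    by transfer (intro ext DERIV_imp_deriv DERIV_cmult smooth_real_has_deriv)
  show "sderiv (f * g) = sderiv f * g + f * sderiv g"
  proof transfer
    fix f g :: "real \<Rightarrow> real"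
    assume fg: "smooth_real f" "smooth_real g"
    show "deriv (\<lambda>x. f x * g x) = (\<lambda>x. deriv f x * g x + f x * deriv g x)"
    proof (intro ext DERIV_imp_deriv)
      fix x
      show "((\<lambda>x. f x * g x) has_real_derivative deriv f x * g x + f x * deriv g x) (at x)"
        using DERIV_mult[OF smooth_real_has_deriv[OF fg(1)] smooth_real_has_deriv[OF fg(2)]]
        by (simp add: algebra_simps)
    qed
  qed
qed


section \<open>Functions on the superspace\<close>

text \<open>\<^term>\<open>SF f g\<close> stands for the superfunction \<open>f + \<theta> g\<close>. As there is a
  single odd variable, the supercommutative algebra of these functions is commutative in the
  ordinary sense as well.\<close>

datatype superfun = SF (body: smooth) (soul: smooth)

instantiation superfun :: "{comm_ring_1, real_algebra_1}"
begin

definition "0 = SF 0 0"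
definition "1 = SF 1 0"
definition "F + G = SF (body F + body G) (soul F + soul G)"
definition "F - G = SF (body F - body G) (soul F - soul G)"
definition "- F = SF (- body F) (- soul F)"
definition "F * G = SF (body F * body G) (body F * soul G + soul F * body G)"
definition "c *\<^sub>R F = SF (c *\<^sub>R body F) (c *\<^sub>R soul F)"

instance
  by standard (auto simp: zero_superfun_def one_superfun_def plus_superfun_def
      minus_superfun_def uminus_superfun_def times_superfun_def scaleR_superfun_def
      algebra_simps)

end

definition theta :: superfun where
  "theta = SF 0 1"

definition d_x :: "superfun \<Rightarrow> superfun" where
  "d_x F = SF (sderiv (body F)) (sderiv (soul F))"

definition d_theta :: "superfun \<Rightarrow> superfun" where
  "d_theta F = SF (soul F) 0"

definition sup_D :: "superfun \<Rightarrow> superfun" where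
  "sup_D F = d_theta F + theta * d_x F"

definition sup_Dbar :: "superfun \<Rightarrow> superfun" where
  "sup_Dbar F = d_theta F - theta * d_x F"

text \<open>Parities are natural numbers read modulo 2. The zero function has both parities.\<close>

definition has_parity :: "nat \<Rightarrow> superfun \<Rightarrow> bool" where
  "has_parity p F \<longleftrightarrow> (if even p then soul F = 0 else body F = 0)"

text \<open>The linear map that is multiplication by \<open>(-1)\<^bsup>p |F|\<^esup>\<close> on homogeneous \<open>F\<close>.\<close>

definition parity_sign :: "nat \<Rightarrow> superfun \<Rightarrow> superfun" where
  "parity_sign p F = SF (body F) ((-1) ^ p *\<^sub>R soul F)"


section \<open>The Lie superalgebra aff(1|1) and its action on densities\<close>

definition contact_field :: "superfun \<Rightarrow> superfun \<Rightarrow> superfun" where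
  "contact_field F G = F * d_x G + (1/2) *\<^sub>R (sup_D F * sup_Dbar G)"

definition lie_deriv :: "real \<Rightarrow> superfun \<Rightarrow> superfun \<Rightarrow> superfun" where
  "lie_deriv m F G = contact_field F G + m *\<^sub>R (d_x F * G)"

text \<open>The triple \<open>(a, b, c)\<close> stands for \<open>a X\<^sub>1 + b X\<^sub>x + c X\<^sub>\<theta>\<close>, the field with
  generating function \<open>a + b x + c \<theta>\<close>.\<close>

type_synonym aff11 = "real \<times> real \<times> real"

fun gen_fun :: "aff11 \<Rightarrow> superfun" where
  "gen_fun (a, b, c) = SF (a *\<^sub>R 1 + b *\<^sub>R coord) (c *\<^sub>R 1)"

fun aff_bracket :: "aff11 \<Rightarrow> aff11 \<Rightarrow> aff11" where
  "aff_bracket (a, b, c) (a', b', c') =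
     (a * b' - b * a' + c * c' / 2, 0, (c * b' - b * c') / 2)"

fun aff_parity :: "nat \<Rightarrow> aff11 \<Rightarrow> bool" where
  "aff_parity p (a, b, c) \<longleftrightarrow> (if even p then c = 0 else a = 0 \<and> b = 0)"

lemmas superfun_simps =
  zero_superfun_def one_superfun_def plus_superfun_def minus_superfun_def uminus_superfun_def
  times_superfun_def scaleR_superfun_def theta_def d_x_def d_theta_def sup_D_def sup_Dbar_def
  contact_field_def sderiv_simps

lemma aff_bracket_contact_field:
  assumes "aff_parity p X" "aff_parity q Y"
  shows "contact_field (gen_fun (aff_bracket X Y)) F =
    contact_field (gen_fun X) (contact_field (gen_fun Y) F)
    - (-1) ^ (p * q) *\<^sub>R contact_field (gen_fun Y) (contact_field (gen_fun X) F)"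
  using assms
  by (cases X; cases Y; cases F; cases "even p"; cases "even q")
    (simp_all add: superfun_simps, (auto intro!: smooth_eqI simp: apply_smooth_simps field_simps))

lemma contact_field_theta: "contact_field (gen_fun (0, 0, 1)) F = (1/2) *\<^sub>R sup_D F"
  by (cases F) (auto intro!: smooth_eqI simp: superfun_simps apply_smooth_simps)

lemma sup_D_sup_D: "sup_D (sup_D F) = d_x F"
  by (cases F) (simp add: superfun_simps)

lemma sup_D_sup_Dbar: "sup_D (sup_Dbar F) + sup_Dbar (sup_D F) = 0"
  by (cases F) (simp add: superfun_simps)


section \<open>Differential operators\<close>

instantiation "fun" :: (type, real_vector) real_vector
begin

definition scaleR_fun :: "real \<Rightarrow> ('a \<Rightarrow> 'b) \<Rightarrow> 'a \<Rightarrow> 'b" where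
  "scaleR_fun c f = (\<lambda>x. c *\<^sub>R f x)"

instance
  by standard (auto simp: scaleR_fun_def plus_fun_def algebra_simps)

end

text \<open>Operators on the \<open>n\<close>-fold tensor product are \<open>n\<close>-linear maps; the arguments are indexed by
  a finite linear order \<open>'n\<close> with \<open>n\<close> elements.\<close>

type_synonym 'n operator = "('n \<Rightarrow> superfun) \<Rightarrow> superfun"

definition diff_ops :: "('n::finite) operator set" where
  "diff_ops = span {(\<lambda>F. a * (\<Prod>i\<in>UNIV. (d_x ^^ \<alpha> i) ((d_theta ^^ \<beta> i) (F i)))) | a \<alpha> \<beta>. True}"

definition op_parity :: "nat \<Rightarrow> ('n::finite) operator \<Rightarrow> bool" where
  "op_parity p A \<longleftrightarrow>
     (\<forall>F q. (\<forall>i. has_parity (q i) (F i)) \<longrightarrow> has_parity (p + (\<Sum>i\<in>UNIV. q i)) (A F))"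

text \<open>\<open>A \<circ> L\<^sub>X\<close> for the Leibniz rule with Koszul signs, \<open>p = |X|\<close>. The sign
  \<open>(-1)\<^bsup>p (|F\<^sub>1| + \<dots> + |F\<^sub>i\<^sub>-\<^sub>1|)\<^esup>\<close> is distributed over the first \<open>i - 1\<close> arguments,
  which extends the rule from homogeneous to all arguments.\<close>

definition comp_lie :: "('n \<Rightarrow> real) \<Rightarrow> nat \<Rightarrow> aff11 \<Rightarrow> ('n::{finite,linorder}) operator \<Rightarrow> 'n operator" where
  "comp_lie lam p X A = (\<lambda>F. \<Sum>i\<in>UNIV. A (\<lambda>j.
     if j < i then parity_sign p (F j)
     else if j = i then lie_deriv (lam i) (gen_fun X) (F i)
     else F j))"

text \<open>\<open>X \<cdot> A\<close> for \<open>X\<close> of parity \<open>p\<close> and \<open>A\<close> of parity \<open>q\<close>.\<close>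

definition op_action ::
  "('n \<Rightarrow> real) \<Rightarrow> real \<Rightarrow> nat \<Rightarrow> nat \<Rightarrow> aff11 \<Rightarrow> ('n::{finite,linorder}) operator \<Rightarrow> 'n operator" where
  "op_action lam mu p q X A =
     (\<lambda>F. lie_deriv mu (gen_fun X) (A F)) - (-1) ^ (p * q) *\<^sub>R comp_lie lam p X A"


section \<open>The first cohomology space\<close>

text \<open>As aff(1|1) is finite dimensional, every linear map on it is given by a differential operator
  in the generating function.\<close>

type_synonym 'n cochain = "aff11 \<Rightarrow> 'n operator"

definition cochains :: "('n::finite) cochain set" where
  "cochains = {c. linear c \<and> (\<forall>g. c g \<in> diff_ops)}"

definition cochain_parity :: "nat \<Rightarrow> ('n::finite) cochain \<Rightarrow> bool" where
  "cochain_parity p c \<longleftrightarrow> (\<forall>q g. aff_parity q g \<longrightarrow> op_parity (p + q) (c g))"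

definition hom_cocycles :: "('n \<Rightarrow> real) \<Rightarrow> real \<Rightarrow> nat \<Rightarrow> ('n::{finite,linorder}) cochain set" where
  "hom_cocycles lam mu p = {c \<in> cochains. cochain_parity p c \<and>
     (\<forall>q r g h. aff_parity q g \<longrightarrow> aff_parity r h \<longrightarrow>
        (-1) ^ (q * p) *\<^sub>R op_action lam mu q (p + r) g (c h)
        - (-1) ^ (r * (q + p)) *\<^sub>R op_action lam mu r (p + q) h (c g)
        - c (aff_bracket g h) = 0)}"

definition hom_coboundaries :: "('n \<Rightarrow> real) \<Rightarrow> real \<Rightarrow> nat \<Rightarrow> ('n::{finite,linorder}) cochain set" where
  "hom_coboundaries lam mu p = {c. linear c \<and> (\<exists>v\<in>diff_ops. op_parity p v \<and>
     (\<forall>q g. aff_parity q g \<longrightarrow> c g = (-1) ^ (q * p) *\<^sub>R op_action lam mu q p g v))}"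

definition cocycles :: "('n \<Rightarrow> real) \<Rightarrow> real \<Rightarrow> ('n::{finite,linorder}) cochain set" where
  "cocycles lam mu = {c + d | c d. c \<in> hom_cocycles lam mu 0 \<and> d \<in> hom_cocycles lam mu 1}"

definition coboundaries :: "('n \<Rightarrow> real) \<Rightarrow> real \<Rightarrow> ('n::{finite,linorder}) cochain set" where
  "coboundaries lam mu =
     {c + d | c d. c \<in> hom_coboundaries lam mu 0 \<and> d \<in> hom_coboundaries lam mu 1}"

definition residue_class :: "'a::real_vector set \<Rightarrow> 'a \<Rightarrow> 'a set" where
  "residue_class B z = {z + b | b. b \<in> B}"

text \<open>The quotient \<open>Z / B\<close> as a module record. In the scalar multiple, \<open>B\<close> is added again
  so that \<open>0\<close> times a class is the class \<open>B\<close> and not \<open>{0}\<close>. The ring fields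
  \<open>mult\<close> and \<open>one\<close> of the record play no role.\<close>

definition quotient_space :: "'a::real_vector set \<Rightarrow> 'a set \<Rightarrow> (real, 'a set) module" where
  "quotient_space Z B = \<lparr>
     carrier = residue_class B ` Z, mult = undefined, one = undefined,
     zero = B, add = (\<lambda>S T. {s + t | s t. s \<in> S \<and> t \<in> T}),
     smult = (\<lambda>a S. {a *\<^sub>R s + b | s b. s \<in> S \<and> b \<in> B}) \<rparr>"

definition real_field :: "real ring" where
  "real_field = \<lparr> carrier = UNIV, mult = (*), one = 1, zero = 0, add = (+) \<rparr>"

definition H1_diff :: "('n \<Rightarrow> real) \<Rightarrow> real \<Rightarrow> (real, ('n::{finite,linorder}) cochain set) module" where
  "H1_diff lam mu = quotient_space (cocycles lam mu) (coboundaries lam mu)"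

definition H1_class :: "('n \<Rightarrow> real) \<Rightarrow> real \<Rightarrow> ('n::{finite,linorder}) cochain \<Rightarrow> 'n cochain set" where
  "H1_class lam mu c = residue_class (coboundaries lam mu) c"


section \<open>The explicit cocycles\<close>

text \<open>\<^term>\<open>eps_set\<close> consists of the \<open>\<epsilon>\<close> with entries in \<open>{0, 1/2}\<close>.\<close>

definition eps_set :: "('n::finite \<Rightarrow> real) set" where
  "eps_set = {\<epsilon>. \<forall>i. \<epsilon> i \<in> {0, 1/2}}"

definition eps_even :: "('n::finite \<Rightarrow> real) set" where
  "eps_even = {\<epsilon> \<in> eps_set. (\<Sum>i\<in>UNIV. \<epsilon> i) \<in> \<nat>}"

definition eps_odd :: "('n::finite \<Rightarrow> real) set" where
  "eps_odd = {\<epsilon> \<in> eps_set. (\<Sum>i\<in>UNIV. \<epsilon> i) \<notin> \<nat>}"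

definition delta_eps :: "('n::finite \<Rightarrow> real) \<Rightarrow> real \<Rightarrow> ('n \<Rightarrow> real) \<Rightarrow> real" where
  "delta_eps lam mu \<epsilon> = mu - (\<Sum>i\<in>UNIV. lam i + \<epsilon> i)"

definition Omega :: "('n \<Rightarrow> real) \<Rightarrow> ('n \<Rightarrow> nat) \<Rightarrow> ('n::finite) operator" where
  "Omega \<epsilon> \<alpha> F =
     SF (\<Prod>i\<in>UNIV. (sderiv ^^ \<alpha> i) (if \<epsilon> i = 0 then body (F i) else soul (F i))) 0"

definition eps_flip :: "('n \<Rightarrow> real) \<Rightarrow> 'n \<Rightarrow> 'n \<Rightarrow> real" where
  "eps_flip \<epsilon> i = \<epsilon>(i := 1/2 - \<epsilon> i)"

definition alpha_shift :: "('n \<Rightarrow> real) \<Rightarrow> ('n \<Rightarrow> nat) \<Rightarrow> 'n \<Rightarrow> 'n \<Rightarrow> nat" where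
  "alpha_shift \<epsilon> \<alpha> i = (if \<epsilon> i = 0 then \<alpha> else \<alpha>(i := \<alpha> i + 1))"

definition xi_sign :: "('n::{finite,linorder} \<Rightarrow> real) \<Rightarrow> 'n \<Rightarrow> real" where
  "xi_sign \<epsilon> i = (-1) ^ nat \<lfloor>2 * (\<Sum>j | j < i. \<epsilon> j)\<rfloor>"

text \<open>The value at \<open>X\<^sub>h\<close> of the cocycle \<open>\<Gamma>\<close>. The sign \<open>(-1)\<^bsup>2|\<epsilon>|\<^esup>\<close> in
  front of \<open>\<theta>\<close> is \<open>1\<close> when \<open>|\<epsilon>|\<close> is an integer. When it is not, the operator
  \<open>\<Omega>\<close> is odd and the sign \<open>-1\<close> is forced: for \<open>n = 1\<close>, \<open>\<epsilon> = (1/2)\<close>,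
  \<open>\<alpha> = 0\<close> the operator is \<open>f + \<theta> g \<mapsto> g - \<theta> f'\<close>, that is \<^const>\<open>sup_Dbar\<close>, which
  supercommutes with \<open>X\<^sub>\<theta> = D / 2\<close>; with the sign \<open>+1\<close> it would be \<^const>\<open>sup_D\<close>, for which
  \<open>X\<^sub>\<theta> \<cdot> D = \<partial>\<^sub>x\<close>, and \<open>X\<^sub>h \<mapsto> h' D\<close> is not the restriction of a cocycle.\<close>

definition Gamma_aff1 :: "('n \<Rightarrow> real) \<Rightarrow> ('n \<Rightarrow> nat) \<Rightarrow> superfun \<Rightarrow> ('n::{finite,linorder}) operator" where
  "Gamma_aff1 \<epsilon> \<alpha> h = (\<lambda>F. d_x h * Omega \<epsilon> \<alpha> F
     + (-1) ^ nat \<lfloor>2 * (\<Sum>i\<in>UNIV. \<epsilon> i)\<rfloor> *\<^sub>R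
       (theta * (\<Sum>i\<in>UNIV. xi_sign \<epsilon> i *\<^sub>R
         (d_x h * Omega (eps_flip \<epsilon> i) (alpha_shift \<epsilon> \<alpha> i) F))))"

text \<open>The cocycles that restrict to the given map on the even part aff(1) of aff(1|1).\<close>

definition Gamma_cocycles ::
  "('n \<Rightarrow> real) \<Rightarrow> real \<Rightarrow> ('n \<Rightarrow> real) \<Rightarrow> ('n \<Rightarrow> nat) \<Rightarrow> ('n::{finite,linorder}) cochain set" where
  "Gamma_cocycles lam mu \<epsilon> \<alpha> = {c \<in> cocycles lam mu.
     \<forall>X. aff_parity 0 X \<longrightarrow> c X = Gamma_aff1 \<epsilon> \<alpha> (gen_fun X)}"

definition Gamma_index ::
  "('n::finite \<Rightarrow> real) \<Rightarrow> real \<Rightarrow> ('n \<Rightarrow> real) set \<Rightarrow> (('n \<Rightarrow> real) \<times> ('n \<Rightarrow> nat)) set" where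
  "Gamma_index lam mu E =
     {(\<epsilon>, \<alpha>). \<epsilon> \<in> E \<and> real (\<Sum>i\<in>UNIV. \<alpha> i) = delta_eps lam mu \<epsilon>}"

text \<open>As a member of the family is prescribed on aff(1) only, the family is a basis if each
  prescription is met by some cocycle and if the classes form a basis whichever cocycles
  meeting the prescriptions are chosen.\<close>

definition Gamma_basis :: "('n \<Rightarrow> real) \<Rightarrow> real \<Rightarrow> ('n::{finite,linorder} \<Rightarrow> real) set \<Rightarrow> bool" where
  "Gamma_basis lam mu E \<longleftrightarrow>
     (\<forall>(\<epsilon>, \<alpha>) \<in> Gamma_index lam mu E. Gamma_cocycles lam mu \<epsilon> \<alpha> \<noteq> {}) \<and>
     (\<forall>\<Gamma>. (\<forall>(\<epsilon>, \<alpha>) \<in> Gamma_index lam mu E. \<Gamma> (\<epsilon>, \<alpha>) \<in> Gamma_cocycles lam mu \<epsilon> \<alpha>) \<longrightarrow>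
        inj_on (\<lambda>i. H1_class lam mu (\<Gamma> i)) (Gamma_index lam mu E) \<and>
        vectorspace.basis real_field (H1_diff lam mu)
          ((\<lambda>i. H1_class lam mu (\<Gamma> i)) ` Gamma_index lam mu E))"

end

theory Submission
  imports Defs
begin

text \<open>The coefficient functions of a differential operator can be integrated, so every cocycle can
  be changed by a coboundary until it vanishes on \<open>X\<^sub>1\<close>; its values are then operators with
  constant coefficients. On these \<open>X\<^sub>\<theta>\<close> acts as a differential, and it is exact: if
  \<open>X\<^sub>\<theta> \<cdot> B = 0\<close>, then \<open>B = X\<^sub>\<theta> \<cdot> (2 \<theta> B)\<close>, because an operator annihilated by
  \<open>X\<^sub>\<theta>\<close> is determined by its component without \<open>\<theta>\<close>. So the value on \<open>X\<^sub>\<theta>\<close> can be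
  removed as well, and what remains is an operator \<open>c(X\<^sub>x)\<close> annihilated by \<open>X\<^sub>1\<close> and
  \<open>X\<^sub>\<theta>\<close>. Such operators have the basis \<open>\<Omega>\<^sup>\<alpha>\<^sub>\<epsilon> \<plusminus> \<theta> \<Sum>\<^sub>i \<xi>\<^sup>i\<^sub>\<epsilon> \<Omega>\<close>, on which
  \<open>X\<^sub>x\<close> acts by the scalars \<open>\<delta>\<^sub>\<epsilon> - |\<alpha>|\<close>; exactly the basis elements with scalar \<open>0\<close>
  survive in the quotient by the coboundaries.\<close>

section \<open>Bases of quotient spaces\<close>

text \<open>Comparing \<theta>-components directly would mean following Koszul signs through two
  successive applications of X_\<theta>. This is avoided throughout: X_\<theta> squares to X_1 / 4,
  so once X_1 acts as zero, an identity between operators killed by X_\<theta> need only be checked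
  on bodies. The primitive 2 \<theta> B has the same origin: the body of X_\<theta> acting on
  \<theta> B is half the body of B. As this primitive has body zero, it leaves the body of the value
  on X_x unchanged; hence a cocycle that is zero on aff(1) is a coboundary. This is what makes the
  classes well defined, since the family is prescribed on aff(1) only. Independence requires a
  functional that kills X_x acting on v for every v, invariant or not. Evaluation at the origin on
  divided powers does this: x d/dx contributes nothing at 0, and the weights of source and target
  cancel exactly when |\<alpha>| equals \<delta>_\<epsilon>.\<close>

lemma field_real_field: "Ring.field real_field"
proof -
  have "cring real_field"
    by unfold_locales
      (auto simp: real_field_def algebra_simps Units_def intro: exI[of _ "- x" for x])
  then show ?thesis
    by (rule cring.cring_fieldI2)
      (auto simp: real_field_def intro: exI[of _ "inverse a" for a] right_inverse)
qed

context
  fixes Z B :: "'a::real_vector set"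
  assumes Z: "Real_Vector_Spaces.subspace Z" and B: "Real_Vector_Spaces.subspace B"
    and B_sub_Z: "B \<subseteq> Z"
begin

lemma residue_class_eq_iff: "residue_class B z = residue_class B w \<longleftrightarrow> z - w \<in> B"
proof
  assume "residue_class B z = residue_class B w"
  moreover have "z \<in> residue_class B z"
    using subspace_0[OF B] by (force simp: residue_class_def)
  ultimately obtain b where "z = w + b" "b \<in> B" by (auto simp: residue_class_def)
  then show "z - w \<in> B" by simp
next
  assume *: "z - w \<in> B"
  have "z + b \<in> residue_class B w" if "b \<in> B" for b
    using subspace_add[OF B * that] unfolding residue_class_def
    by (intro CollectI exI[of _ "z - w + b"]) simp
  moreover have "w + b \<in> residue_class B z" if "b \<in> B" for b
    using subspace_diff[OF B that *] unfolding residue_class_def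
    by (intro CollectI exI[of _ "b - (z - w)"]) simp
  ultimately show "residue_class B z = residue_class B w"
    by (auto simp: residue_class_def)
qed

lemma residue_class_0: "residue_class B 0 = B"
  by (auto simp: residue_class_def)

lemma quotient_space_zero: "\<zero>\<^bsub>quotient_space Z B\<^esub> = residue_class B 0"
  by (simp add: quotient_space_def residue_class_0)

lemma quotient_space_carrier: "carrier (quotient_space Z B) = residue_class B ` Z"
  by (simp add: quotient_space_def)

lemma quotient_space_add:
  "residue_class B z \<oplus>\<^bsub>quotient_space Z B\<^esub> residue_class B w = residue_class B (z + w)"
proof -
  have "(z + b) + (w + c) \<in> residue_class B (z + w)" if "b \<in> B" "c \<in> B" for b c
    using subspace_add[OF B that] unfolding residue_class_def
    by (intro CollectI exI[of _ "b + c"]) (simp add: algebra_simps)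
  moreover have "\<exists>s t. z + w + b = s + t \<and> s \<in> residue_class B z \<and> t \<in> residue_class B w"
    if "b \<in> B" for b
    using that subspace_0[OF B]
    by (intro exI[of _ "z + b"] exI[of _ "w + 0"]) (auto simp: residue_class_def algebra_simps)
  ultimately show ?thesis
    by (fastforce simp: quotient_space_def residue_class_def)
qed

lemma quotient_space_smult:
  "a \<odot>\<^bsub>quotient_space Z B\<^esub> residue_class B z = residue_class B (a *\<^sub>R z)"
proof -
  have "a *\<^sub>R (z + b) + c \<in> residue_class B (a *\<^sub>R z)" if "b \<in> B" "c \<in> B" for b c
    using subspace_add[OF B subspace_scale[OF B that(1), of a] that(2)]
    unfolding residue_class_def
    by (intro CollectI exI[of _ "a *\<^sub>R b + c"]) (simp add: algebra_simps)
  moreover have "\<exists>s c. a *\<^sub>R z + b = a *\<^sub>R s + c \<and> s \<in> residue_class B z \<and> c \<in> B" if "b \<in> B" for b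
    using that subspace_0[OF B]
    by (intro exI[of _ "z + 0"] exI[of _ b]) (auto simp: residue_class_def)
  ultimately show ?thesis
    by (fastforce simp: quotient_space_def residue_class_def)
qed

lemma vectorspace_quotient_space: "vectorspace real_field (quotient_space Z B)"
proof (rule vs_criteria)
  show "\<forall>v\<in>carrier (quotient_space Z B). \<exists>neg_v\<in>carrier (quotient_space Z B).
      v \<oplus>\<^bsub>quotient_space Z B\<^esub> neg_v = \<zero>\<^bsub>quotient_space Z B\<^esub>"
  proof
    fix v assume "v \<in> carrier (quotient_space Z B)"
    then obtain z where "v = residue_class B z" "z \<in> Z" by (auto simp: quotient_space_carrier)
    then show "\<exists>neg_v\<in>carrier (quotient_space Z B).
        v \<oplus>\<^bsub>quotient_space Z B\<^esub> neg_v = \<zero>\<^bsub>quotient_space Z B\<^esub>"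
      using subspace_neg[OF Z]
      by (intro bexI[of _ "residue_class B (- z)"])
        (simp_all add: quotient_space_carrier quotient_space_add quotient_space_zero)
  qed
qed (use field_real_field in \<open>auto simp: quotient_space_carrier quotient_space_add quotient_space_zero
    quotient_space_smult real_field_def algebra_simps
    intro!: imageI subspace_add[OF Z] subspace_scale[OF Z] subspace_0[OF Z]\<close>)

lemma quotient_space_finsum:
  assumes "finite I" "\<And>i. i \<in> I \<Longrightarrow> z i \<in> Z"
  shows "(\<Oplus>\<^bsub>quotient_space Z B\<^esub>i\<in>I. residue_class B (z i)) = residue_class B (\<Sum>i\<in>I. z i)"
proof -
  interpret vectorspace real_field "quotient_space Z B" by (rule vectorspace_quotient_space)
  show ?thesis using assms
  proof (induction I rule: finite_induct)
    case (insert i I)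
    then show ?case
      by (subst M.finsum_insert) (auto simp: quotient_space_carrier quotient_space_add)
  qed (simp add: quotient_space_zero)
qed

text \<open>The usual criterion modulo B, phrased for representatives indexed by I instead of a set
  of classes, so that it can be applied to an explicit family of cocycles without computing in the
  quotient.\<close>

lemma quotient_space_basis:
  fixes z :: "'i \<Rightarrow> 'a"
  assumes fin: "finite I" and z: "\<And>i. i \<in> I \<Longrightarrow> z i \<in> Z"
    and gen: "\<And>c. c \<in> Z \<Longrightarrow> \<exists>a. c - (\<Sum>i\<in>I. a i *\<^sub>R z i) \<in> B"
    and indep: "\<And>a i. (\<Sum>i\<in>I. a i *\<^sub>R z i) \<in> B \<Longrightarrow> i \<in> I \<Longrightarrow> a i = 0"
  shows "inj_on (\<lambda>i. residue_class B (z i)) I"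
    and "vectorspace.basis real_field (quotient_space Z B) ((\<lambda>i. residue_class B (z i)) ` I)"
    and "vectorspace.fin_dim real_field (quotient_space Z B)"
    and "vectorspace.dim real_field (quotient_space Z B) = card I"
proof -
  interpret V: vectorspace real_field "quotient_space Z B" by (rule vectorspace_quotient_space)
  let ?r = "\<lambda>i. residue_class B (z i)"
  show inj: "inj_on ?r I"
  proof (rule inj_onI)
    fix i j assume ij: "i \<in> I" "j \<in> I" "?r i = ?r j"
    \<comment> \<open>Injectivity is independence applied to the combination z i - z j.\<close>
    define a where "a k = (if k = i then 1 else 0) - (if k = j then 1 else 0 :: real)" for k
    have "(\<Sum>k\<in>I. a k *\<^sub>R z k) = z i - z j"
      using fin ij by (simp add: a_def scaleR_left_diff_distrib sum_subtractf if_distrib[of "\<lambda>c. c *\<^sub>R _"] cong: if_cong)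
    with ij have "a i = 0" by (intro indep) (simp_all add: residue_class_eq_iff)
    then show "i = j" by (simp add: a_def split: if_splits)
  qed
  have lincomb: "V.lincomb a (?r ` I) = residue_class B (\<Sum>i\<in>I. a (?r i) *\<^sub>R z i)" for a
  proof -
    have "V.lincomb a (?r ` I) = (\<Oplus>\<^bsub>quotient_space Z B\<^esub>i\<in>I. a (?r i) \<odot>\<^bsub>quotient_space Z B\<^esub> ?r i)"
      unfolding V.lincomb_def using inj z
      by (subst V.M.finsum_reindex)
        (auto simp: quotient_space_carrier quotient_space_smult intro!: imageI subspace_scale[OF Z])
    also have "\<dots> = (\<Oplus>\<^bsub>quotient_space Z B\<^esub>i\<in>I. residue_class B (a (?r i) *\<^sub>R z i))"
      by (simp add: quotient_space_smult)
    also have "\<dots> = residue_class B (\<Sum>i\<in>I. a (?r i) *\<^sub>R z i)"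
      using fin z by (intro quotient_space_finsum subspace_scale[OF Z])
    finally show ?thesis .
  qed
  have sub: "?r ` I \<subseteq> carrier (quotient_space Z B)"
    using z by (auto simp: quotient_space_carrier)
  have li: "\<not> V.lin_dep (?r ` I)"
  proof (rule V.finite_lin_indpt2)
    fix a :: "'a set \<Rightarrow> real"
    assume "V.lincomb a (?r ` I) = \<zero>\<^bsub>quotient_space Z B\<^esub>"
    then have "(\<Sum>i\<in>I. a (?r i) *\<^sub>R z i) \<in> B"
      by (simp add: lincomb quotient_space_zero residue_class_eq_iff)
    from indep[OF this] show "\<forall>v\<in>?r ` I. a v = \<zero>\<^bsub>real_field\<^esub>"
      by (auto simp: real_field_def)
  qed (use fin sub in auto)
  have "v \<in> V.span (?r ` I)" if v: "v \<in> carrier (quotient_space Z B)" for v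
  proof -
    obtain c where c: "v = residue_class B c" "c \<in> Z" using v by (auto simp: quotient_space_carrier)
    with gen obtain a where a: "c - (\<Sum>i\<in>I. a i *\<^sub>R z i) \<in> B" by blast
    \<comment> \<open>\<open>lincomb\<close> wants coefficients indexed by classes; injectivity of
      \<open>?r\<close> lets those indexed by I be carried over.\<close>
    define a' where "a' = (\<lambda>v. a (the_inv_into I ?r v))"
    have "V.lincomb a' (?r ` I) = residue_class B (\<Sum>i\<in>I. a i *\<^sub>R z i)"
      unfolding lincomb by (intro arg_cong[of _ _ "residue_class B"] sum.cong)
        (simp_all add: a'_def the_inv_into_f_f[OF inj])
    also have "\<dots> = v" using a c residue_class_eq_iff by blast
    finally show ?thesis
      using fin unfolding V.span_def
      by (intro CollectI exI[of _ a'] exI[of _ "?r ` I"]) (simp add: real_field_def)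
  qed
  then have gen': "V.span (?r ` I) = carrier (quotient_space Z B)"
    using V.span_is_subset2[OF sub] by blast
  show basis: "V.basis (?r ` I)" using li gen' sub by (simp add: V.basis_def)
  show "V.fin_dim" using fin sub gen' unfolding V.fin_dim_def by blast
  show "V.dim = card I" using V.dim_basis[OF _ basis] fin card_image[OF inj] by simp
qed

end

section \<open>Smooth functions\<close>

text \<open>Antiderivatives exist on the whole line; this is the only analytic input to the
  surjectivity of X_1 on differential operators.\<close>

lemma sderiv_surj: "\<exists>g. sderiv g = f"
proof transfer
  fix f :: "real \<Rightarrow> real" assume f: "smooth_real f"
  have "isCont f x" for x
    using smooth_real_has_deriv[OF f] DERIV_isCont by blast
  then have "\<exists>F. \<forall>x. - \<infinity> < ereal x \<longrightarrow> ereal x < \<infinity> \<longrightarrow> (F has_vector_derivative f x) (at x)"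
    by (intro einterval_antiderivative) auto
  then obtain F where "\<And>x. (F has_real_derivative f x) (at x)"
    by (auto simp: has_real_derivative_iff_has_vector_derivative)
  then have F: "deriv F = f" "\<And>x. F differentiable (at x)"
    by (auto simp: real_differentiable_def DERIV_imp_deriv)
  \<comment> \<open>The antiderivative is only known to be differentiable; its derivatives of order
    at least one are those of f.\<close>
  have "smooth_real F"
  proof (unfold smooth_real_def, intro allI)
    fix k x show "(deriv ^^ k) F differentiable (at x)"
    proof (cases k)
      case (Suc j)
      then show ?thesis using f F(1) by (simp add: funpow_Suc_right smooth_real_def del: funpow.simps)
    qed (use F(2) in simp)
  qed
  with F(1) show "\<exists>g\<in>Collect smooth_real. deriv g = f" by auto
qed

lemma sderiv_eq_0: "sderiv f = 0 \<Longrightarrow> \<exists>c. f = c *\<^sub>R 1"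
proof transfer
  fix f :: "real \<Rightarrow> real" assume f: "smooth_real f" and "deriv f = (\<lambda>x. 0)"
  then have "(f has_real_derivative 0) (at x)" for x
    using smooth_real_has_deriv[OF f, of x] by simp
  then show "\<exists>c. f = (\<lambda>x. c * 1)"
    using DERIV_isconst_all by (metis mult.right_neutral ext)
qed

lemma linear_sderiv: "linear sderiv"
  by (rule linearI) (simp_all add: sderiv_simps)

lemma linear_funpow: "linear f \<Longrightarrow> linear (f ^^ k)"
  for f :: "'a::real_vector \<Rightarrow> 'a"
  by (induction k) (auto intro: linear_compose linear_ident simp: id_def)

lemmas linear_sderiv_funpow = linear_funpow[OF linear_sderiv]

lemma sderiv_prod:
  "finite S \<Longrightarrow> sderiv (\<Prod>i\<in>S. f i) = (\<Sum>i\<in>S. sderiv (f i) * (\<Prod>j\<in>S - {i}. f j))"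
proof (induction S rule: finite_induct)
  case (insert i S)
  have "insert i S - {j} = insert i (S - {j})" if "j \<in> S" for j
    using that insert.hyps(2) by auto
  with insert show ?case
    by (simp add: sderiv_simps sum_distrib_left mult.left_commute cong: sum.cong)
qed (simp add: sderiv_simps)

text \<open>The commutator of the k-th derivative with multiplication by x. Its extra term k is how
  the order \<alpha>_i enters the weight of \<Omega>.\<close>

lemma sderiv_funpow_coord:
  "(sderiv ^^ k) (coord * sderiv h) = coord * (sderiv ^^ Suc k) h + real k *\<^sub>R (sderiv ^^ k) h"
proof (induction k)
  case (Suc k)
  then show ?case
    by (simp add: sderiv_simps algebra_simps)
qed simp

text \<open>The divided power (x - t)^m / m!, dual to the derivatives at t: its k-th derivative
  there is 1 for k = m and 0 otherwise.\<close>

definition shifted_power :: "real \<Rightarrow> nat \<Rightarrow> smooth" where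
  "shifted_power t m = (1 / fact m) *\<^sub>R (coord - t *\<^sub>R 1) ^ m"

lemma sderiv_power: "sderiv (f ^ Suc m) = real (Suc m) *\<^sub>R (f ^ m * sderiv f)"
proof (induction m)
  case (Suc m)
  have "sderiv (f ^ Suc (Suc m)) = sderiv f * f ^ Suc m + f * sderiv (f ^ Suc m)"
    by (simp only: power_Suc[of f "Suc m"] sderiv_simps)
  also have "\<dots> = real (Suc (Suc m)) *\<^sub>R (f ^ Suc m * sderiv f)"
    unfolding Suc.IH by (rule smooth_eqI) (simp add: apply_smooth_simps algebra_simps)
  finally show ?case .
qed (simp add: sderiv_simps)

lemma sderiv_shifted_power:
  "sderiv (shifted_power t m) = (if m = 0 then 0 else shifted_power t (m - 1))"
proof (cases m)
  case (Suc k)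
  have "sderiv (shifted_power t (Suc k)) = (1 / fact (Suc k)) *\<^sub>R sderiv ((coord - t *\<^sub>R 1) ^ Suc k)"
    by (simp only: shifted_power_def sderiv_simps)
  also have "\<dots> = shifted_power t k"
    unfolding sderiv_power by (simp add: sderiv_simps shifted_power_def del: of_nat_Suc)
  finally show ?thesis using Suc by simp
qed (simp add: shifted_power_def sderiv_simps)

lemma apply_shifted_power: "apply_smooth (shifted_power t m) t = (if m = 0 then 1 else 0)"
proof -
  have "apply_smooth (f ^ m) x = apply_smooth f x ^ m" for f :: smooth and x
    by (induction m) (simp_all add: apply_smooth_simps)
  then show ?thesis by (simp add: shifted_power_def apply_smooth_simps power_0_left)
qed

lemma sderiv_funpow_shifted_power:
  "(sderiv ^^ k) (shifted_power t m) = (if k \<le> m then shifted_power t (m - k) else 0)"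
  by (induction k) (auto simp: sderiv_shifted_power sderiv_simps)

text \<open>Euler's identity. The centre has to be 0, the zero of the field x d/dx.\<close>

lemma coord_shifted_power: "coord * sderiv (shifted_power 0 m) = real m *\<^sub>R shifted_power 0 m"
  by (cases m)
    (simp_all add: sderiv_shifted_power del: of_nat_Suc, simp_all add: shifted_power_def del: of_nat_Suc)

lemma apply_smooth_sum: "apply_smooth (\<Sum>i\<in>S. f i) x = (\<Sum>i\<in>S. apply_smooth (f i) x)"
  by (induction S rule: infinite_finite_induct) (simp_all add: apply_smooth_simps)

lemma apply_smooth_prod: "apply_smooth (\<Prod>i\<in>S. f i) x = (\<Prod>i\<in>S. apply_smooth (f i) x)"
  by (induction S rule: infinite_finite_induct) (simp_all add: apply_smooth_simps)


section \<open>Superfunctions and Lie derivatives\<close>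

lemma superfun_eqI: "body F = body G \<Longrightarrow> soul F = soul G \<Longrightarrow> F = G"
  by (simp add: superfun.expand)

lemma body_soul_simps [simp]:
  "body 0 = 0" "soul 0 = 0" "body 1 = 1" "soul 1 = 0"
  "body (F + G) = body F + body G" "soul (F + G) = soul F + soul G"
  "body (F - G) = body F - body G" "soul (F - G) = soul F - soul G"
  "body (- F) = - body F" "soul (- F) = - soul F"
  "body (F * G) = body F * body G" "soul (F * G) = body F * soul G + soul F * body G"
  "body (c *\<^sub>R F) = c *\<^sub>R body F" "soul (c *\<^sub>R F) = c *\<^sub>R soul F"
  "body theta = 0" "soul theta = 1"
  "body (parity_sign p F) = body F" "soul (parity_sign p F) = (-1) ^ p *\<^sub>R soul F"
  by (simp_all add: superfun_simps parity_sign_def)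

lemma body_sum [simp]: "body (\<Sum>i\<in>S. f i) = (\<Sum>i\<in>S. body (f i))"
  by (induction S rule: infinite_finite_induct) simp_all

lemma soul_sum [simp]: "soul (\<Sum>i\<in>S. f i) = (\<Sum>i\<in>S. soul (f i))"
  by (induction S rule: infinite_finite_induct) simp_all

text \<open>Any term containing two souls carries \<theta> twice and vanishes, so at most one factor
  contributes its soul.\<close>

lemma prod_SF:
  "finite S \<Longrightarrow> (\<Prod>i\<in>S. SF (u i) (v i)) = SF (\<Prod>i\<in>S. u i) (\<Sum>i\<in>S. v i * (\<Prod>j\<in>S - {i}. u j))"
proof (induction S rule: finite_induct)
  case (insert i S)
  have "insert i S - {j} = insert i (S - {j})" if "j \<in> S" for j
    using that insert.hyps(2) by auto
  with insert show ?case
    by (simp add: times_superfun_def sum_distrib_left mult.left_commute cong: sum.cong)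
qed (simp add: one_superfun_def)

declare gen_fun.simps [simp del]

text \<open>The soul of a density of weight m transforms under aff(1) as a density of weight m +
  1/2, the source of the entries \<epsilon>_i in the weights. X_\<theta> puts the soul into the body
  as it is, and the body into the soul with one derivative; the latter is the shift of \<alpha> in
  \<open>alpha_shift\<close>.\<close>

lemma lie_deriv_gen_fun:
  "lie_deriv m (gen_fun (a, b, c)) F =
    SF (a *\<^sub>R sderiv (body F) + b *\<^sub>R (coord * sderiv (body F) + m *\<^sub>R body F) + (c / 2) *\<^sub>R soul F)
       (a *\<^sub>R sderiv (soul F) + b *\<^sub>R (coord * sderiv (soul F) + (m + 1/2) *\<^sub>R soul F)
        + (c / 2) *\<^sub>R sderiv (body F))"
  by (cases F) (auto intro!: smooth_eqI simp: lie_deriv_def gen_fun.simps superfun_simps apply_smooth_simps field_simps)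

lemma linear_lie_deriv: "linear (lie_deriv m (gen_fun X))"
  by (cases X, rule linearI; rule superfun_eqI) (simp_all add: lie_deriv_gen_fun sderiv_simps algebra_simps)

lemma linear_lie_deriv_gen_fun: "linear (\<lambda>X. lie_deriv m (gen_fun X) F)"
  by (rule linearI; rule superfun_eqI)
    (auto simp: lie_deriv_gen_fun algebra_simps add_divide_distrib)

lemma lie_deriv_bracket:
  assumes "aff_parity p X" "aff_parity q Y"
  shows "lie_deriv m (gen_fun (aff_bracket X Y)) F =
    lie_deriv m (gen_fun X) (lie_deriv m (gen_fun Y) F)
    - (-1) ^ (p * q) *\<^sub>R lie_deriv m (gen_fun Y) (lie_deriv m (gen_fun X) F)"
  using assms
  by (cases X; cases Y; cases "even p"; cases "even q"; intro superfun_eqI)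
    (simp_all add: lie_deriv_gen_fun sderiv_simps,
      (auto intro!: smooth_eqI simp: apply_smooth_simps field_simps))

text \<open>A field of parity q shifts the parity of its argument by q, so moving the sign across it
  costs (-1)^(p q).\<close>

lemma parity_sign_lie_deriv:
  assumes "aff_parity q X"
  shows "parity_sign p (lie_deriv m (gen_fun X) F)
    = (-1) ^ (p * q) *\<^sub>R lie_deriv m (gen_fun X) (parity_sign p F)"
  using assms
  by (cases X; cases "even p"; cases "even q"; intro superfun_eqI)
    (simp_all add: lie_deriv_gen_fun sderiv_simps algebra_simps)

lemma parity_sign_parity_sign: "parity_sign p (parity_sign q F) = parity_sign (p + q) F"
  by (rule superfun_eqI) (simp_all add: power_add)

lemma parity_sign_commute: "parity_sign p (parity_sign q F) = parity_sign q (parity_sign p F)"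
  by (simp add: parity_sign_parity_sign add.commute)

lemma has_parity_lie_deriv:
  "aff_parity p X \<Longrightarrow> has_parity q F \<Longrightarrow> has_parity (p + q) (lie_deriv m (gen_fun X) F)"
  by (cases X; cases "even p"; cases "even q")
    (auto simp: has_parity_def lie_deriv_gen_fun sderiv_simps)

lemma has_parity_parity_sign: "has_parity q F \<Longrightarrow> has_parity q (parity_sign p F)"
  by (auto simp: has_parity_def)

section \<open>Differential operators\<close>

lemma prod_scaleR:
  "(\<Prod>i\<in>S. c i *\<^sub>R f i) = (\<Prod>i\<in>S. c i) *\<^sub>R (\<Prod>i\<in>S. f i)"
  for f :: "'i \<Rightarrow> 'a::{comm_ring_1, real_algebra_1}"
  by (induction S rule: infinite_finite_induct) (simp_all add: mult.commute)

lemma sum_fun_eq: "(\<Sum>i\<in>S. f i) = (\<lambda>x. \<Sum>i\<in>S. f i x)"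
  by (induction S rule: infinite_finite_induct) (auto simp: fun_eq_iff)

definition slot :: "real \<Rightarrow> superfun \<Rightarrow> smooth" where
  "slot e F = (if e = 0 then body F else soul F)"

lemma linear_slot: "linear (slot e)"
  by (rule linearI) (simp_all add: slot_def)

lemma Omega_slot: "Omega \<epsilon> \<alpha> F = SF (\<Prod>i\<in>UNIV. (sderiv ^^ \<alpha> i) (slot (\<epsilon> i) (F i))) 0"
  by (simp add: Omega_def slot_def)

lemma Omega_fun_upd:
  "Omega \<epsilon> \<alpha> (F(i := u)) = SF ((sderiv ^^ \<alpha> i) (slot (\<epsilon> i) u) *
     (\<Prod>j\<in>UNIV - {i}. (sderiv ^^ \<alpha> j) (slot (\<epsilon> j) (F j)))) 0"
  unfolding Omega_slot by (subst prod.remove[of _ i]) (auto intro!: prod.cong)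

lemma soul_Omega [simp]: "soul (Omega \<epsilon> \<alpha> F) = 0"
  by (simp add: Omega_def)

lemma eps_setD: "\<epsilon> \<in> eps_set \<Longrightarrow> \<epsilon> i \<noteq> 0 \<Longrightarrow> \<epsilon> i = 1/2"
  by (auto simp: eps_set_def)

lemma eps_flip_in_eps_set: "\<epsilon> \<in> eps_set \<Longrightarrow> eps_flip \<epsilon> i \<in> eps_set"
  by (auto simp: eps_set_def eps_flip_def)

subsection \<open>The operators \<open>\<Omega>\<close> generate all differential operators\<close>

text \<open>A factor with \<epsilon>_i = 1/2 has lost its soul to \<open>d_theta\<close>; one with
  \<epsilon>_i = 0 may contribute its soul at the price of a \<theta>. As \<theta> squares to 0,
  only single flips occur. The relation is triangular, hence usable in both directions.\<close>

lemma prod_d_x_d_theta: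
  assumes "\<epsilon> \<in> eps_set"
  shows "(\<Prod>i\<in>UNIV. (d_x ^^ \<alpha> i) ((d_theta ^^ (if \<epsilon> i = 0 then 0 else 1)) (F i)))
    = Omega \<epsilon> \<alpha> F + (\<Sum>i | \<epsilon> i = 0. theta * Omega (eps_flip \<epsilon> i) \<alpha> F)"
proof -
  have d_x: "(d_x ^^ k) F = SF ((sderiv ^^ k) (body F)) ((sderiv ^^ k) (soul F))" for k F
    by (induction k) (simp_all add: d_x_def)
  let ?u = "\<lambda>i. (sderiv ^^ \<alpha> i) (slot (\<epsilon> i) (F i))"
  let ?v = "\<lambda>i. if \<epsilon> i = 0 then (sderiv ^^ \<alpha> i) (soul (F i)) else 0"
  have factor: "(d_x ^^ \<alpha> i) ((d_theta ^^ (if \<epsilon> i = 0 then 0 else 1)) (F i)) = SF (?u i) (?v i)" for i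
    by (simp add: d_x d_theta_def slot_def linear_0[OF linear_sderiv_funpow])
  have flip: "?v i * (\<Prod>j\<in>UNIV - {i}. ?u j) = body (Omega (eps_flip \<epsilon> i) \<alpha> F)" if "\<epsilon> i = 0" for i
  proof -
    have "body (Omega (eps_flip \<epsilon> i) \<alpha> F)
      = (sderiv ^^ \<alpha> i) (slot (eps_flip \<epsilon> i i) (F i)) *
        (\<Prod>j\<in>UNIV - {i}. (sderiv ^^ \<alpha> j) (slot (eps_flip \<epsilon> i j) (F j)))"
      unfolding Omega_slot by (subst prod.remove[of _ i]) auto
    also have "\<dots> = ?v i * (\<Prod>j\<in>UNIV - {i}. ?u j)"
      using that by (intro arg_cong2[of _ _ _ _ "(*)"] prod.cong) (auto simp: eps_flip_def slot_def)
    finally show ?thesis by simp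
  qed
  have "(\<Sum>i\<in>UNIV. ?v i * (\<Prod>j\<in>UNIV - {i}. ?u j)) = (\<Sum>i | \<epsilon> i = 0. body (Omega (eps_flip \<epsilon> i) \<alpha> F))"
    (is "?L = ?R")
  proof -
    have "?L = (\<Sum>i | \<epsilon> i = 0. ?v i * (\<Prod>j\<in>UNIV - {i}. ?u j))"
      by (rule sum.mono_neutral_right) auto
    also have "\<dots> = ?R" by (intro sum.cong refl flip) simp
    finally show ?thesis .
  qed
  then show ?thesis
    unfolding factor prod_SF[OF finite]
    by (intro superfun_eqI) (simp_all add: Omega_slot[of \<epsilon>])
qed

abbreviation Omega_ops :: "('n::finite) operator set" where
  "Omega_ops \<equiv> {(\<lambda>F. u * Omega \<epsilon> \<alpha> F) | u \<epsilon> \<alpha>. \<epsilon> \<in> eps_set}"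

lemma mult_in_span:
  fixes A :: "'n operator"
  assumes "\<And>A. A \<in> G \<Longrightarrow> (\<lambda>F. u * A F) \<in> Real_Vector_Spaces.span G" "A \<in> Real_Vector_Spaces.span G"
  shows "(\<lambda>F. u * A F) \<in> Real_Vector_Spaces.span G"
  using assms(2)
proof (induction rule: span_induct_alt)
  case base
  then show ?case using span_zero[of G] by (simp add: zero_fun_def)
next
  case (step c A B)
  then have "c *\<^sub>R (\<lambda>F. u * A F) + (\<lambda>F. u * B F) \<in> Real_Vector_Spaces.span G"
    using assms(1) by (intro span_add span_scale) auto
  then show ?case by (simp add: plus_fun_def scaleR_fun_def algebra_simps)
qed

lemma Omega_in_span:
  "\<epsilon> \<in> eps_set \<Longrightarrow> (\<lambda>F. u * Omega \<epsilon> \<alpha> F) \<in> Real_Vector_Spaces.span Omega_ops"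
  by (rule span_base) blast

text \<open>The triangular relation \<open>prod_d_x_d_theta\<close> changes between the monomials in
  \<open>d_x\<close>, \<open>d_theta\<close> and the operators \<Omega>. Coefficients of the latter
  are unique and aff(1) acts on them one at a time.\<close>

lemma diff_ops_eq: "(diff_ops :: ('n::finite) operator set) = Real_Vector_Spaces.span Omega_ops"
proof
  show "diff_ops \<subseteq> (Real_Vector_Spaces.span Omega_ops :: 'n operator set)"
    unfolding diff_ops_def
  proof (rule span_minimal[OF _ subspace_span], safe)
    fix a and \<alpha> \<beta> :: "'n \<Rightarrow> nat"
    show "(\<lambda>F. a * (\<Prod>i\<in>UNIV. (d_x ^^ \<alpha> i) ((d_theta ^^ \<beta> i) (F i)))) \<in> Real_Vector_Spaces.span Omega_ops"
    proof (cases "\<forall>i. \<beta> i \<le> 1")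
      case True
      define \<epsilon> :: "'n \<Rightarrow> real" where "\<epsilon> i = (if \<beta> i = 0 then 0 else 1/2)" for i
      have \<epsilon>: "\<epsilon> \<in> eps_set" by (simp add: \<epsilon>_def eps_set_def)
      have \<beta>: "\<beta> i = (if \<epsilon> i = 0 then 0 else 1)" for i
        using True[rule_format, of i] by (simp add: \<epsilon>_def)
      have "(\<lambda>F. a * (\<Prod>i\<in>UNIV. (d_x ^^ \<alpha> i) ((d_theta ^^ \<beta> i) (F i))))
        = (\<lambda>F. a * Omega \<epsilon> \<alpha> F) + (\<Sum>i | \<epsilon> i = 0. (\<lambda>F. (a * theta) * Omega (eps_flip \<epsilon> i) \<alpha> F))"
        unfolding \<beta> prod_d_x_d_theta[OF \<epsilon>]
        by (simp add: fun_eq_iff sum_fun_eq distrib_left sum_distrib_left mult.assoc)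
      also have "\<dots> \<in> Real_Vector_Spaces.span Omega_ops"
        by (intro span_add span_sum Omega_in_span eps_flip_in_eps_set \<epsilon>)
      finally show ?thesis .
    next
      \<comment> \<open>\<open>d_theta\<close> squares to zero, so an exponent above 1 kills the
        whole monomial.\<close>
      case False
      then obtain i where i: "\<beta> i > 1" by (auto simp: not_le)
      then obtain k where k: "\<beta> i = Suc (Suc k)" by (auto simp: less_iff_Suc_add)
      have d_theta_0: "(d_theta ^^ k) 0 = 0" for k
        by (induction k) (simp_all add: d_theta_def zero_superfun_def)
      have d_x_0: "(d_x ^^ k) 0 = 0" for k
        by (induction k) (simp_all add: d_x_def zero_superfun_def sderiv_simps)
      have "d_theta (d_theta F) = 0" for F
        by (simp add: d_theta_def zero_superfun_def)
      then have "(d_theta ^^ \<beta> i) F = 0" for F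
        by (simp add: k funpow_Suc_right d_theta_0 del: funpow.simps)
      then have "(\<Prod>i\<in>UNIV. (d_x ^^ \<alpha> i) ((d_theta ^^ \<beta> i) (F i))) = 0" for F
        using d_x_0 by (intro prod_zero bexI[of _ i]) auto
      then show ?thesis using span_zero[of Omega_ops] by (simp add: zero_fun_def)
    qed
  qed
next
  have diff_ops: "Real_Vector_Spaces.subspace (diff_ops :: 'n operator set)"
    unfolding diff_ops_def by (rule subspace_span)
  have monomial: "(\<lambda>F. a * (\<Prod>i\<in>UNIV. (d_x ^^ \<alpha> i) ((d_theta ^^ \<beta> i) (F i)))) \<in> diff_ops"
    for a and \<alpha> \<beta> :: "'n \<Rightarrow> nat"
    unfolding diff_ops_def by (rule span_base) auto
  have mult: "(\<lambda>F. u * A F) \<in> diff_ops" if "A \<in> diff_ops" for A :: "'n operator" and u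
    using that unfolding diff_ops_def
  proof (rule mult_in_span[rotated])
    fix A :: "'n operator"
    assume "A \<in> {\<lambda>F. a * (\<Prod>i\<in>UNIV. (d_x ^^ \<alpha> i) ((d_theta ^^ \<beta> i) (F i))) |a \<alpha> \<beta>. True}"
    then obtain a \<alpha> \<beta> where A: "A = (\<lambda>F. a * (\<Prod>i\<in>UNIV. (d_x ^^ \<alpha> i) ((d_theta ^^ \<beta> i) (F i))))"
      by auto
    show "(\<lambda>F. u * A F) \<in> Real_Vector_Spaces.span
        {\<lambda>F. a * (\<Prod>i\<in>UNIV. (d_x ^^ \<alpha> i) ((d_theta ^^ \<beta> i) (F i))) |a \<alpha> \<beta>. True}"
      using monomial[of "u * a" \<alpha> \<beta>] by (simp add: A mult.assoc diff_ops_def)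
  qed
  \<comment> \<open>The relation is solved for \<Omega> by induction on the number of zero entries
    of \<epsilon>: each correction term has one of them flipped to 1/2.\<close>
  have "Omega \<epsilon> \<alpha> \<in> diff_ops" if "\<epsilon> \<in> eps_set" for \<epsilon> :: "'n \<Rightarrow> real" and \<alpha>
    using that
  proof (induction "card {i. \<epsilon> i = 0}" arbitrary: \<epsilon> rule: less_induct)
    case less
    have "Omega \<epsilon> \<alpha> = (\<lambda>F. 1 * (\<Prod>i\<in>UNIV. (d_x ^^ \<alpha> i) ((d_theta ^^ (if \<epsilon> i = 0 then 0 else 1)) (F i))))
        - (\<Sum>i | \<epsilon> i = 0. (\<lambda>F. theta * Omega (eps_flip \<epsilon> i) \<alpha> F))"
      unfolding prod_d_x_d_theta[OF less.prems] by (simp add: fun_eq_iff sum_fun_eq)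
    also have "\<dots> \<in> diff_ops"
    proof (intro subspace_diff[OF diff_ops] subspace_sum[OF diff_ops] monomial mult less.hyps)
      fix i assume "i \<in> {i. \<epsilon> i = 0}"
      then have "{j. eps_flip \<epsilon> i j = 0} \<subset> {j. \<epsilon> j = 0}"
        by (auto simp: eps_flip_def)
      then show "card {j. eps_flip \<epsilon> i j = 0} < card {j. \<epsilon> j = 0}"
        by (rule psubset_card_mono[OF finite])
    qed (rule eps_flip_in_eps_set[OF less.prems])
    finally show ?case .
  qed
  with mult have "Omega_ops \<subseteq> (diff_ops :: 'n operator set)" by auto
  then show "Real_Vector_Spaces.span Omega_ops \<subseteq> (diff_ops :: 'n operator set)"
    by (rule span_minimal[OF _ diff_ops])
qed

lemma subspace_diff_ops: "Real_Vector_Spaces.subspace diff_ops"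
  unfolding diff_ops_def by (rule subspace_span)

lemmas diff_ops_0 = subspace_0[OF subspace_diff_ops]
  and diff_ops_add = subspace_add[OF subspace_diff_ops]
  and diff_ops_diff = subspace_diff[OF subspace_diff_ops]
  and diff_ops_scaleR = subspace_scale[OF subspace_diff_ops]
  and diff_ops_sum = subspace_sum[OF subspace_diff_ops]

lemma diff_ops_Omega: "\<epsilon> \<in> eps_set \<Longrightarrow> (\<lambda>F. u * Omega \<epsilon> \<alpha> F) \<in> diff_ops"
  unfolding diff_ops_eq by (rule Omega_in_span)

lemma diff_ops_mult: "A \<in> diff_ops \<Longrightarrow> (\<lambda>F. u * A F) \<in> diff_ops"
  unfolding diff_ops_eq
proof (rule mult_in_span[rotated])
  fix A :: "'a operator" assume "A \<in> Omega_ops"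
  then obtain v \<epsilon> \<alpha> where "\<epsilon> \<in> eps_set" "A = (\<lambda>F. v * Omega \<epsilon> \<alpha> F)" by blast
  then show "(\<lambda>F. u * A F) \<in> Real_Vector_Spaces.span Omega_ops"
    using diff_ops_Omega[of \<epsilon> "u * v" \<alpha>] by (simp add: diff_ops_eq mult.assoc)
qed

text \<open>Scalars are absorbed into the coefficient u, so no case for scalar multiples is
  required.\<close>

lemma diff_ops_induct [consumes 1, case_names zero add Omega]:
  assumes "A \<in> diff_ops" "P 0" "\<And>A B. A \<in> diff_ops \<Longrightarrow> B \<in> diff_ops \<Longrightarrow> P A \<Longrightarrow> P B \<Longrightarrow> P (A + B)"
    "\<And>u \<epsilon> \<alpha>. \<epsilon> \<in> eps_set \<Longrightarrow> P (\<lambda>F. u * Omega \<epsilon> \<alpha> F)"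
  shows "P A"
proof -
  from assms(1) have "A \<in> Real_Vector_Spaces.span Omega_ops" by (simp add: diff_ops_eq)
  then have "A \<in> diff_ops \<and> P A"
  proof (induction rule: span_induct_alt)
    case base
    show ?case using assms(2) diff_ops_0 by blast
  next
    case (step c A B)
    then obtain u \<epsilon> \<alpha> where *: "\<epsilon> \<in> eps_set" "A = (\<lambda>F. u * Omega \<epsilon> \<alpha> F)" by blast
    then have "c *\<^sub>R A = (\<lambda>F. (c *\<^sub>R u) * Omega \<epsilon> \<alpha> F)" by (simp add: scaleR_fun_def)
    with * step show ?case using assms(3,4) diff_ops_Omega diff_ops_add by metis
  qed
  then show ?thesis ..
qed

section \<open>The action of aff(1|1) on operators\<close>

definition multilinear_op :: "'n operator \<Rightarrow> bool" where
  "multilinear_op A \<longleftrightarrow> (\<forall>F i. linear (\<lambda>u. A (F(i := u))))"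

lemma multilinear_diff_ops: "A \<in> diff_ops \<Longrightarrow> multilinear_op A"
proof (induction rule: diff_ops_induct)
  case zero
  then show ?case by (simp add: multilinear_op_def zero_fun_def linear_zero)
next
  case (add A B)
  then show ?case by (simp add: multilinear_op_def linear_compose_add)
next
  case (Omega u \<epsilon> \<alpha>)
  have lin: "linear (\<lambda>v. (sderiv ^^ \<alpha> i) (slot (\<epsilon> i) v))" for i
    using linear_compose[OF linear_slot linear_sderiv_funpow] by (simp add: o_def)
  show ?case
    unfolding multilinear_op_def Omega_fun_upd
    by (intro allI linearI superfun_eqI)
      (simp_all add: linear_add[OF lin] linear_scale[OF lin] algebra_simps)
qed

definition lie_arg ::
  "('n \<Rightarrow> real) \<Rightarrow> nat \<Rightarrow> aff11 \<Rightarrow> 'n \<Rightarrow> ('n::linorder \<Rightarrow> superfun) \<Rightarrow> 'n \<Rightarrow> superfun" where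
  "lie_arg lam p X i F = (\<lambda>j. if j < i then parity_sign p (F j)
     else if j = i then lie_deriv (lam i) (gen_fun X) (F i) else F j)"

lemma comp_lie_eq: "comp_lie lam p X A = (\<lambda>F. \<Sum>i\<in>UNIV. A (lie_arg lam p X i F))"
  by (simp add: comp_lie_def lie_arg_def)

text \<open>Confines the dependence on X to one slot, so that multilinearity of A gives linearity in
  X.\<close>

lemma lie_arg_upd:
  "lie_arg lam p X i F = (\<lambda>j. if j < i then parity_sign p (F j) else F j)
     (i := lie_deriv (lam i) (gen_fun X) (F i))"
  by (auto simp: lie_arg_def)

lemma linear_op_action: "linear (op_action lam mu p q X)"
proof (rule linearI)
  show "op_action lam mu p q X (A + B) = op_action lam mu p q X A + op_action lam mu p q X B" for A B
    by (rule ext) (simp add: op_action_def comp_lie_eq linear_add[OF linear_lie_deriv] sum.distrib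
        scaleR_fun_def algebra_simps)
  show "op_action lam mu p q X (c *\<^sub>R A) = c *\<^sub>R op_action lam mu p q X A" for A c
    by (rule ext) (simp add: op_action_def comp_lie_eq linear_scale[OF linear_lie_deriv]
        scaleR_fun_def algebra_simps scaleR_sum_right)
qed

lemmas op_action_add = linear_add[OF linear_op_action]
  and op_action_diff = linear_diff[OF linear_op_action]
  and op_action_scaleR = linear_scale[OF linear_op_action]
  and op_action_0 = linear_0[OF linear_op_action]
  and op_action_sum = linear_sum[OF linear_op_action]

lemma linear_comp_lie_left:
  assumes "multilinear_op A"
  shows "linear (\<lambda>X. comp_lie lam p X A)"
proof (rule linearI)
  have lin: "linear (\<lambda>u. A (F(i := u)))" for F i
    using assms by (simp add: multilinear_op_def)
  show "comp_lie lam p (X + Y) A = comp_lie lam p X A + comp_lie lam p Y A" for X Y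
    by (rule ext) (simp add: comp_lie_eq lie_arg_upd linear_add[OF linear_lie_deriv_gen_fun]
        linear_add[OF lin] sum.distrib)
  show "comp_lie lam p (c *\<^sub>R X) A = c *\<^sub>R comp_lie lam p X A" for X c
    by (rule ext) (simp add: comp_lie_eq lie_arg_upd linear_scale[OF linear_lie_deriv_gen_fun]
        linear_scale[OF lin] scaleR_sum_right scaleR_fun_def)
qed

text \<open>The parity p is an argument of its own, so for fixed p the action is linear on all of
  aff(1|1), even where X does not have parity p.\<close>

lemma linear_op_action_left:
  assumes "A \<in> diff_ops"
  shows "linear (\<lambda>X. op_action lam mu p q X A)"
proof -
  have "linear (\<lambda>X F. lie_deriv mu (gen_fun X) (A F))"
    by (rule linearI)
      (simp_all add: fun_eq_iff scaleR_fun_def linear_add[OF linear_lie_deriv_gen_fun]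
        linear_scale[OF linear_lie_deriv_gen_fun])
  then show ?thesis
    unfolding op_action_def
    by (intro linear_compose_sub linear_compose_scale_right linear_comp_lie_left
        multilinear_diff_ops assms)
qed

lemma op_action_cong_parity:
  "even p = even p' \<Longrightarrow> even q = even q' \<Longrightarrow> op_action lam mu p q X A = op_action lam mu p' q' X A"
proof -
  have *: "(-1) ^ p = ((-1) ^ p' :: real)" if "even p = even p'" for p p' :: nat
    using that by (cases "even p") simp_all
  assume "even p = even p'" "even q = even q'"
  then have "(-1) ^ (p * q) = ((-1) ^ (p' * q') :: real)" and "parity_sign p = parity_sign p'"
    using *[of "p * q" "p' * q'"] *[of p p'] by (auto simp: parity_sign_def fun_eq_iff)
  then show ?thesis unfolding op_action_def comp_lie_eq lie_arg_def by (simp only:)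
qed


subsection \<open>The action is a representation\<close>

text \<open>The two placements differ only in slot k < i, where the Koszul sign of X is applied
  before or after Y; \<open>parity_sign_lie_deriv\<close> supplies the factor.\<close>

lemma lie_arg_commute:
  assumes A: "multilinear_op A" and X: "aff_parity p X" and Y: "aff_parity r Y" and "k < i"
  shows "A (lie_arg lam r Y k (lie_arg lam p X i F)) =
      (-1) ^ (p * r) *\<^sub>R A (lie_arg lam p X i (lie_arg lam r Y k F))"
proof -
  define G where "G = lie_arg lam p X i (lie_arg lam r Y k F)"
  have Gk: "G k = parity_sign p (lie_deriv (lam k) (gen_fun Y) (F k))"
    using \<open>k < i\<close> by (simp add: G_def lie_arg_def)
  have "lie_deriv (lam k) (gen_fun Y) (parity_sign p (F k)) = (-1) ^ (p * r) *\<^sub>R G k"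
    unfolding Gk parity_sign_lie_deriv[OF Y] by (simp flip: power_add mult_2)
  then have "lie_arg lam r Y k (lie_arg lam p X i F) = G(k := (-1) ^ (p * r) *\<^sub>R G k)"
    using \<open>k < i\<close> by (auto simp: G_def lie_arg_def parity_sign_commute)
  then show ?thesis
    using A linear_scale[of "\<lambda>u. A (G(k := u))"] by (simp add: multilinear_op_def flip: G_def)
qed


text \<open>Precomposition reverses the order, so the iterate with Y outermost is A after L_X after
  L_Y. Terms with X and Y in different slots cancel by \<open>lie_arg_commute\<close>; those in the
  same slot combine to the bracket.\<close>

lemma comp_lie_bracket:
  assumes A: "multilinear_op A" and X: "aff_parity p X" and Y: "aff_parity r Y"
  shows "comp_lie lam (p + r) (aff_bracket X Y) A =
    comp_lie lam r Y (comp_lie lam p X A) - (-1) ^ (p * r) *\<^sub>R comp_lie lam p X (comp_lie lam r Y A)"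
proof
  fix F
  let ?s = "(-1) ^ (p * r) :: real"
  let ?XY = "\<lambda>i k. A (lie_arg lam p X i (lie_arg lam r Y k F))"
  let ?YX = "\<lambda>i k. A (lie_arg lam r Y k (lie_arg lam p X i F))"
  have off: "?XY i k = ?s *\<^sub>R ?YX i k" if "i \<noteq> k" for i k
  proof (cases "k < i")
    case True
    then show ?thesis
      by (simp add: lie_arg_commute[OF A X Y] flip: power_add mult_2)
  next
    case False
    with that have "i < k" by simp
    then show ?thesis
      by (simp add: lie_arg_commute[OF A Y X] mult.commute)
  qed
  have diag: "?XY i i - ?s *\<^sub>R ?YX i i = A (lie_arg lam (p + r) (aff_bracket X Y) i F)" for i
  proof -
    define G where "G = (\<lambda>j. if j < i then parity_sign (p + r) (F j) else F j)"
    have "lie_arg lam p X i (lie_arg lam r Y i F)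
        = G(i := lie_deriv (lam i) (gen_fun X) (lie_deriv (lam i) (gen_fun Y) (F i)))"
      "lie_arg lam r Y i (lie_arg lam p X i F)
        = G(i := lie_deriv (lam i) (gen_fun Y) (lie_deriv (lam i) (gen_fun X) (F i)))"
      by (auto simp: G_def lie_arg_def parity_sign_parity_sign add.commute)
    moreover have "lie_arg lam (p + r) (aff_bracket X Y) i F
        = G(i := lie_deriv (lam i) (gen_fun (aff_bracket X Y)) (F i))"
      by (simp add: G_def lie_arg_upd)
    moreover have lin: "linear (\<lambda>u. A (G(i := u)))"
      using A by (simp add: multilinear_op_def)
    ultimately show ?thesis
      by (simp only: lie_deriv_bracket[OF X Y] linear_diff[OF lin] linear_scale[OF lin])
  qed
  have "(comp_lie lam r Y (comp_lie lam p X A)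
      - ?s *\<^sub>R comp_lie lam p X (comp_lie lam r Y A)) F
    = (\<Sum>k\<in>UNIV. \<Sum>i\<in>UNIV. ?XY i k) - ?s *\<^sub>R (\<Sum>i\<in>UNIV. \<Sum>k\<in>UNIV. ?YX i k)"
    by (simp add: comp_lie_eq scaleR_fun_def)
  also have "(\<Sum>k\<in>UNIV. \<Sum>i\<in>UNIV. ?XY i k) = (\<Sum>i\<in>UNIV. \<Sum>k\<in>UNIV. ?XY i k)"
    by (rule sum.swap)
  also have "\<dots> - ?s *\<^sub>R (\<Sum>i\<in>UNIV. \<Sum>k\<in>UNIV. ?YX i k)
    = (\<Sum>i\<in>UNIV. \<Sum>k\<in>UNIV. ?XY i k - ?s *\<^sub>R ?YX i k)"
    by (simp add: sum_subtractf scaleR_sum_right)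
  also have "\<dots> = (\<Sum>i\<in>UNIV. \<Sum>k\<in>{i}. ?XY i k - ?s *\<^sub>R ?YX i k)"
    by (rule sum.cong[OF refl], rule sum.mono_neutral_right) (simp_all add: off)
  also have "\<dots> = comp_lie lam (p + r) (aff_bracket X Y) A F"
    by (simp add: diag comp_lie_eq)
  finally show "comp_lie lam (p + r) (aff_bracket X Y) A F = (comp_lie lam r Y (comp_lie lam p X A)
      - ?s *\<^sub>R comp_lie lam p X (comp_lie lam r Y A)) F" by simp
qed

lemma op_action_bracket:
  assumes A: "multilinear_op A" and X: "aff_parity p X" and Y: "aff_parity r Y"
  shows "op_action lam mu (p + r) q (aff_bracket X Y) A =
    op_action lam mu p (r + q) X (op_action lam mu r q Y A)
    - (-1) ^ (p * r) *\<^sub>R op_action lam mu r (p + q) Y (op_action lam mu p q X A)"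
proof
  fix F
  let ?LX = "lie_deriv mu (gen_fun X)" and ?LY = "lie_deriv mu (gen_fun Y)"
  let ?CX = "comp_lie lam p X" and ?CY = "comp_lie lam r Y"
  have X1: "op_action lam mu p (r + q) X (op_action lam mu r q Y A) F =
    ?LX (?LY (A F)) - (-1) ^ (r * q) *\<^sub>R ?LX (?CY A F)
    - (-1) ^ (p * (r + q)) *\<^sub>R (?CX (\<lambda>F. ?LY (A F)) F - (-1) ^ (r * q) *\<^sub>R ?CX (?CY A) F)"
    by (simp add: op_action_def linear_diff[OF linear_lie_deriv] linear_scale[OF linear_lie_deriv]
        scaleR_fun_def comp_lie_eq[of lam p X] sum_subtractf scaleR_sum_right[symmetric])
  have X2: "op_action lam mu r (p + q) Y (op_action lam mu p q X A) F =
    ?LY (?LX (A F)) - (-1) ^ (p * q) *\<^sub>R ?LY (?CX A F)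
    - (-1) ^ (r * (p + q)) *\<^sub>R (?CY (\<lambda>F. ?LX (A F)) F - (-1) ^ (p * q) *\<^sub>R ?CY (?CX A) F)"
    by (simp add: op_action_def linear_diff[OF linear_lie_deriv] linear_scale[OF linear_lie_deriv]
        scaleR_fun_def comp_lie_eq[of lam r Y] sum_subtractf scaleR_sum_right[symmetric])
  \<comment> \<open>Composition on the left commutes with composition on the right, so the mixed
    terms cancel and only the two brackets remain.\<close>
  have swap: "?CX (\<lambda>F. ?LY (A F)) F = ?LY (?CX A F)" "?CY (\<lambda>F. ?LX (A F)) F = ?LX (?CY A F)"
    by (simp_all add: comp_lie_eq linear_sum[OF linear_lie_deriv])
  have X0: "op_action lam mu (p + r) q (aff_bracket X Y) A F =
    ?LX (?LY (A F)) - (-1) ^ (p * r) *\<^sub>R ?LY (?LX (A F))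
    - (-1) ^ ((p + r) * q) *\<^sub>R (?CY (?CX A) F - (-1) ^ (p * r) *\<^sub>R ?CX (?CY A) F)"
    by (simp add: op_action_def lie_deriv_bracket[OF X Y] comp_lie_bracket[OF A X Y] scaleR_fun_def)
  show "op_action lam mu (p + r) q (aff_bracket X Y) A F =
    (op_action lam mu p (r + q) X (op_action lam mu r q Y A)
    - (-1) ^ (p * r) *\<^sub>R op_action lam mu r (p + q) Y (op_action lam mu p q X A)) F"
    by (simp add: X0 X1 X2 swap scaleR_fun_def, cases "even p"; cases "even q"; cases "even r")
      (simp_all add: algebra_simps)
qed

subsection \<open>The action in terms of the operators \<open>\<Omega>\<close>\<close>

text \<open>The number 2|\<epsilon>| as a natural number, which is also the parity of
  \<Omega>.\<close>

definition eps_parity :: "('n::finite \<Rightarrow> real) \<Rightarrow> nat" where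
  "eps_parity \<epsilon> = card {i. \<epsilon> i \<noteq> 0}"

lemma eps_sum:
  assumes "\<epsilon> \<in> eps_set" "finite S"
  shows "(\<Sum>i\<in>S. \<epsilon> i) = real (card {i\<in>S. \<epsilon> i \<noteq> 0}) / 2"
proof -
  have "(\<Sum>i\<in>S. \<epsilon> i) = (\<Sum>i\<in>{i\<in>S. \<epsilon> i \<noteq> 0}. \<epsilon> i)"
    by (rule sum.mono_neutral_right) (use assms in auto)
  also have "\<dots> = (\<Sum>i\<in>{i\<in>S. \<epsilon> i \<noteq> 0}. 1 / 2)"
    by (intro sum.cong) (auto dest: eps_setD[OF assms(1)])
  finally show ?thesis by simp
qed

lemma eps_sum_UNIV: "\<epsilon> \<in> eps_set \<Longrightarrow> (\<Sum>i\<in>UNIV. \<epsilon> i) = real (eps_parity \<epsilon>) / 2"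
  by (simp add: eps_sum eps_parity_def)

lemma prod_sign: "finite S \<Longrightarrow> (\<Prod>i\<in>S. if P i then 1 else - 1) = (-1 :: real) ^ card {i\<in>S. \<not> P i}"
  by (subst prod.If_cases) (auto simp: Int_def conj_commute)

lemma xi_sign_eq: "\<epsilon> \<in> eps_set \<Longrightarrow> xi_sign \<epsilon> i = (\<Prod>j | j < i. if \<epsilon> j = 0 then 1 else - 1)"
  by (simp add: xi_sign_def prod_sign eps_sum)

text \<open>Chosen so that mu - \<open>weight\<close> is \<delta>_\<epsilon> - |\<alpha>|: the
  condition |\<alpha>| = \<delta>_\<epsilon> says that the weight is mu.\<close>

definition weight :: "('n::finite \<Rightarrow> real) \<Rightarrow> ('n \<Rightarrow> real) \<Rightarrow> ('n \<Rightarrow> nat) \<Rightarrow> real" where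
  "weight lam \<epsilon> \<alpha> = (\<Sum>i\<in>UNIV. lam i + \<epsilon> i + real (\<alpha> i))"

lemma lie_arg_even: "even p \<Longrightarrow> lie_arg lam p X i F = F(i := lie_deriv (lam i) (gen_fun X) (F i))"
  by (auto simp: lie_arg_def parity_sign_def intro!: superfun_eqI)

text \<open>On the fields \<open>X\<^sub>h\<close> with \<open>h \<in> Span(1, x)\<close>, the Leibniz rule makes \<open>\<Omega>\<close> equivariant
  up to the change of weights.\<close>

lemma comp_lie_Omega_even:
  assumes \<epsilon>: "\<epsilon> \<in> eps_set" and p: "even p"
  shows "(\<Sum>i\<in>UNIV. Omega \<epsilon> \<alpha> (lie_arg lam p (a, b, 0) i F))
    = lie_deriv (weight lam \<epsilon> \<alpha>) (gen_fun (a, b, 0)) (Omega \<epsilon> \<alpha> F)"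
proof -
  let ?h = "\<lambda>i. (sderiv ^^ \<alpha> i) (slot (\<epsilon> i) (F i))"
  let ?P = "\<Prod>j\<in>UNIV. ?h j"
  have slot: "slot (\<epsilon> i) (lie_deriv (lam i) (gen_fun (a, b, 0)) (F i)) =
      a *\<^sub>R sderiv (slot (\<epsilon> i) (F i))
      + b *\<^sub>R (coord * sderiv (slot (\<epsilon> i) (F i)) + (lam i + \<epsilon> i) *\<^sub>R slot (\<epsilon> i) (F i))" for i
    using eps_setD[OF \<epsilon>, of i] by (auto simp: slot_def lie_deriv_gen_fun)
  have factor: "(sderiv ^^ \<alpha> i) (slot (\<epsilon> i) (lie_deriv (lam i) (gen_fun (a, b, 0)) (F i))) =
      a *\<^sub>R sderiv (?h i) + b *\<^sub>R (coord * sderiv (?h i) + (lam i + \<epsilon> i + real (\<alpha> i)) *\<^sub>R ?h i)" for i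
    by (simp add: slot linear_add[OF linear_sderiv_funpow] linear_scale[OF linear_sderiv_funpow]
        sderiv_funpow_coord algebra_simps flip: funpow_swap1)
  have "body (Omega \<epsilon> \<alpha> (lie_arg lam p (a, b, 0) i F)) =
      a *\<^sub>R (sderiv (?h i) * (\<Prod>j\<in>UNIV - {i}. ?h j))
      + b *\<^sub>R (coord * (sderiv (?h i) * (\<Prod>j\<in>UNIV - {i}. ?h j))
      + (lam i + \<epsilon> i + real (\<alpha> i)) *\<^sub>R ?P)" for i
  proof -
    have "?P = ?h i * (\<Prod>j\<in>UNIV - {i}. ?h j)" by (rule prod.remove) auto
    then show ?thesis
      unfolding lie_arg_even[OF p] Omega_fun_upd factor by (simp add: algebra_simps)
  qed
  then have "body (\<Sum>i\<in>UNIV. Omega \<epsilon> \<alpha> (lie_arg lam p (a, b, 0) i F)) =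
      a *\<^sub>R sderiv ?P + b *\<^sub>R (coord * sderiv ?P + weight lam \<epsilon> \<alpha> *\<^sub>R ?P)"
    by (simp add: sum.distrib sderiv_prod[OF finite] weight_def
        flip: scaleR_sum_right scaleR_sum_left sum_distrib_left)
  then show ?thesis
    by (intro superfun_eqI)
      (simp_all add: lie_deriv_gen_fun linear_0[OF linear_sderiv] Omega_slot[of \<epsilon> \<alpha> F])
qed

lemma lie_deriv_mult:
  "lie_deriv (l + m) (gen_fun (a, b, 0)) (F * G) =
    lie_deriv l (gen_fun (a, b, 0)) F * G + F * lie_deriv m (gen_fun (a, b, 0)) G"
  by (rule superfun_eqI)
    (simp_all add: lie_deriv_gen_fun sderiv_simps algebra_simps)

text \<open>Since \<Omega> intertwines aff(1) with densities of weight \<open>weight\<close>, the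
  action on u \<Omega> reduces to that on u as a density of the complementary weight. In particular
  X_1 just differentiates coefficients.\<close>

lemma op_action_Omega_even:
  assumes "\<epsilon> \<in> eps_set" "even p"
  shows "op_action lam mu p q (a, b, 0) (\<lambda>F. u * Omega \<epsilon> \<alpha> F) =
    (\<lambda>F. lie_deriv (mu - weight lam \<epsilon> \<alpha>) (gen_fun (a, b, 0)) u * Omega \<epsilon> \<alpha> F)"
proof
  fix F
  have "op_action lam mu p q (a, b, 0) (\<lambda>F. u * Omega \<epsilon> \<alpha> F) F =
    lie_deriv ((mu - weight lam \<epsilon> \<alpha>) + weight lam \<epsilon> \<alpha>) (gen_fun (a, b, 0)) (u * Omega \<epsilon> \<alpha> F)
    - u * (\<Sum>i\<in>UNIV. Omega \<epsilon> \<alpha> (lie_arg lam p (a, b, 0) i F))"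
    using assms(2) by (simp add: op_action_def comp_lie_eq sum_distrib_left)
  also have "\<dots> = lie_deriv (mu - weight lam \<epsilon> \<alpha>) (gen_fun (a, b, 0)) u * Omega \<epsilon> \<alpha> F"
    unfolding comp_lie_Omega_even[OF assms] lie_deriv_mult by simp
  finally show "op_action lam mu p q (a, b, 0) (\<lambda>F. u * Omega \<epsilon> \<alpha> F) F = \<dots>" .
qed

text \<open>X_\<theta> in slot i exchanges body and soul there, which flips \<epsilon>_i. Each
  earlier slot that reads a soul contributes -1, and together these make \<xi>.\<close>

lemma comp_lie_Omega_odd:
  assumes \<epsilon>: "\<epsilon> \<in> eps_set" and p: "odd p"
  shows "Omega \<epsilon> \<alpha> (lie_arg lam p (0, 0, c) i F)
    = (xi_sign \<epsilon> i * (c / 2)) *\<^sub>R Omega (eps_flip \<epsilon> i) (alpha_shift \<epsilon> \<alpha> i) F"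
proof -
  \<comment> \<open>The scalar produced by slot j: a Koszul sign before i, the factor of the field
    at i, and 1 after it.\<close>
  define s where "s j = (if j < i then if \<epsilon> j = 0 then 1 else - 1 else if j = i then c / 2 else 1)" for j
  have "(sderiv ^^ \<alpha> j) (slot (\<epsilon> j) (lie_arg lam p (0, 0, c) i F j))
    = s j *\<^sub>R (sderiv ^^ alpha_shift \<epsilon> \<alpha> i j) (slot (eps_flip \<epsilon> i j) (F j))" for j
    using p eps_setD[OF \<epsilon>, of i]
    by (auto simp: s_def lie_arg_def slot_def alpha_shift_def eps_flip_def lie_deriv_gen_fun
        linear_neg[OF linear_sderiv_funpow] linear_scale[OF linear_sderiv_funpow] funpow_swap1)
  moreover have "(\<Prod>j\<in>UNIV. s j) = xi_sign \<epsilon> i * (c / 2)"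
  proof -
    have "(\<Prod>j\<in>UNIV. s j) = (\<Prod>j\<in>insert i {j. j < i}. s j)"
      by (rule prod.mono_neutral_right) (auto simp: s_def)
    also have "\<dots> = (c / 2) * (\<Prod>j | j < i. if \<epsilon> j = 0 then 1 else - 1)"
      by (subst prod.insert) (auto simp: s_def intro!: prod.cong)
    finally show ?thesis by (simp add: xi_sign_eq[OF \<epsilon>])
  qed
  ultimately show ?thesis
    by (simp add: Omega_slot prod_scaleR scaleR_superfun_def)
qed

section \<open>Stability of differential operators and of parity under the action\<close>

lemma diff_ops_op_action_even:
  assumes "A \<in> diff_ops" "even p"
  shows "op_action lam mu p q (a, b, 0) A \<in> diff_ops"
  using assms(1)
  by (induction rule: diff_ops_induct)
    (simp_all only: op_action_0 op_action_add diff_ops_0 diff_ops_add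
      op_action_Omega_even[OF _ assms(2)] diff_ops_Omega)

lemma diff_ops_op_action_odd:
  assumes "A \<in> diff_ops" "odd p"
  shows "op_action lam mu p q (0, 0, c) A \<in> diff_ops"
  using assms(1)
proof (induction rule: diff_ops_induct)
  case zero
  then show ?case by (simp only: op_action_0 diff_ops_0)
next
  case (add A B)
  then show ?case by (simp only: op_action_add diff_ops_add)
next
  case (Omega u \<epsilon> \<alpha>)
  \<comment> \<open>The first two lines are the Lie derivative of the value u \<Omega>, the second
    collecting the derivative of \<Omega> by the Leibniz rule; the rest is the precomposition
    term.\<close>
  let ?A = "(\<lambda>F. ((c / 2) *\<^sub>R SF (soul u) (sderiv (body u))) * Omega \<epsilon> \<alpha> F)
    + (\<Sum>i\<in>UNIV. (\<lambda>F. ((c / 2) *\<^sub>R SF 0 (body u)) * Omega \<epsilon> (\<alpha>(i := Suc (\<alpha> i))) F))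
    - ((-1) ^ (p * q) :: real) *\<^sub>R (\<Sum>i\<in>UNIV. (\<lambda>F. ((xi_sign \<epsilon> i * (c / 2)) *\<^sub>R u)
        * Omega (eps_flip \<epsilon> i) (alpha_shift \<epsilon> \<alpha> i) F))"
  have deriv: "sderiv (body (Omega \<epsilon> \<alpha> F)) = (\<Sum>i\<in>UNIV. body (Omega \<epsilon> (\<alpha>(i := Suc (\<alpha> i))) F))" for F
  proof -
    have "body (Omega \<epsilon> (\<alpha>(i := Suc (\<alpha> i))) F) = sderiv ((sderiv ^^ \<alpha> i) (slot (\<epsilon> i) (F i))) *
        (\<Prod>j\<in>UNIV - {i}. (sderiv ^^ \<alpha> j) (slot (\<epsilon> j) (F j)))" for i
      unfolding Omega_slot by (subst prod.remove[of _ i]) (auto intro!: prod.cong)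
    then show ?thesis by (simp add: Omega_slot sderiv_prod)
  qed
  have "op_action lam mu p q (0, 0, c) (\<lambda>F. u * Omega \<epsilon> \<alpha> F) F = ?A F" for F
    by (intro superfun_eqI)
      (simp_all add: op_action_def comp_lie_eq comp_lie_Omega_odd[OF Omega \<open>odd p\<close>] lie_deriv_gen_fun
        sderiv_simps deriv sum_fun_eq scaleR_fun_def algebra_simps
        flip: sum_distrib_left scaleR_sum_right)
  then have "op_action lam mu p q (0, 0, c) (\<lambda>F. u * Omega \<epsilon> \<alpha> F) = ?A" ..
  also have "\<dots> \<in> diff_ops"
    by (intro diff_ops_add diff_ops_diff diff_ops_sum diff_ops_scaleR diff_ops_Omega
        eps_flip_in_eps_set Omega)
  finally show ?case .
qed

lemma aff_parity_cases:
  assumes "aff_parity p X"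
  obtains a b where "even p" "X = (a, b, 0)" | c where "odd p" "X = (0, 0, c)"
  using assms by (cases X; cases "even p") auto

lemma diff_ops_op_action:
  assumes "A \<in> diff_ops" "aff_parity p X"
  shows "op_action lam mu p q X A \<in> diff_ops"
  using assms(2)
  by (cases rule: aff_parity_cases) (auto intro: diff_ops_op_action_even diff_ops_op_action_odd assms)

lemma op_parity_op_action:
  fixes A :: "('n::{finite,linorder}) operator"
  assumes A: "op_parity q A" and X: "aff_parity p X"
  shows "op_parity (p + q) (op_action lam mu p q X A)"
  unfolding op_parity_def
proof (intro allI impI)
  fix F :: "'n \<Rightarrow> superfun" and r assume F: "\<forall>i. has_parity (r i) (F i)"
  let ?n = "\<Sum>i\<in>UNIV. r i"
  have diff: "has_parity m (G - c *\<^sub>R H)" if "has_parity m G" "has_parity m H" for m G H c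
    using that by (auto simp: has_parity_def split: if_splits)
  have sum: "has_parity m (\<Sum>i\<in>S. G i)" if "\<And>i. has_parity m (G i)" for m G S
    using that by (auto simp: has_parity_def intro!: sum.neutral split: if_splits)
  have "has_parity (p + (q + ?n)) (lie_deriv mu (gen_fun X) (A F))"
    using A F by (intro has_parity_lie_deriv[OF X]) (auto simp: op_parity_def)
  moreover have "has_parity (q + (p + ?n)) (A (lie_arg lam p X i F))" for i
  proof -
    have "has_parity ((r(i := p + r i)) j) (lie_arg lam p X i F j)" for j
      using F has_parity_lie_deriv[OF X] by (auto simp: lie_arg_def has_parity_parity_sign)
    moreover have "(\<Sum>j\<in>UNIV. (r(i := p + r i)) j) = p + ?n"
    proof -
      have "(\<Sum>j\<in>UNIV. (r(i := p + r i)) j) = (p + r i) + (\<Sum>j\<in>UNIV - {i}. r j)"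
        by (subst sum.remove[of _ i]) auto
      moreover have "?n = r i + (\<Sum>j\<in>UNIV - {i}. r j)"
        by (subst sum.remove[of _ i]) auto
      ultimately show ?thesis by simp
    qed
    ultimately show ?thesis using A unfolding op_parity_def by metis
  qed
  ultimately show "has_parity (p + q + ?n) (op_action lam mu p q X A F)"
    unfolding op_action_def comp_lie_eq fun_diff_def scaleR_fun_def
    by (intro diff sum) (simp_all add: add_ac)
qed

text \<open>If some slot vanishes, the value is 0 and has both parities. Otherwise \<epsilon> forces
  the parity of every argument, and the total agrees with 2|\<epsilon>| modulo 2.\<close>

lemma op_parity_Omega:
  fixes \<epsilon> :: "'n::finite \<Rightarrow> real"
  assumes \<epsilon>: "\<epsilon> \<in> eps_set" and u: "has_parity r u"
  shows "op_parity (r + eps_parity \<epsilon>) (\<lambda>F. u * Omega \<epsilon> \<alpha> F)"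
  unfolding op_parity_def
proof (intro allI impI)
  fix F :: "'n \<Rightarrow> superfun" and q assume F: "\<forall>i. has_parity (q i) (F i)"
  show "has_parity (r + eps_parity \<epsilon> + (\<Sum>i\<in>UNIV. q i)) (u * Omega \<epsilon> \<alpha> F)"
  proof (cases "\<exists>i. slot (\<epsilon> i) (F i) = 0")
    case True
    then obtain i where "slot (\<epsilon> i) (F i) = 0" ..
    then have "(\<Prod>i\<in>UNIV. (sderiv ^^ \<alpha> i) (slot (\<epsilon> i) (F i))) = 0"
      by (intro prod_zero bexI[of _ i]) (simp_all add: linear_0[OF linear_sderiv_funpow])
    then show ?thesis by (simp add: Omega_slot has_parity_def)
  next
    case False
    then have "even (q i) \<longleftrightarrow> \<epsilon> i = 0" for i
      using F by (auto simp: slot_def has_parity_def split: if_splits)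
    then have "even (q i + (if \<epsilon> i \<noteq> 0 then 1 else 0))" for i by auto
    then have "even (\<Sum>i\<in>UNIV. q i + (if \<epsilon> i \<noteq> 0 then 1 else 0))"
      by (intro dvd_sum)
    then have "even ((\<Sum>i\<in>UNIV. q i) + eps_parity \<epsilon>)"
      by (simp add: sum.distrib eps_parity_def sum.If_cases Compl_eq)
    then show ?thesis using u by (cases "even r") (auto simp: has_parity_def)
  qed
qed

section \<open>Coefficients of differential operators\<close>

text \<open>The homogeneous test argument dual at the point t to the operator with indices
  \<epsilon>, \<alpha>.\<close>

definition probe :: "real \<Rightarrow> ('n \<Rightarrow> real) \<Rightarrow> ('n \<Rightarrow> nat) \<Rightarrow> 'n \<Rightarrow> superfun" where
  "probe t \<epsilon> \<alpha> i =
     (if \<epsilon> i = 0 then SF (shifted_power t (\<alpha> i)) 0 else SF 0 (shifted_power t (\<alpha> i)))"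

lemma Omega_probe:
  assumes "\<epsilon> \<in> eps_set" "\<epsilon>' \<in> eps_set"
  shows "apply_smooth (body (Omega \<epsilon>' \<alpha>' (probe t \<epsilon> \<alpha>))) t = (if \<epsilon>' = \<epsilon> \<and> \<alpha>' = \<alpha> then 1 else 0)"
proof -
  have factor: "apply_smooth ((sderiv ^^ \<alpha>' i) (slot (\<epsilon>' i) (probe t \<epsilon> \<alpha> i))) t =
      (if \<epsilon>' i = \<epsilon> i \<and> \<alpha>' i = \<alpha> i then 1 else 0)" for i
    using eps_setD[OF assms(1), of i] eps_setD[OF assms(2), of i]
    by (auto simp: slot_def probe_def sderiv_funpow_shifted_power apply_shifted_power
        linear_0[OF linear_sderiv_funpow] apply_smooth_simps)
  have eq: "apply_smooth (body (Omega \<epsilon>' \<alpha>' (probe t \<epsilon> \<alpha>))) t =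
      (\<Prod>i\<in>UNIV. if \<epsilon>' i = \<epsilon> i \<and> \<alpha>' i = \<alpha> i then 1 else 0)"
    by (simp add: Omega_slot apply_smooth_prod factor)
  show ?thesis
  proof (cases "\<epsilon>' = \<epsilon> \<and> \<alpha>' = \<alpha>")
    case False
    then obtain i where "\<not> (\<epsilon>' i = \<epsilon> i \<and> \<alpha>' i = \<alpha> i)" by fastforce
    then have "(\<Prod>i\<in>UNIV. if \<epsilon>' i = \<epsilon> i \<and> \<alpha>' i = \<alpha> i then 1 else 0 :: real) = 0"
      by (intro prod_zero bexI[of _ i]) simp_all
    with False eq show ?thesis by simp
  next
    case True
    then show ?thesis unfolding eq by simp
  qed
qed

lemma has_parity_probe: "has_parity (if \<epsilon> i = 0 then 0 else 1) (probe t \<epsilon> \<alpha> i)"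
  by (simp add: has_parity_def probe_def)

lemma sum_probe_parity: "(\<Sum>i\<in>UNIV. if \<epsilon> i = 0 then 0 else 1) = eps_parity \<epsilon>"
  by (simp add: eps_parity_def sum.If_cases Compl_eq)

abbreviation expansion ::
  "(('n \<Rightarrow> real) \<times> ('n \<Rightarrow> nat)) set \<Rightarrow> (('n \<Rightarrow> real) \<times> ('n \<Rightarrow> nat) \<Rightarrow> superfun) \<Rightarrow> ('n::finite) operator"
  where "expansion S u \<equiv> (\<Sum>s\<in>S. (\<lambda>F. u s * Omega (fst s) (snd s) F))"

lemma diff_ops_expansion:
  assumes "A \<in> diff_ops"
  obtains S u where "finite S" "S \<subseteq> eps_set \<times> UNIV" "A = expansion S u"
proof -
  from assms have "\<exists>S u. finite S \<and> S \<subseteq> eps_set \<times> UNIV \<and> A = expansion S u"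
  proof (induction rule: diff_ops_induct)
    case zero
    show ?case by (intro exI[of _ "{}"]) simp
  next
    case (add A B)
    then obtain S u T v where
      S: "finite S" "S \<subseteq> eps_set \<times> UNIV" "A = expansion S u" and
      T: "finite T" "T \<subseteq> eps_set \<times> UNIV" "B = expansion T v" by blast
    \<comment> \<open>Coefficients are extended by zero to the union of the supports, where they can
      be added.\<close>
    let ?u = "\<lambda>s. if s \<in> S then u s else 0" and ?v = "\<lambda>s. if s \<in> T then v s else 0"
    have "A = expansion (S \<union> T) ?u" "B = expansion (S \<union> T) ?v"
      using S(1) T(1) unfolding S(3) T(3)
      by (auto intro!: sum.mono_neutral_cong_left simp: zero_fun_def)
    then have "A + B = expansion (S \<union> T) (\<lambda>s. ?u s + ?v s)"
      by (simp add: distrib_right sum_fun_eq sum.distrib plus_fun_def)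
    with S T show ?case by (intro exI[of _ "S \<union> T"] exI[of _ "\<lambda>s. ?u s + ?v s"]) blast
  next
    case (Omega u \<epsilon> \<alpha>)
    then show ?case by (intro exI[of _ "{(\<epsilon>, \<alpha>)}"] exI[of _ "\<lambda>_. u"]) simp
  qed
  with that show ?thesis by blast
qed

text \<open>By duality a probe centred at t isolates one coefficient at t. Varying t recovers the
  whole coefficient, hence its uniqueness and its parity.\<close>

lemma expansion_probe:
  assumes "finite S" "S \<subseteq> eps_set \<times> UNIV" "s \<in> S"
  shows "apply_smooth (body (expansion S u (probe t (fst s) (snd s)))) t = apply_smooth (body (u s)) t"
    and "apply_smooth (soul (expansion S u (probe t (fst s) (snd s)))) t = apply_smooth (soul (u s)) t"
proof -
  have *: "apply_smooth (body (Omega (fst r) (snd r) (probe t (fst s) (snd s)))) t = (if r = s then 1 else 0)"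
    if "r \<in> S" for r
    using that assms by (subst Omega_probe) (auto simp: prod_eq_iff)
  show "apply_smooth (body (expansion S u (probe t (fst s) (snd s)))) t = apply_smooth (body (u s)) t"
    and "apply_smooth (soul (expansion S u (probe t (fst s) (snd s)))) t = apply_smooth (soul (u s)) t"
    using assms by (simp_all add: sum_fun_eq apply_smooth_sum apply_smooth_simps * if_distrib cong: sum.cong if_cong)
qed

lemma expansion_eq_0:
  assumes "finite S" "S \<subseteq> eps_set \<times> UNIV" "s \<in> S" "expansion S u = 0"
  shows "u s = 0"
  using expansion_probe[OF assms(1-3), of u] unfolding assms(4)
  by (intro superfun_eqI smooth_eqI) (simp_all add: zero_fun_def apply_smooth_simps)

lemma has_parity_expansion:
  assumes "finite S" "S \<subseteq> eps_set \<times> UNIV" "s \<in> S" "op_parity p (expansion S u)"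
  shows "has_parity (p + eps_parity (fst s)) (u s)"
proof -
  have "has_parity (p + eps_parity (fst s)) (expansion S u (probe t (fst s) (snd s)))" for t
    using assms(4) has_parity_probe[of "fst s" _ t "snd s"] unfolding op_parity_def
    by (metis (no_types, lifting) sum_probe_parity)
  with expansion_probe[OF assms(1-3), of u] show ?thesis
    by (auto simp: has_parity_def apply_smooth_simps intro!: smooth_eqI split: if_splits)
qed

section \<open>Parity of operators as a linear condition\<close>

lemma subspace_op_parity: "Real_Vector_Spaces.subspace {A. op_parity p A}"
  by (rule subspaceI)
    (auto simp: op_parity_def has_parity_def scaleR_fun_def split: if_splits)

lemmas op_parity_0 = subspace_0[OF subspace_op_parity, simplified]
  and op_parity_add = subspace_add[OF subspace_op_parity, simplified]
  and op_parity_scaleR = subspace_scale[OF subspace_op_parity, simplified]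
  and op_parity_sum = subspace_sum[OF subspace_op_parity, simplified]

lemma op_parity_cong: "even p = even q \<Longrightarrow> op_parity p = op_parity q"
  by (auto simp: op_parity_def has_parity_def fun_eq_iff)

text \<open>Each coefficient would be both even and odd. This separates the homogeneous parts of a
  cocycle from its values.\<close>

lemma op_parity_both:
  assumes A: "A \<in> diff_ops" "op_parity 0 A" "op_parity (Suc 0) A"
  shows "A = 0"
proof -
  obtain S u where S: "finite S" "S \<subseteq> eps_set \<times> UNIV" "A = expansion S u"
    using diff_ops_expansion[OF A(1)] .
  have "u s = 0" if s: "s \<in> S" for s
  proof -
    have "has_parity (0 + eps_parity (fst s)) (u s)" "has_parity (Suc 0 + eps_parity (fst s)) (u s)"
      by (fact has_parity_expansion[OF S(1,2) s A(2)[unfolded S(3)]]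
          has_parity_expansion[OF S(1,2) s A(3)[unfolded S(3)]])+
    then show ?thesis
      by (intro superfun_eqI) (auto simp: has_parity_def split: if_splits)
  qed
  then show ?thesis unfolding S(3) by (intro sum.neutral) (simp add: zero_fun_def)
qed

section \<open>Operators annihilated by \<open>X\<^sub>1\<close> and \<open>X\<^sub>\<theta>\<close>\<close>

text \<open>X_1 differentiates the coefficients in the \<Omega> expansion, so it is enough to
  integrate each of them.\<close>

lemma op_action_1_surj:
  assumes A: "A \<in> diff_ops" "op_parity p A"
  obtains v where "v \<in> diff_ops" "op_parity p v" "op_action lam mu 0 q (1, 0, 0) v = A"
proof -
  obtain S u where S: "finite S" "S \<subseteq> eps_set \<times> UNIV" "A = expansion S u"
    using diff_ops_expansion[OF A(1)] .
  have "\<exists>w. has_parity (p + eps_parity (fst s)) w \<and> (\<forall>m. lie_deriv m (gen_fun (1, 0, 0)) w = u s)"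
    if "s \<in> S" for s
  proof -
    obtain f g where fg: "sderiv f = body (u s)" "sderiv g = soul (u s)"
      using sderiv_surj by meson
    have "has_parity (p + eps_parity (fst s)) (u s)"
      using has_parity_expansion[OF S(1,2) that] A(2) by (simp add: S(3))
    \<comment> \<open>Using \<open>SF f g\<close> could spoil the parity, because the chosen
      antiderivative of a vanishing component may be a nonzero constant.\<close>
    with fg show ?thesis
      by (intro exI[of _ "if even (p + eps_parity (fst s)) then SF f 0 else SF 0 g"])
        (auto simp: has_parity_def lie_deriv_gen_fun sderiv_simps intro!: superfun_eqI split: if_splits)
  qed
  then obtain w where w: "\<And>s. s \<in> S \<Longrightarrow> has_parity (p + eps_parity (fst s)) (w s)"
    "\<And>s m. s \<in> S \<Longrightarrow> lie_deriv m (gen_fun (1, 0, 0)) (w s) = u s"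
    by metis
  show ?thesis
  proof (rule that[of "expansion S w"])
    show "expansion S w \<in> diff_ops"
      using S(2) by (intro diff_ops_sum diff_ops_Omega) auto
    show "op_parity p (expansion S w)"
    proof (rule op_parity_sum)
      fix s assume s: "s \<in> S"
      then have "op_parity (p + eps_parity (fst s) + eps_parity (fst s)) (\<lambda>F. w s * Omega (fst s) (snd s) F)"
        using S(2) by (intro op_parity_Omega w(1)) auto
      then show "op_parity p (\<lambda>F. w s * Omega (fst s) (snd s) F)"
        by (subst op_parity_cong[of _ "p + eps_parity (fst s) + eps_parity (fst s)"]) auto
    qed
    show "op_action lam mu 0 q (1, 0, 0) (expansion S w) = A"
      unfolding op_action_sum S(3)
    proof (rule sum.cong[OF refl])
      fix s assume s: "s \<in> S"
      then have "fst s \<in> eps_set" using S(2) by auto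
      then show "op_action lam mu 0 q (1, 0, 0) (\<lambda>F. w s * Omega (fst s) (snd s) F)
          = (\<lambda>F. u s * Omega (fst s) (snd s) F)"
        by (simp add: op_action_Omega_even w(2)[OF s])
    qed
  qed
qed

lemma body_op_action_theta:
  assumes "odd p"
  shows "body (op_action lam mu p q (0, 0, 1) A F) = (1/2) *\<^sub>R soul (A F)
    - (-1) ^ (p * q) *\<^sub>R (\<Sum>i\<in>UNIV. body (A (lie_arg lam p (0, 0, 1) i F)))"
  by (simp add: op_action_def comp_lie_eq lie_deriv_gen_fun scaleR_fun_def)

text \<open>By \<open>body_op_action_theta\<close> the body of X_\<theta> acting on A is half the
  soul of A plus terms in the body of A. When the bodies vanish, so must the soul.\<close>

lemma theta_invariant_eq_0:
  assumes "\<And>F. body (A F) = 0" "op_action lam mu (Suc 0) q (0, 0, 1) A = 0"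
  shows "A = 0"
proof (rule ext, rule superfun_eqI)
  fix F
  show "soul (A F) = soul (0 F)"
    using body_op_action_theta[of "Suc 0" lam mu q A F] by (simp add: assms zero_fun_def)
qed (simp add: assms zero_fun_def)

text \<open>For an odd field the bracket with itself is twice its square, and
  [X_\<theta>, X_\<theta>] = X_1 / 2; hence 1/4.\<close>

lemma op_action_theta_theta:
  assumes "A \<in> diff_ops"
  shows "op_action lam mu (Suc 0) (Suc q) (0, 0, 1) (op_action lam mu (Suc 0) q (0, 0, 1) A)
    = (1/4) *\<^sub>R op_action lam mu 0 q (1, 0, 0) A"
proof -
  have "op_action lam mu (Suc 0 + Suc 0) q (aff_bracket (0, 0, 1) (0, 0, 1)) A
    = (1/2) *\<^sub>R op_action lam mu 0 q (1, 0, 0) A"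
    using linear_scale[OF linear_op_action_left[OF assms], of lam mu 0 q "1/2" "(1, 0, 0)"]
    by (subst op_action_cong_parity[of _ 0 q q]) simp_all
  moreover have "op_action lam mu (Suc 0 + Suc 0) q (aff_bracket (0, 0, 1) (0, 0, 1)) A
    = 2 *\<^sub>R op_action lam mu (Suc 0) (Suc q) (0, 0, 1) (op_action lam mu (Suc 0) q (0, 0, 1) A)"
    by (subst op_action_bracket[OF multilinear_diff_ops[OF assms]]) (simp_all add: scaleR_2)
  ultimately have "2 *\<^sub>R op_action lam mu (Suc 0) (Suc q) (0, 0, 1) (op_action lam mu (Suc 0) q (0, 0, 1) A)
      = (1/2) *\<^sub>R op_action lam mu 0 q (1, 0, 0) A" by simp
  then have "(1/2) *\<^sub>R 2 *\<^sub>R op_action lam mu (Suc 0) (Suc q) (0, 0, 1) (op_action lam mu (Suc 0) q (0, 0, 1) A)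
      = (1/2) *\<^sub>R (1/2) *\<^sub>R op_action lam mu 0 q (1, 0, 0) A" by (rule arg_cong)
  then show ?thesis by simp
qed

lemma op_action_x_theta:
  assumes "A \<in> diff_ops"
  shows "op_action lam mu 0 (Suc q) (0, 1, 0) (op_action lam mu (Suc 0) q (0, 0, 1) A)
    - op_action lam mu (Suc 0) q (0, 0, 1) (op_action lam mu 0 q (0, 1, 0) A)
    = (- 1/2) *\<^sub>R op_action lam mu (Suc 0) q (0, 0, 1) A"
proof -
  have "op_action lam mu (0 + Suc 0) q (aff_bracket (0, 1, 0) (0, 0, 1)) A
      = (- 1/2) *\<^sub>R op_action lam mu (Suc 0) q (0, 0, 1) A"
    using linear_scale[OF linear_op_action_left[OF assms], of lam mu "Suc 0" q "- 1/2" "(0, 0, 1)"]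
    by simp
  then show ?thesis
    by (subst (asm) op_action_bracket[OF multilinear_diff_ops[OF assms]]) simp_all
qed

text \<open>The soul is the only one for which the body of X_\<theta> acting on the operator
  vanishes, given the body \<Omega>: the factors 1/2 in \<open>body_op_action_theta\<close> and
  \<open>comp_lie_Omega_odd\<close> cancel and the signs are left.\<close>

definition Gamma_op :: "('n \<Rightarrow> real) \<times> ('n \<Rightarrow> nat) \<Rightarrow> ('n::{finite,linorder}) operator" where
  "Gamma_op s = (\<lambda>F. Omega (fst s) (snd s) F + (-1) ^ eps_parity (fst s) *\<^sub>R
     (theta * (\<Sum>i\<in>UNIV. xi_sign (fst s) i *\<^sub>R
       Omega (eps_flip (fst s) i) (alpha_shift (fst s) (snd s) i) F)))"

lemma body_Gamma_op: "body (Gamma_op s F) = body (Omega (fst s) (snd s) F)"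
  by (simp add: Gamma_op_def)

lemma Gamma_op_eq:
  "Gamma_op s = (\<lambda>F. 1 * Omega (fst s) (snd s) F) + (\<Sum>i\<in>UNIV.
     (\<lambda>F. (((-1) ^ eps_parity (fst s) * xi_sign (fst s) i) *\<^sub>R theta)
       * Omega (eps_flip (fst s) i) (alpha_shift (fst s) (snd s) i) F))"
  by (rule ext, rule superfun_eqI)
    (simp_all add: Gamma_op_def sum_fun_eq scaleR_sum_right)

context
  fixes s :: "('n::{finite,linorder} \<Rightarrow> real) \<times> ('n \<Rightarrow> nat)" and lam :: "'n \<Rightarrow> real" and mu :: real
  assumes s: "fst s \<in> eps_set"
begin

lemma diff_ops_Gamma_op: "Gamma_op s \<in> diff_ops"
  unfolding Gamma_op_eq by (intro diff_ops_add diff_ops_sum diff_ops_Omega eps_flip_in_eps_set s)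

lemma op_parity_Gamma_op: "op_parity (eps_parity (fst s)) (Gamma_op s)"
  unfolding Gamma_op_eq
proof (intro op_parity_add op_parity_sum)
  show "op_parity (eps_parity (fst s)) (\<lambda>F. 1 * Omega (fst s) (snd s) F)"
    using op_parity_Omega[OF s, of 0 1] by (simp add: has_parity_def)
  fix i
  have flip: "even (eps_parity (eps_flip (fst s) i)) \<longleftrightarrow> odd (eps_parity (fst s))"
  proof (cases "fst s i = 0")
    case True
    then have "{j. eps_flip (fst s) i j \<noteq> 0} = insert i {j. fst s j \<noteq> 0}"
      by (auto simp: eps_flip_def)
    with True show ?thesis by (simp add: eps_parity_def)
  next
    case False
    then have "{j. fst s j \<noteq> 0} = insert i {j. eps_flip (fst s) i j \<noteq> 0}" "eps_flip (fst s) i i = 0"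
      using eps_setD[OF s] by (auto simp: eps_flip_def)
    then show ?thesis by (simp add: eps_parity_def)
  qed
  have "op_parity (1 + eps_parity (eps_flip (fst s) i))
     (\<lambda>F. (((-1) ^ eps_parity (fst s) * xi_sign (fst s) i) *\<^sub>R theta)
       * Omega (eps_flip (fst s) i) (alpha_shift (fst s) (snd s) i) F)"
    by (intro op_parity_Omega eps_flip_in_eps_set s) (simp add: has_parity_def)
  then show "op_parity (eps_parity (fst s))
     (\<lambda>F. (((-1) ^ eps_parity (fst s) * xi_sign (fst s) i) *\<^sub>R theta)
       * Omega (eps_flip (fst s) i) (alpha_shift (fst s) (snd s) i) F)"
    by (subst op_parity_cong[of _ "1 + eps_parity (eps_flip (fst s) i)"]) (use flip in simp_all)
qed

lemma op_action_1_Gamma_op: "op_action lam mu 0 q (1, 0, 0) (Gamma_op s) = 0"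
proof -
  have "lie_deriv m (gen_fun (1, 0, 0)) 1 = 0" "lie_deriv m (gen_fun (1, 0, 0)) (c *\<^sub>R theta) = 0" for m c
    by (intro superfun_eqI; simp add: lie_deriv_gen_fun sderiv_simps)+
  then show ?thesis
    unfolding Gamma_op_eq op_action_add op_action_sum op_action_Omega_even[OF s dvd_0_right]
      op_action_Omega_even[OF eps_flip_in_eps_set[OF s] dvd_0_right]
    by (simp add: zero_fun_def sum_fun_eq plus_fun_def)
qed

text \<open>The body of the result vanishes by the choice of the soul of \<open>Gamma_op\<close>.
  The soul is not computed: a second application of X_\<theta> gives X_1 / 4, which is zero on
  constant coefficients.\<close>

lemma op_action_theta_Gamma_op:
  assumes "even q = even (eps_parity (fst s))"
  shows "op_action lam mu (Suc 0) q (0, 0, 1) (Gamma_op s) = 0"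
proof (rule theta_invariant_eq_0)
  fix F
  have "(-1) ^ q = ((-1) ^ eps_parity (fst s) :: real)"
    using assms by (cases "even q") simp_all
  then show "body (op_action lam mu (Suc 0) q (0, 0, 1) (Gamma_op s) F) = 0"
    by (simp add: body_op_action_theta body_Gamma_op comp_lie_Omega_odd[OF s] Gamma_op_def
        scaleR_sum_right)
  show "op_action lam mu (Suc 0) (Suc q) (0, 0, 1) (op_action lam mu (Suc 0) q (0, 0, 1) (Gamma_op s)) = 0"
    by (simp only: op_action_theta_theta[OF diff_ops_Gamma_op] op_action_1_Gamma_op scaleR_zero_right)
qed

text \<open>On bodies this is the weight rule for \<Omega>. It extends to souls because
  [X_x, X_\<theta>] is a multiple of X_\<theta>, so both sides are killed by X_\<theta>.\<close>

lemma op_action_x_Gamma_op: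
  "op_action lam mu 0 q (0, 1, 0) (Gamma_op s) = (mu - weight lam (fst s) (snd s)) *\<^sub>R Gamma_op s"
proof -
  let ?m = "mu - weight lam (fst s) (snd s)" and ?p = "eps_parity (fst s)"
  let ?R = "op_action lam mu 0 q (0, 1, 0) (Gamma_op s) - ?m *\<^sub>R Gamma_op s"
  have "?R = 0"
  proof (rule theta_invariant_eq_0)
    fix F
    show "body (?R F) = 0"
      unfolding Gamma_op_eq op_action_add op_action_sum op_action_Omega_even[OF s dvd_0_right]
        op_action_Omega_even[OF eps_flip_in_eps_set[OF s] dvd_0_right]
      by (simp add: sum_fun_eq scaleR_fun_def lie_deriv_gen_fun sderiv_simps)
    have "op_action lam mu (Suc 0) ?p (0, 0, 1) (op_action lam mu 0 ?p (0, 1, 0) (Gamma_op s)) = 0"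
      using op_action_x_theta[OF diff_ops_Gamma_op, of lam mu ?p]
      by (simp only: op_action_theta_Gamma_op[OF refl] op_action_0 scaleR_zero_right diff_0 neg_equal_0_iff_equal)
    \<comment> \<open>For an even field the sign is 1, so the label q may be replaced by the parity
      at which invariance under X_\<theta> is known.\<close>
    moreover have "op_action lam mu 0 q (0, 1, 0) (Gamma_op s) = op_action lam mu 0 ?p (0, 1, 0) (Gamma_op s)"
      by (simp add: op_action_def)
    ultimately show "op_action lam mu (Suc 0) ?p (0, 0, 1) ?R = 0"
      by (simp only: op_action_diff op_action_scaleR op_action_theta_Gamma_op[OF refl]
          scaleR_zero_right diff_0_right)
  qed
  then show ?thesis by simp
qed

end

text \<open>Invariance under X_1 makes the bodies of the coefficients constant. The combination of
  \<open>Gamma_op\<close> with these constants has the same bodies as A and is also killed by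
  X_\<theta>, hence equals A.\<close>

lemma invariant_expansion:
  assumes A: "A \<in> diff_ops" "op_parity p A"
    and inv: "op_action lam mu 0 p (1, 0, 0) A = 0" "op_action lam mu (Suc 0) p (0, 0, 1) A = 0"
  obtains S c where "finite S" "S \<subseteq> {s. fst s \<in> eps_set \<and> even (eps_parity (fst s)) = even p}"
    "A = (\<Sum>s\<in>S. c s *\<^sub>R Gamma_op s)"
proof -
  obtain S u where S: "finite S" "S \<subseteq> eps_set \<times> UNIV" "A = expansion S u"
    using diff_ops_expansion[OF A(1)] .
  have "op_action lam mu 0 p (1, 0, 0) A = expansion S (\<lambda>s. d_x (u s))"
    unfolding S(3) op_action_sum
    by (rule sum.cong[OF refl], subst op_action_Omega_even)
      (use S(2) in \<open>auto simp: lie_deriv_gen_fun d_x_def\<close>)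
  then have "expansion S (\<lambda>s. d_x (u s)) = 0" using inv(1) by simp
  then have "d_x (u s) = 0" if "s \<in> S" for s
    using expansion_eq_0[OF S(1,2) that, of "\<lambda>s. d_x (u s)"] by blast
  then have "\<exists>c. body (u s) = c *\<^sub>R 1" if "s \<in> S" for s
    using that by (intro sderiv_eq_0) (simp add: d_x_def zero_superfun_def)
  then obtain c where c: "\<And>s. s \<in> S \<Longrightarrow> body (u s) = c s *\<^sub>R 1" by metis
  let ?T = "{s \<in> S. even (eps_parity (fst s)) = even p}"
  \<comment> \<open>For \<epsilon> of the opposite parity the coefficient is odd, a multiple of
    \<theta>.\<close>
  have body_0: "body (u s) = 0" if "s \<in> S - ?T" for s
    using has_parity_expansion[OF S(1,2), of s p u] that A(2) unfolding S(3)
    by (auto simp: has_parity_def)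
  have T: "fst s \<in> eps_set" "even p = even (eps_parity (fst s))" if "s \<in> ?T" for s
    using that S(2) by auto
  have "A - (\<Sum>s\<in>?T. c s *\<^sub>R Gamma_op s) = 0"
  proof (rule theta_invariant_eq_0)
    fix F
    have "body (A F) = (\<Sum>s\<in>S. body (u s) * body (Omega (fst s) (snd s) F))"
      by (simp add: S(3) sum_fun_eq)
    also have "\<dots> = (\<Sum>s\<in>?T. body (u s) * body (Omega (fst s) (snd s) F))"
      using S(1) body_0 by (intro sum.mono_neutral_right) auto
    also have "\<dots> = (\<Sum>s\<in>?T. c s *\<^sub>R body (Omega (fst s) (snd s) F))"
      by (intro sum.cong) (simp_all add: c)
    finally show "body ((A - (\<Sum>s\<in>?T. c s *\<^sub>R Gamma_op s)) F) = 0"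
      by (simp add: sum_fun_eq scaleR_fun_def body_Gamma_op)
    have "op_action lam mu (Suc 0) p (0, 0, 1) (c s *\<^sub>R Gamma_op s) = 0" if "s \<in> ?T" for s
      by (simp only: op_action_scaleR op_action_theta_Gamma_op[OF T[OF that]] scaleR_zero_right)
    then show "op_action lam mu (Suc 0) p (0, 0, 1) (A - (\<Sum>s\<in>?T. c s *\<^sub>R Gamma_op s)) = 0"
      by (simp add: op_action_diff op_action_sum inv(2))
  qed
  then have "A = (\<Sum>s\<in>?T. c s *\<^sub>R Gamma_op s)" by (simp only: right_minus_eq)
  moreover have "?T \<subseteq> {s. fst s \<in> eps_set \<and> even (eps_parity (fst s)) = even p}"
    using T(1) by blast
  ultimately show ?thesis using that[of ?T c] S(1) by simp
qed

section \<open>Coboundaries and cocycles\<close>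

text \<open>The formula for \<partial>v on homogeneous fields, extended to all fields: the sign
  (-1)^(|g| p) is 1 on the even part and (-1)^p on the odd part.\<close>

definition coboundary ::
  "('n \<Rightarrow> real) \<Rightarrow> real \<Rightarrow> nat \<Rightarrow> ('n::{finite,linorder}) operator \<Rightarrow> 'n cochain" where
  "coboundary lam mu p v = (\<lambda>(a, b, c). op_action lam mu 0 p (a, b, 0) v
     + (-1) ^ p *\<^sub>R op_action lam mu (Suc 0) p (0, 0, c) v)"

lemma scaleR_fun_apply: "(r *\<^sub>R f) x = r *\<^sub>R f x"
  by (simp add: scaleR_fun_def)

lemma op_action_zero_field: "A \<in> diff_ops \<Longrightarrow> op_action lam mu p q (0, 0, 0) A = 0"
  using linear_0[OF linear_op_action_left, of A lam mu p q] by (simp add: zero_prod_def)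

lemma coboundary_homogeneous:
  assumes v: "v \<in> diff_ops" and g: "aff_parity q g"
  shows "coboundary lam mu p v g = (-1) ^ (q * p) *\<^sub>R op_action lam mu q p g v"
  using g
proof (cases rule: aff_parity_cases)
  case (1 a b)
  then show ?thesis
    by (simp add: coboundary_def op_action_zero_field[OF v] del: One_nat_def)
      (rule op_action_cong_parity; simp)
next
  case (2 c)
  then have "op_action lam mu q p g v = op_action lam mu (Suc 0) p g v" "(-1) ^ (q * p) = ((-1) ^ p :: real)"
    by (intro op_action_cong_parity, simp_all) (cases "even p"; simp)
  with 2 show ?thesis
    by (simp add: coboundary_def op_action_zero_field[OF v])
qed

lemma linear_coboundary_left:
  assumes v: "v \<in> diff_ops"
  shows "linear (coboundary lam mu p v)"
proof (rule linearI)
  fix X Y :: aff11 and r :: real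
  obtain a b c a' b' c' where XY: "X = (a, b, c)" "Y = (a', b', c')"
    by (cases X; cases Y)
  have add: "op_action lam mu q p (a + a', b + b', c + c') v =
      op_action lam mu q p (a, b, c) v + op_action lam mu q p (a', b', c') v" for q a b c a' b' c'
    using linear_add[OF linear_op_action_left[OF v], of lam mu q p "(a, b, c)" "(a', b', c')"] by simp
  have scale: "op_action lam mu q p (r * a, r * b, r * c) v = r *\<^sub>R op_action lam mu q p (a, b, c) v" for q a b c
    using linear_scale[OF linear_op_action_left[OF v], of lam mu q p r "(a, b, c)"] by simp
  show "coboundary lam mu p v (X + Y) = coboundary lam mu p v X + coboundary lam mu p v Y"
    using add[of 0 a a' b b' 0 0] add[of "Suc 0" 0 0 0 0 c c']
    by (simp add: XY coboundary_def algebra_simps)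
  show "coboundary lam mu p v (r *\<^sub>R X) = r *\<^sub>R coboundary lam mu p v X"
    using scale[of 0 a b 0] scale[of "Suc 0" 0 0 c]
    by (simp add: XY coboundary_def algebra_simps)
qed

lemma linear_coboundary:
  fixes lam :: "'n::{finite,linorder} \<Rightarrow> real"
  shows "linear (coboundary lam mu p)"
proof (rule linearI; rule ext)
  fix u v :: "'n operator" and r :: real and X :: aff11
  show "coboundary lam mu p (u + v) X = (coboundary lam mu p u + coboundary lam mu p v) X"
    by (cases X) (simp add: coboundary_def op_action_add scaleR_add_right)
  show "coboundary lam mu p (r *\<^sub>R u) X = (r *\<^sub>R coboundary lam mu p u) X"
    by (cases X) (simp add: coboundary_def op_action_scaleR scaleR_add_right scaleR_fun_apply mult.commute)
qed

lemma aff11_eq_add: "(a, b, c) = (a, b, 0) + (0, 0, c)"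
  for a b c :: real
  by simp

lemma hom_coboundaries_eq:
  "hom_coboundaries lam mu p = coboundary lam mu p ` {v \<in> diff_ops. op_parity p v}"
proof (intro subset_antisym subsetI)
  fix c assume "c \<in> hom_coboundaries lam mu p"
  then obtain v where c: "linear c" and v: "v \<in> diff_ops" "op_parity p v"
    and eq: "\<And>q g. aff_parity q g \<Longrightarrow> c g = (-1) ^ (q * p) *\<^sub>R op_action lam mu q p g v"
    unfolding hom_coboundaries_def by blast
  have hom: "c g = coboundary lam mu p v g" if "aff_parity q g" for q g
    using eq[OF that] coboundary_homogeneous[OF v(1) that] by simp
  have "c g = coboundary lam mu p v g" for g
  proof (cases g)
    case (fields x y z)
    show ?thesis
      unfolding fields aff11_eq_add[of x y z] linear_add[OF c] linear_add[OF linear_coboundary_left[OF v(1)]]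
      by (intro arg_cong2[of _ _ _ _ "(+)"] hom[of 0] hom[of 1]) simp_all
  qed
  then show "c \<in> coboundary lam mu p ` {v \<in> diff_ops. op_parity p v}" using v by blast
next
  fix c assume "c \<in> coboundary lam mu p ` {v \<in> diff_ops. op_parity p v}"
  then show "c \<in> hom_coboundaries lam mu p"
    unfolding hom_coboundaries_def
    using coboundary_homogeneous linear_coboundary_left by blast
qed

lemma subspace_hom_coboundaries:
  fixes lam :: "'n::{finite,linorder} \<Rightarrow> real"
  shows "Real_Vector_Spaces.subspace (hom_coboundaries lam mu p)"
proof -
  have "{v :: 'n operator. v \<in> diff_ops \<and> op_parity p v} = diff_ops \<inter> {v. op_parity p v}" by blast
  then show ?thesis
    unfolding hom_coboundaries_eq
    by (simp only: linear_subspace_image[OF linear_coboundary] subspace_inter subspace_diff_ops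
        subspace_op_parity)
qed

lemma aff_parity_bracket:
  "aff_parity q g \<Longrightarrow> aff_parity r h \<Longrightarrow> aff_parity (q + r) (aff_bracket g h)"
  by (cases g; cases h; cases "even q"; cases "even r") auto

text \<open>Up to signs, the cocycle condition for \<partial>v is the representation property
  \<open>op_action_bracket\<close>.\<close>

lemma hom_coboundaries_subset: "hom_coboundaries lam mu p \<subseteq> hom_cocycles lam mu p"
proof
  fix c assume "c \<in> hom_coboundaries lam mu p"
  then obtain v where v: "v \<in> diff_ops" "op_parity p v" and c: "c = coboundary lam mu p v"
    unfolding hom_coboundaries_eq by blast
  note hom = coboundary_homogeneous[OF v(1)]
  have "c g \<in> diff_ops" for g
    by (cases g) (simp add: c coboundary_def diff_ops_add diff_ops_scaleR diff_ops_op_action v)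
  then have "c \<in> cochains"
    by (simp add: cochains_def c linear_coboundary_left v)
  moreover have "cochain_parity p c"
    unfolding cochain_parity_def
  proof (intro allI impI)
    fix q g assume g: "aff_parity q g"
    then show "op_parity (p + q) (c g)"
      unfolding c hom[OF g] add.commute[of p q] by (intro op_parity_scaleR op_parity_op_action v)
  qed
  moreover have "(-1) ^ (q * p) *\<^sub>R op_action lam mu q (p + r) g (c h)
        - (-1) ^ (r * (q + p)) *\<^sub>R op_action lam mu r (p + q) h (c g) - c (aff_bracket g h) = 0"
    if g: "aff_parity q g" and h: "aff_parity r h" for q r g h
  proof -
    let ?G = "op_action lam mu q (r + p) g (op_action lam mu r p h v)"
    let ?H = "op_action lam mu r (q + p) h (op_action lam mu q p g v)"
    have "c (aff_bracket g h) = (-1) ^ ((q + r) * p) *\<^sub>R (?G - (-1) ^ (q * r) *\<^sub>R ?H)"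
      unfolding c hom[OF aff_parity_bracket[OF g h]]
      by (subst op_action_bracket[OF multilinear_diff_ops[OF v(1)] g h]) simp
    moreover have "op_action lam mu q (p + r) g (c h) = (-1) ^ (r * p) *\<^sub>R ?G"
      "op_action lam mu r (p + q) h (c g) = (-1) ^ (q * p) *\<^sub>R ?H"
      unfolding c hom[OF g] hom[OF h] by (simp_all only: op_action_scaleR add.commute)
    ultimately show ?thesis
      by (cases "even p"; cases "even q"; cases "even r") simp_all
  qed
  ultimately show "c \<in> hom_cocycles lam mu p"
    unfolding hom_cocycles_def by blast
qed

lemma subspace_cochains:
  "Real_Vector_Spaces.subspace (cochains :: ('n::finite) cochain set)"
  by (rule subspaceI)
    (simp_all add: cochains_def linear_iff diff_ops_0 diff_ops_add diff_ops_scaleR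
      scaleR_fun_apply scaleR_add_right mult.commute)

lemma linear_cocycle_condition:
  "linear (\<lambda>c. s *\<^sub>R op_action lam mu q p' g (c h) - t *\<^sub>R op_action lam mu r p'' h (c g) - c k)"
  by (rule linearI)
    (simp_all add: op_action_add op_action_scaleR scaleR_add_right scaleR_diff_right mult.commute
      scaleR_fun_apply)

lemma subspace_INT:
  "(\<And>i. i \<in> I \<Longrightarrow> Real_Vector_Spaces.subspace (f i)) \<Longrightarrow> Real_Vector_Spaces.subspace (\<Inter>i\<in>I. f i)"
  by (auto simp: Real_Vector_Spaces.subspace_def)

lemma subspace_hom_cocycles:
  fixes lam :: "'n::{finite,linorder} \<Rightarrow> real"
  shows "Real_Vector_Spaces.subspace (hom_cocycles lam mu p)"
proof -
  have "hom_cocycles lam mu p = cochains \<inter> {c. cochain_parity p c} \<inter>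
     (\<Inter>q. \<Inter>r. \<Inter>g\<in>{g. aff_parity q g}. \<Inter>h\<in>{h. aff_parity r h}.
        {c. (-1) ^ (q * p) *\<^sub>R op_action lam mu q (p + r) g (c h)
        - (-1) ^ (r * (q + p)) *\<^sub>R op_action lam mu r (p + q) h (c g)
        - c (aff_bracket g h) = 0})"
    unfolding hom_cocycles_def by blast
  moreover have "Real_Vector_Spaces.subspace {c :: 'n cochain. cochain_parity p c}"
    by (rule subspaceI)
      (simp_all add: cochain_parity_def scaleR_fun_apply op_parity_0
        op_parity_add op_parity_scaleR)
  ultimately show ?thesis
    by (simp only:) (intro subspace_inter subspace_cochains subspace_INT
        linear_subspace_kernel[OF linear_cocycle_condition])
qed

section \<open>Reduction of cocycles to normal form\<close>

lemma aff11_eq_lincomb: "(a, b, c) = a *\<^sub>R (1, 0, 0) + b *\<^sub>R (0, 1, 0) + c *\<^sub>R (0, 0, 1)"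
  for a b c :: real
  by simp

lemma cochain_eq_0:
  fixes c :: "'n cochain"
  assumes "linear c" "c (1, 0, 0) = 0" "c (0, 1, 0) = 0" "c (0, 0, 1) = 0"
  shows "c = 0"
proof
  fix X :: aff11
  obtain x y z where "X = (x, y, z)" by (cases X)
  then have "c X = x *\<^sub>R c (1, 0, 0) + y *\<^sub>R c (0, 1, 0) + z *\<^sub>R c (0, 0, 1)"
    by (simp only: aff11_eq_lincomb[of x y z] linear_add[OF assms(1)] linear_scale[OF assms(1)])
  then show "c X = 0 X" by (simp add: assms(2-4))
qed

lemma linear_fun_diff: "linear f \<Longrightarrow> linear g \<Longrightarrow> linear (f - g)"
  using linear_compose_sub[of f g] by (simp add: fun_diff_def)

lemma coboundary_values:
  assumes "v \<in> diff_ops"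
  shows "coboundary lam mu p v (1, 0, 0) = op_action lam mu 0 p (1, 0, 0) v"
    "coboundary lam mu p v (0, 1, 0) = op_action lam mu 0 p (0, 1, 0) v"
    "coboundary lam mu p v (0, 0, 1) = (-1) ^ p *\<^sub>R op_action lam mu (Suc 0) p (0, 0, 1) v"
  using assms by (simp_all add: coboundary_def op_action_zero_field)

text \<open>The component \<open>fst (snd X)\<close> is h' for h = a + b x. This is the extension of
  \<Gamma> by zero on X_\<theta>, used as the standard representative.\<close>

definition basic_cocycle ::
  "('n \<Rightarrow> real) \<times> ('n \<Rightarrow> nat) \<Rightarrow> ('n::{finite,linorder}) cochain" where
  "basic_cocycle s = (\<lambda>X. fst (snd X) *\<^sub>R Gamma_op s)"

lemma linear_basic_cocycle: "linear (basic_cocycle s)"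
  by (rule linearI) (simp_all add: basic_cocycle_def scaleR_add_left)

lemma sum_basic_cocycle:
  "(\<Sum>s\<in>S. a s *\<^sub>R basic_cocycle s) = (\<lambda>X. fst (snd X) *\<^sub>R (\<Sum>s\<in>S. a s *\<^sub>R Gamma_op s))"
  by (subst sum_fun_eq) (simp add: scaleR_fun_apply basic_cocycle_def scaleR_sum_right mult.commute)

context
  fixes lam :: "'n::{finite,linorder} \<Rightarrow> real" and mu :: real
begin

lemma hom_cocyclesD:
  assumes "c \<in> hom_cocycles lam mu p"
  shows "linear c" "c g \<in> diff_ops" "aff_parity q g \<Longrightarrow> op_parity (p + q) (c g)"
    "aff_parity q g \<Longrightarrow> aff_parity r h \<Longrightarrow>
        (-1) ^ (q * p) *\<^sub>R op_action lam mu q (p + r) g (c h)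
        - (-1) ^ (r * (q + p)) *\<^sub>R op_action lam mu r (p + q) h (c g)
        = c (aff_bracket g h)"
  using assms unfolding hom_cocycles_def cochains_def cochain_parity_def right_minus_eq
  by blast+

lemma coboundary_in_cocycles:
  "v \<in> diff_ops \<Longrightarrow> op_parity p v \<Longrightarrow> coboundary lam mu p v \<in> hom_cocycles lam mu p"
  using hom_coboundaries_subset hom_coboundaries_eq by blast

lemma op_parity_theta_mult:
  assumes "op_parity (p + 1) A"
  shows "op_parity p (\<lambda>F. theta * A F)"
  using assms by (auto simp: op_parity_def has_parity_def split: if_splits)

text \<open>The conditions for (X_1, X_\<theta>) and (X_\<theta>, X_\<theta>) say that X_1 and
  X_\<theta> annihilate B = c(X_\<theta>), so 2 \<theta> B is a primitive up to sign. Its vanishing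
  body is recorded for later control of the value on X_x.\<close>

lemma cocycle_theta_component:
  assumes c: "c \<in> hom_cocycles lam mu p" and c1: "c (1, 0, 0) = 0"
  obtains v where "v \<in> diff_ops" "op_parity p v" "\<And>F. body (v F) = 0"
    "coboundary lam mu p v (1, 0, 0) = 0" "coboundary lam mu p v (0, 0, 1) = c (0, 0, 1)"
proof -
  note cD = hom_cocyclesD[OF c]
  define B where "B = c (0, 0, 1)"
  have B: "B \<in> diff_ops" "op_parity (p + 1) B"
    using cD(2) cD(3)[of 1 "(0, 0, 1)"] by (simp_all add: B_def)
  have c0: "c 0 = 0" by (rule linear_0[OF cD(1)])
  have "op_action lam mu 0 (p + 1) (1, 0, 0) B = 0"
    using cD(4)[of 0 "(1, 0, 0)" 1 "(0, 0, 1)"] c0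
    by (simp add: B_def c1 op_action_0 zero_prod_def)
  then have B1: "op_action lam mu 0 q (1, 0, 0) B = 0" for q by (simp add: op_action_def)
  have "c (aff_bracket (0, 0, 1) (0, 0, 1)) = 0"
    using linear_scale[OF cD(1), of "1/2" "(1, 0, 0)"] by (simp add: c1)
  \<comment> \<open>With both arguments equal to X_\<theta> the two terms of the cocycle condition
    add up instead of cancelling.\<close>
  then have "(-1) ^ p *\<^sub>R op_action lam mu (Suc 0) (Suc p) (0, 0, 1) B
      - (-1) ^ Suc p *\<^sub>R op_action lam mu (Suc 0) (Suc p) (0, 0, 1) B = 0"
    using cD(4)[of "Suc 0" "(0, 0, 1)" "Suc 0" "(0, 0, 1)"] by (simp add: B_def)
  then have "(2 * (-1) ^ p) *\<^sub>R op_action lam mu (Suc 0) (Suc p) (0, 0, 1) B = 0"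
    by (simp add: scaleR_left_distrib flip: scaleR_2 del: scaleR_scaleR)
  then have Bt: "op_action lam mu (Suc 0) (Suc p) (0, 0, 1) B = 0" by simp
  define w where "w = (\<lambda>F. theta * B F)"
  have w: "w \<in> diff_ops" unfolding w_def by (rule diff_ops_mult[OF B(1)])
  \<comment> \<open>X_1 commutes with multiplication by the constant \<theta>, so subtracting
    \<partial>w does not disturb the value on X_1.\<close>
  have w1: "op_action lam mu 0 p (1, 0, 0) w = 0"
  proof
    fix F
    have "op_action lam mu 0 p (1, 0, 0) w F = theta * op_action lam mu 0 p (1, 0, 0) B F"
      by (rule superfun_eqI)
        (simp_all add: w_def op_action_def comp_lie_eq lie_deriv_gen_fun sderiv_simps)
    then show "op_action lam mu 0 p (1, 0, 0) w F = 0 F" by (simp add: B1)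
  qed
  \<comment> \<open>The body of X_\<theta> acting on \<theta> B is half the body of B, whence the
    factor 2; both terms are killed by X_\<theta>.\<close>
  have "2 *\<^sub>R op_action lam mu (Suc 0) p (0, 0, 1) w - B = 0"
  proof (rule theta_invariant_eq_0)
    fix F
    show "body ((2 *\<^sub>R op_action lam mu (Suc 0) p (0, 0, 1) w - B) F) = 0"
      by (simp add: scaleR_fun_apply body_op_action_theta w_def)
    show "op_action lam mu (Suc 0) (Suc p) (0, 0, 1) (2 *\<^sub>R op_action lam mu (Suc 0) p (0, 0, 1) w - B) = 0"
      by (simp only: op_action_diff op_action_scaleR op_action_theta_theta[OF w] w1 Bt
          scaleR_zero_right diff_0_right)
  qed
  then have wt: "2 *\<^sub>R op_action lam mu (Suc 0) p (0, 0, 1) w = B" by simp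
  let ?v = "((-1) ^ p * 2) *\<^sub>R w"
  show ?thesis
  proof (rule that[of ?v])
    show v: "?v \<in> diff_ops" by (intro diff_ops_scaleR w)
    show "op_parity p ?v"
      unfolding w_def by (intro op_parity_scaleR op_parity_theta_mult B(2))
    show "body (?v F) = 0" for F by (simp add: scaleR_fun_apply w_def)
    show "coboundary lam mu p ?v (1, 0, 0) = 0"
      by (simp only: coboundary_values[OF v] op_action_scaleR w1 scaleR_zero_right)
    have "((-1) ^ p * ((-1) ^ p * 2)) = (2 :: real)" by (simp flip: power_add mult.assoc mult_2)
    then show "coboundary lam mu p ?v (0, 0, 1) = c (0, 0, 1)"
      by (simp only: coboundary_values[OF v] op_action_scaleR scaleR_scaleR wt flip: B_def)
  qed
qed

text \<open>The brackets of X_1 and X_\<theta> with X_x are multiples of X_1 and X_\<theta>, where c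
  vanishes; one term of each cocycle condition survives.\<close>

lemma cocycle_x_component:
  assumes c: "c \<in> hom_cocycles lam mu p" and c1: "c (1, 0, 0) = 0" and ct: "c (0, 0, 1) = 0"
  shows "op_action lam mu 0 p (1, 0, 0) (c (0, 1, 0)) = 0"
    and "op_action lam mu (Suc 0) p (0, 0, 1) (c (0, 1, 0)) = 0"
proof -
  note cD = hom_cocyclesD[OF c]
  show "op_action lam mu 0 p (1, 0, 0) (c (0, 1, 0)) = 0"
    using cD(4)[of 0 "(1, 0, 0)" 0 "(0, 1, 0)"] by (simp add: c1 op_action_0)
  have "c (aff_bracket (0, 0, 1) (0, 1, 0)) = 0"
    using linear_scale[OF cD(1), of "1/2" "(0, 0, 1)"] by (simp add: ct)
  then show "op_action lam mu (Suc 0) p (0, 0, 1) (c (0, 1, 0)) = 0"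
    using cD(4)[of "Suc 0" "(0, 0, 1)" 0 "(0, 1, 0)"] by (simp add: ct op_action_0)
qed

text \<open>After removing the value on X_\<theta> by a coboundary of an operator with body zero,
  the value on X_x still has body zero and is killed by X_\<theta>, so it is zero.\<close>

lemma cocycle_vanishing_on_aff1:
  assumes c: "c \<in> hom_cocycles lam mu p" and c1: "c (1, 0, 0) = 0" and cx: "c (0, 1, 0) = 0"
  shows "c \<in> hom_coboundaries lam mu p"
proof -
  obtain v where v: "v \<in> diff_ops" "op_parity p v" "\<And>F. body (v F) = 0"
    "coboundary lam mu p v (1, 0, 0) = 0" "coboundary lam mu p v (0, 0, 1) = c (0, 0, 1)"
    using cocycle_theta_component[OF c c1] by blast
  let ?d = "c - coboundary lam mu p v"
  have d: "?d \<in> hom_cocycles lam mu p"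
    by (intro subspace_diff[OF subspace_hom_cocycles] c coboundary_in_cocycles v)
  have d1: "?d (1, 0, 0) = 0" and dt: "?d (0, 0, 1) = 0"
    by (simp_all add: c1 v)
  have "?d (0, 1, 0) = 0"
  proof (rule theta_invariant_eq_0)
    fix F
    show "body (?d (0, 1, 0) F) = 0"
      by (simp add: cx coboundary_values[OF v(1)] op_action_def comp_lie_eq lie_deriv_gen_fun v(3)
          linear_0[OF linear_sderiv])
  qed (rule cocycle_x_component(2)[OF d d1 dt])
  then have "?d = 0"
    by (intro cochain_eq_0 hom_cocyclesD(1)[OF d] d1 dt)
  then have "c = coboundary lam mu p v" by (simp only: right_minus_eq)
  then show ?thesis unfolding hom_coboundaries_eq using v by blast
qed

text \<open>The condition |\<alpha>| = \<delta>_\<epsilon> for \<epsilon> of either parity; once 2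
  \<delta> is a natural number, its parity decides which \<epsilon> occur.\<close>

definition basic_index :: "(('n \<Rightarrow> real) \<times> ('n \<Rightarrow> nat)) set" where
  "basic_index = {s. fst s \<in> eps_set \<and> weight lam (fst s) (snd s) = mu}"

lemma op_action_Gamma_op_homogeneous:
  assumes s: "s \<in> basic_index" and g: "aff_parity q g"
    and p: "even p = even (eps_parity (fst s))"
  shows "op_action lam mu q p g (Gamma_op s) = 0"
proof -
  have s': "fst s \<in> eps_set" "mu - weight lam (fst s) (snd s) = 0"
    using s by (simp_all add: basic_index_def)
  obtain x y z where xyz: "g = (x, y, z)" by (cases g)
  note lin = linear_op_action_left[OF diff_ops_Gamma_op[OF s'(1)], of lam mu]
  have "op_action lam mu q p g (Gamma_op s) = op_action lam mu q p (x *\<^sub>R (1, 0, 0) + y *\<^sub>R (0, 1, 0) + z *\<^sub>R (0, 0, 1)) (Gamma_op s)"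
    by (simp add: xyz)
  also have "\<dots> = x *\<^sub>R op_action lam mu q p (1, 0, 0) (Gamma_op s)
      + y *\<^sub>R op_action lam mu q p (0, 1, 0) (Gamma_op s)
      + z *\<^sub>R op_action lam mu q p (0, 0, 1) (Gamma_op s)"
    by (simp only: linear_add[OF lin] linear_scale[OF lin])
  also have "\<dots> = 0"
  proof (cases "even q")
    case True
    then have "z = 0" using g by (simp add: xyz)
    moreover have "op_action lam mu q p (1, 0, 0) (Gamma_op s) = 0" "op_action lam mu q p (0, 1, 0) (Gamma_op s) = 0"
      using True op_action_1_Gamma_op[OF s'(1), of lam mu p] op_action_x_Gamma_op[OF s'(1), of lam mu p]
      by (subst op_action_cong_parity[of q 0 p p], simp_all add: s'(2))+
    ultimately show ?thesis by simp
  next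
    case False
    then have "x = 0" "y = 0" using g by (simp_all add: xyz)
    moreover have "op_action lam mu q p (0, 0, 1) (Gamma_op s) = 0"
      using False op_action_theta_Gamma_op[OF s'(1) p, of lam mu]
      by (subst op_action_cong_parity[of q "Suc 0" p p]) simp_all
    ultimately show ?thesis by simp
  qed
  finally show ?thesis .
qed

text \<open>At weight mu, \<open>Gamma_op\<close> is invariant under the whole superalgebra, and the
  coefficient of X_x vanishes on brackets. Every term of the cocycle condition is therefore
  zero.\<close>

lemma basic_cocycle_in_hom_cocycles:
  assumes s: "s \<in> basic_index" and p: "even p = even (eps_parity (fst s))"
  shows "basic_cocycle s \<in> hom_cocycles lam mu p"
proof -
  have s': "fst s \<in> eps_set" using s by (simp add: basic_index_def)
  have "op_parity (p + q) (basic_cocycle s g)" if "aff_parity q g" for q g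
  proof (cases "even q")
    case True
    have "op_parity (eps_parity (fst s)) (basic_cocycle s g)"
      unfolding basic_cocycle_def by (intro op_parity_scaleR op_parity_Gamma_op s')
    then show ?thesis by (subst op_parity_cong[of _ "eps_parity (fst s)"]) (use True p in auto)
  next
    case False
    then have "basic_cocycle s g = 0" using that by (cases g) (simp add: basic_cocycle_def)
    then show ?thesis by (simp only: op_parity_0)
  qed
  moreover have "op_action lam mu q (p + r) g (basic_cocycle s h) = 0"
    if g: "aff_parity q g" and h: "aff_parity r h" for q r g h
  proof (cases "even r")
    case True
    then show ?thesis
      unfolding basic_cocycle_def op_action_scaleR
      by (subst op_action_Gamma_op_homogeneous[OF s g]) (simp_all add: p)
  next
    case False
    then have "basic_cocycle s h = 0" using h by (cases h) (simp add: basic_cocycle_def)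
    then show ?thesis by (simp only: op_action_0)
  qed
  moreover have "basic_cocycle s (aff_bracket g h) = 0" for g h
    by (cases g; cases h) (simp add: basic_cocycle_def)
  ultimately show ?thesis
    by (simp add: hom_cocycles_def cochains_def cochain_parity_def linear_basic_cocycle)
      (simp add: basic_cocycle_def diff_ops_scaleR diff_ops_Gamma_op s')
qed

lemma finite_basic_index: "finite basic_index"
proof -
  \<comment> \<open>As |\<alpha>| = \<delta> - |\<epsilon>|, no entry of \<alpha> exceeds
    \<delta>.\<close>
  define N where "N = nat \<lceil>mu - (\<Sum>i\<in>UNIV. lam i)\<rceil>"
  have eps: "finite (eps_set :: ('n \<Rightarrow> real) set)"
  proof -
    have "eps_set \<subseteq> PiE (UNIV :: 'n set) (\<lambda>_. {0, 1/2 :: real})" by (auto simp: eps_set_def)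
    then show ?thesis by (rule finite_subset) (intro finite_PiE; simp)
  qed
  have N: "finite (PiE (UNIV :: 'n set) (\<lambda>_. {..N}))" by (intro finite_PiE; simp)
  have "basic_index \<subseteq> eps_set \<times> PiE UNIV (\<lambda>_. {..N})"
  proof
    fix s assume s: "s \<in> basic_index"
    then have \<epsilon>: "fst s \<in> eps_set" by (simp add: basic_index_def)
    have "snd s i \<le> N" for i
    proof -
      have "snd s i \<le> (\<Sum>i\<in>UNIV. snd s i)" by (rule member_le_sum) auto
      moreover have "real (\<Sum>i\<in>UNIV. snd s i) \<le> mu - (\<Sum>i\<in>UNIV. lam i)"
        using s eps_sum_UNIV[OF \<epsilon>] by (simp add: basic_index_def weight_def sum.distrib)
      ultimately show ?thesis unfolding N_def by linarith
    qed
    then show "s \<in> eps_set \<times> PiE UNIV (\<lambda>_. {..N})" using \<epsilon> by (cases s) auto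
  qed
  then show ?thesis by (rule finite_subset[OF _ finite_cartesian_product[OF eps N]])
qed

lemma hom_cocycle_normal_form:
  assumes c: "c \<in> hom_cocycles lam mu p"
  obtains a where
    "c - (\<Sum>s\<in>basic_index. a s *\<^sub>R basic_cocycle s) \<in> hom_coboundaries lam mu p"
proof -
  obtain v1 where v1: "v1 \<in> diff_ops" "op_parity p v1" "op_action lam mu 0 p (1, 0, 0) v1 = c (1, 0, 0)"
    using op_action_1_surj[of "c (1, 0, 0)" p lam mu p] hom_cocyclesD(2)[OF c]
      hom_cocyclesD(3)[OF c, of 0 "(1, 0, 0)"] by auto
  define c1 where "c1 = c - coboundary lam mu p v1"
  have c1: "c1 \<in> hom_cocycles lam mu p"
    unfolding c1_def by (intro subspace_diff[OF subspace_hom_cocycles] c coboundary_in_cocycles v1)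
  have c1_1: "c1 (1, 0, 0) = 0" by (simp add: c1_def coboundary_values v1)
  obtain v2 where v2: "v2 \<in> diff_ops" "op_parity p v2" "\<And>F. body (v2 F) = 0"
    "coboundary lam mu p v2 (1, 0, 0) = 0" "coboundary lam mu p v2 (0, 0, 1) = c1 (0, 0, 1)"
    using cocycle_theta_component[OF c1 c1_1] by blast
  define c2 where "c2 = c1 - coboundary lam mu p v2"
  have c2: "c2 \<in> hom_cocycles lam mu p"
    unfolding c2_def by (intro subspace_diff[OF subspace_hom_cocycles] c1 coboundary_in_cocycles v2)
  have c2_1: "c2 (1, 0, 0) = 0" and c2_t: "c2 (0, 0, 1) = 0"
    by (simp_all add: c2_def c1_1 v2)
  have "c2 (0, 1, 0) \<in> diff_ops" and "op_parity p (c2 (0, 1, 0))"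
    using hom_cocyclesD(2)[OF c2] hom_cocyclesD(3)[OF c2, of 0 "(0, 1, 0)"] by simp_all
  from invariant_expansion[OF this cocycle_x_component[OF c2 c2_1 c2_t]]
  obtain S a where S: "finite S" "S \<subseteq> {s. fst s \<in> eps_set \<and> even (eps_parity (fst s)) = even p}"
    "c2 (0, 1, 0) = (\<Sum>s\<in>S. a s *\<^sub>R Gamma_op s)" .
  let ?m = "\<lambda>s. mu - weight lam (fst s) (snd s)"
  \<comment> \<open>T collects the terms of eigenvalue 0 under X_x. On the others the eigenvalue can
    be divided out; as w is killed by X_1 and X_\<theta>, its coboundary changes the value on X_x
    only.\<close>
  define T where "T = {s \<in> S. ?m s = 0}"
  define w where "w = (\<Sum>s\<in>S - T. (a s / ?m s) *\<^sub>R Gamma_op s)"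
  have w: "w \<in> diff_ops" "op_parity p w"
  proof -
    show "w \<in> diff_ops"
      unfolding w_def using S(2) by (intro diff_ops_sum diff_ops_scaleR diff_ops_Gamma_op) auto
    have "op_parity p (Gamma_op s)" if "s \<in> S" for s
      using that S(2) op_parity_Gamma_op[of s]
      by (subst op_parity_cong[of _ "eps_parity (fst s)"]) auto
    then show "op_parity p w"
      unfolding w_def by (intro op_parity_sum op_parity_scaleR) auto
  qed
  have S': "fst s \<in> eps_set" "even p = even (eps_parity (fst s))" if "s \<in> S - T" for s
    using that S(2) by auto
  have w1: "op_action lam mu 0 p (1, 0, 0) w = 0"
    unfolding w_def op_action_sum op_action_scaleR
    by (rule sum.neutral, rule ballI) (simp only: op_action_1_Gamma_op[OF S'(1)] scaleR_zero_right)
  have wt: "op_action lam mu (Suc 0) p (0, 0, 1) w = 0"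
    unfolding w_def op_action_sum op_action_scaleR
    by (rule sum.neutral, rule ballI) (simp only: op_action_theta_Gamma_op[OF S'] scaleR_zero_right)
  have wx: "op_action lam mu 0 p (0, 1, 0) w = (\<Sum>s\<in>S - T. a s *\<^sub>R Gamma_op s)"
    unfolding w_def op_action_sum op_action_scaleR
  proof (rule sum.cong[OF refl])
    fix s assume s: "s \<in> S - T"
    then have "?m s \<noteq> 0" by (auto simp: T_def)
    then show "(a s / ?m s) *\<^sub>R op_action lam mu 0 p (0, 1, 0) (Gamma_op s) = a s *\<^sub>R Gamma_op s"
      by (simp add: op_action_x_Gamma_op[OF S'(1)[OF s]])
  qed
  let ?e = "c2 - coboundary lam mu p w - (\<Sum>s\<in>T. a s *\<^sub>R basic_cocycle s)"
  have "?e = 0"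
  proof (rule cochain_eq_0)
    have "linear (\<Sum>s\<in>T. a s *\<^sub>R basic_cocycle s)"
      by (rule linearI) (simp_all add: sum_basic_cocycle scaleR_add_left)
    then show "linear ?e"
      by (intro linear_fun_diff hom_cocyclesD(1)[OF c2] linear_coboundary_left[OF w(1)])
    show "?e (1, 0, 0) = 0" "?e (0, 0, 1) = 0"
      by (simp_all add: c2_1 c2_t coboundary_values[OF w(1)] w1 wt sum_basic_cocycle)
    have "c2 (0, 1, 0) = (\<Sum>s\<in>S - T. a s *\<^sub>R Gamma_op s) + (\<Sum>s\<in>T. a s *\<^sub>R Gamma_op s)"
      unfolding S(3) using S(1) by (intro sum.subset_diff) (auto simp: T_def)
    then show "?e (0, 1, 0) = 0"
      by (simp add: coboundary_values[OF w(1)] wx sum_basic_cocycle)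
  qed
  then have "c - (\<Sum>s\<in>T. a s *\<^sub>R basic_cocycle s) = coboundary lam mu p v1 + coboundary lam mu p v2 + coboundary lam mu p w"
    unfolding c2_def c1_def by (simp only: algebra_simps add_0_left)
  also have "\<dots> \<in> hom_coboundaries lam mu p"
    by (intro subspace_add[OF subspace_hom_coboundaries])
      (use v1 v2 w in \<open>auto simp: hom_coboundaries_eq\<close>)
  finally have "c - (\<Sum>s\<in>T. a s *\<^sub>R basic_cocycle s) \<in> hom_coboundaries lam mu p" .
  moreover have "(\<Sum>s\<in>T. a s *\<^sub>R basic_cocycle s)
      = (\<Sum>s\<in>basic_index. (if s \<in> T then a s else 0) *\<^sub>R basic_cocycle s)"
    using finite_basic_index S(2)
    by (intro sum.mono_neutral_cong_left) (auto simp: T_def basic_index_def)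
  ultimately show ?thesis using that[of "\<lambda>s. if s \<in> T then a s else 0"] by simp
qed

text \<open>Euler's identity for the divided powers, plus the weight l of a body or l + 1/2 of a
  soul.\<close>

lemma lie_deriv_x_probe:
  assumes "\<epsilon> \<in> eps_set"
  shows "lie_deriv l (gen_fun (0, 1, 0)) (probe 0 \<epsilon> \<alpha> i) = (l + \<epsilon> i + real (\<alpha> i)) *\<^sub>R probe 0 \<epsilon> \<alpha> i"
  using eps_setD[OF assms, of i]
  by (intro superfun_eqI)
    (auto simp: lie_deriv_gen_fun probe_def coord_shifted_power sderiv_simps algebra_simps)

text \<open>At the origin the probe belonging to \<open>\<Omega>\<close> is an eigenvector of \<open>X\<^sub>x\<close>, of the weight
  of \<open>\<Omega>\<close>; hence the coefficients of weight \<open>mu\<close> of an operator \<open>X\<^sub>x \<cdot> v\<close> vanish.\<close>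

lemma op_action_x_probe:
  assumes v: "v \<in> diff_ops" and s: "s \<in> basic_index"
  shows "apply_smooth (body (op_action lam mu 0 q (0, 1, 0) v (probe 0 (fst s) (snd s)))) 0 = 0"
proof -
  let ?F = "probe 0 (fst s) (snd s)"
  have s': "fst s \<in> eps_set" "weight lam (fst s) (snd s) = mu"
    using s by (simp_all add: basic_index_def)
  have "v (lie_arg lam 0 (0, 1, 0) i ?F) = (lam i + fst s i + real (snd s i)) *\<^sub>R v ?F" for i
  proof -
    have lin: "linear (\<lambda>u. v (?F(i := u)))"
      using multilinear_diff_ops[OF v] by (simp add: multilinear_op_def)
    show ?thesis
      by (simp add: lie_arg_even lie_deriv_x_probe[OF s'(1)] linear_scale[OF lin])
  qed
  then have "op_action lam mu 0 q (0, 1, 0) v ?F = lie_deriv mu (gen_fun (0, 1, 0)) (v ?F) - mu *\<^sub>R v ?F"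
    using s'(2) by (simp add: op_action_def comp_lie_eq weight_def flip: scaleR_sum_left)
  then show ?thesis
    by (simp add: lie_deriv_gen_fun apply_smooth_simps)
qed

end

section \<open>The first cohomology space\<close>

context
  fixes lam :: "'n::{finite,linorder} \<Rightarrow> real" and mu :: real
begin

lemma subspace_cocycles: "Real_Vector_Spaces.subspace (cocycles lam mu)"
  unfolding cocycles_def by (intro subspace_sums subspace_hom_cocycles)

lemma subspace_coboundaries: "Real_Vector_Spaces.subspace (coboundaries lam mu)"
  unfolding coboundaries_def by (intro subspace_sums subspace_hom_coboundaries)

lemma coboundaries_subset: "coboundaries lam mu \<subseteq> cocycles lam mu"
  unfolding cocycles_def coboundaries_def
  using hom_coboundaries_subset[of lam mu] by blast

lemma hom_in_cocycles:
  "c \<in> hom_cocycles lam mu 0 \<Longrightarrow> c \<in> cocycles lam mu"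
  "c \<in> hom_cocycles lam mu 1 \<Longrightarrow> c \<in> cocycles lam mu"
proof -
  show "c \<in> cocycles lam mu" if "c \<in> hom_cocycles lam mu 0"
    unfolding cocycles_def
    by (intro CollectI exI[of _ c] exI[of _ 0] conjI that subspace_0[OF subspace_hom_cocycles]) simp
  show "c \<in> cocycles lam mu" if "c \<in> hom_cocycles lam mu 1"
    unfolding cocycles_def
    by (intro CollectI exI[of _ c] exI[of _ 0] conjI that subspace_0[OF subspace_hom_cocycles]) simp
qed

lemma basic_cocycle_in_cocycles:
  assumes "s \<in> basic_index lam mu"
  shows "basic_cocycle s \<in> cocycles lam mu"
  using hom_in_cocycles basic_cocycle_in_hom_cocycles[OF assms, of 0]
    basic_cocycle_in_hom_cocycles[OF assms, of 1]
  by (cases "even (eps_parity (fst s))") auto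

lemma cocycles_generated:
  assumes "c \<in> cocycles lam mu"
  shows "\<exists>a. c - (\<Sum>s\<in>basic_index lam mu. a s *\<^sub>R basic_cocycle s) \<in> coboundaries lam mu"
proof -
  obtain c0 c1 where c01: "c0 \<in> hom_cocycles lam mu 0" "c1 \<in> hom_cocycles lam mu 1" "c = c0 + c1"
    using assms unfolding cocycles_def by blast
  obtain b0 where b0: "c0 - (\<Sum>s\<in>basic_index lam mu. b0 s *\<^sub>R basic_cocycle s) \<in> hom_coboundaries lam mu 0"
    using hom_cocycle_normal_form[OF c01(1)] .
  obtain b1 where b1: "c1 - (\<Sum>s\<in>basic_index lam mu. b1 s *\<^sub>R basic_cocycle s) \<in> hom_coboundaries lam mu 1"
    using hom_cocycle_normal_form[OF c01(2)] .
  have "c - (\<Sum>s\<in>basic_index lam mu. (b0 s + b1 s) *\<^sub>R basic_cocycle s) =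
    (c0 - (\<Sum>s\<in>basic_index lam mu. b0 s *\<^sub>R basic_cocycle s))
    + (c1 - (\<Sum>s\<in>basic_index lam mu. b1 s *\<^sub>R basic_cocycle s))"
    by (simp only: c01(3) scaleR_add_left sum.distrib algebra_simps)
  also have "\<dots> \<in> coboundaries lam mu"
    unfolding coboundaries_def using b0 b1 by (intro CollectI exI conjI) (rule refl)
  finally show ?thesis by (intro exI[of _ "\<lambda>s. b0 s + b1 s"])
qed

text \<open>Evaluated on X_x at the probe of s centred at 0, every coboundary gives 0 by
  \<open>op_action_x_probe\<close>, while the combination gives its coefficient at s.\<close>

lemma basic_cocycles_independent:
  assumes "(\<Sum>s\<in>basic_index lam mu. a s *\<^sub>R basic_cocycle s) \<in> coboundaries lam mu"
    and s: "s \<in> basic_index lam mu"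
  shows "a s = 0"
proof -
  let ?I = "basic_index lam mu"
  obtain v0 v1 where v: "v0 \<in> diff_ops" "v1 \<in> diff_ops"
    and eq: "(\<Sum>s\<in>?I. a s *\<^sub>R basic_cocycle s) = coboundary lam mu 0 v0 + coboundary lam mu 1 v1"
    using assms(1) unfolding coboundaries_def hom_coboundaries_eq by blast
  have "op_action lam mu 0 1 (0, 1, 0) v1 = op_action lam mu 0 0 (0, 1, 0) v1"
    by (simp add: op_action_def)
  then have "(\<Sum>s\<in>?I. a s *\<^sub>R Gamma_op s) = op_action lam mu 0 0 (0, 1, 0) (v0 + v1)"
    using fun_cong[OF eq, of "(0, 1, 0)"]
    by (simp add: sum_basic_cocycle coboundary_values[OF v(1)] coboundary_values[OF v(2)] op_action_add
        del: One_nat_def)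
  then have "apply_smooth (body ((\<Sum>s\<in>?I. a s *\<^sub>R Gamma_op s) (probe 0 (fst s) (snd s)))) 0 = 0"
    using op_action_x_probe[OF diff_ops_add[OF v] s] by simp
  moreover have "apply_smooth (body (Gamma_op r (probe 0 (fst s) (snd s)))) 0 = (if r = s then 1 else 0)"
    if "r \<in> ?I" for r
    using that s by (auto simp: body_Gamma_op Omega_probe basic_index_def prod_eq_iff)
  ultimately show ?thesis
    using s finite_basic_index[of lam mu]
    by (simp add: sum_fun_eq scaleR_fun_apply apply_smooth_sum scaleR_smooth.rep_eq if_distrib
        cong: sum.cong if_cong)
qed

text \<open>On an even field the two homogeneous parts take values of opposite parity with sum zero,
  so each vanishes and the homogeneous case applies.\<close>

lemma cocycles_vanishing_on_aff1:
  assumes c: "c \<in> cocycles lam mu" and zero: "\<And>X. aff_parity 0 X \<Longrightarrow> c X = 0"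
  shows "c \<in> coboundaries lam mu"
proof -
  obtain c0 c1 where c01: "c0 \<in> hom_cocycles lam mu 0" "c1 \<in> hom_cocycles lam mu 1" "c = c0 + c1"
    using c unfolding cocycles_def by blast
  have "c0 X = 0 \<and> c1 X = 0" if X: "aff_parity 0 X" for X
  proof -
    have sum: "c0 X = - c1 X" using zero[OF X] by (simp add: c01(3) eq_neg_iff_add_eq_0)
    have "op_parity (Suc 0) (- c1 X)"
      using op_parity_scaleR[of "Suc 0" "c1 X" "-1"] hom_cocyclesD(3)[OF c01(2) X] by simp
    then have "op_parity (Suc 0) (c0 X)" by (simp only: sum)
    then have "c0 X = 0"
      using hom_cocyclesD(2)[OF c01(1)] hom_cocyclesD(3)[OF c01(1) X] by (intro op_parity_both) simp_all
    then show ?thesis using sum by simp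
  qed
  from this[of "(1, 0, 0)"] this[of "(0, 1, 0)"]
  have "c0 \<in> hom_coboundaries lam mu 0" "c1 \<in> hom_coboundaries lam mu 1"
    by (intro cocycle_vanishing_on_aff1 c01; simp)+
  then show ?thesis unfolding coboundaries_def c01(3) by blast
qed

lemma Gamma_aff1_eq:
  assumes "\<epsilon> \<in> eps_set"
  shows "Gamma_aff1 \<epsilon> \<alpha> (gen_fun (a, b, 0)) = b *\<^sub>R Gamma_op (\<epsilon>, \<alpha>)"
proof
  fix F
  have d: "d_x (gen_fun (a, b, 0)) = b *\<^sub>R 1"
    by (rule superfun_eqI) (simp_all add: gen_fun.simps d_x_def sderiv_simps)
  have "nat \<lfloor>2 * (\<Sum>i\<in>UNIV. \<epsilon> i)\<rfloor> = eps_parity \<epsilon>"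
    by (simp add: eps_sum_UNIV[OF assms])
  then show "Gamma_aff1 \<epsilon> \<alpha> (gen_fun (a, b, 0)) F = (b *\<^sub>R Gamma_op (\<epsilon>, \<alpha>)) F"
    by (simp add: Gamma_aff1_def Gamma_op_def d scaleR_fun_apply scaleR_add_right scaleR_sum_right
        sum_distrib_left ac_simps)
qed

lemma basic_cocycle_restrict:
  assumes "s \<in> basic_index lam mu" "aff_parity 0 X"
  shows "basic_cocycle s X = Gamma_aff1 (fst s) (snd s) (gen_fun X)"
  using assms by (cases X) (simp add: basic_cocycle_def Gamma_aff1_eq basic_index_def)

lemma Gamma_index_eq: "Gamma_index lam mu E = {s \<in> basic_index lam mu. fst s \<in> E}"
  if "E \<subseteq> eps_set"
  using that by (auto simp: Gamma_index_def basic_index_def weight_def delta_eps_def sum.distrib)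

lemma H1_diff_basis:
  shows "inj_on (\<lambda>s. H1_class lam mu (basic_cocycle s)) (basic_index lam mu)"
    and "vectorspace.basis real_field (H1_diff lam mu)
      ((\<lambda>s. H1_class lam mu (basic_cocycle s)) ` basic_index lam mu)"
    and "vectorspace.fin_dim real_field (H1_diff lam mu)"
    and "vectorspace.dim real_field (H1_diff lam mu) = card (basic_index lam mu)"
  unfolding H1_class_def H1_diff_def
  by (rule quotient_space_basis[OF subspace_cocycles subspace_coboundaries coboundaries_subset
      finite_basic_index[of lam mu], where z = basic_cocycle];
      (erule basic_cocycle_in_cocycles | erule cocycles_generated
        | erule (1) basic_cocycles_independent))+

text \<open>Any admissible choice differs from \<open>basic_cocycle\<close> by a cocycle that is
  zero on aff(1), hence has the same class.\<close>

lemma Gamma_basis_basic_index: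
  assumes E: "E \<subseteq> eps_set" and I: "basic_index lam mu = Gamma_index lam mu E"
  shows "Gamma_basis lam mu E"
proof -
  let ?I = "basic_index lam mu"
  have C: "basic_cocycle s \<in> Gamma_cocycles lam mu (fst s) (snd s)" if "s \<in> ?I" for s
    using that by (simp add: Gamma_cocycles_def basic_cocycle_in_cocycles basic_cocycle_restrict)
  have class_eq: "H1_class lam mu c = H1_class lam mu (basic_cocycle s)"
    if s: "s \<in> ?I" and c: "c \<in> Gamma_cocycles lam mu (fst s) (snd s)" for s c
  proof -
    have "c - basic_cocycle s \<in> coboundaries lam mu"
    proof (rule cocycles_vanishing_on_aff1)
      show "c - basic_cocycle s \<in> cocycles lam mu"
        using c basic_cocycle_in_cocycles[OF s] by (auto simp: Gamma_cocycles_def intro: subspace_diff[OF subspace_cocycles])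
      show "(c - basic_cocycle s) X = 0" if "aff_parity 0 X" for X
      proof -
        have "c X = Gamma_aff1 (fst s) (snd s) (gen_fun X)"
          using c that unfolding Gamma_cocycles_def by blast
        then show ?thesis by (simp add: basic_cocycle_restrict[OF s that])
      qed
    qed
    then show ?thesis
      unfolding H1_class_def
      by (simp add: residue_class_eq_iff[OF subspace_cocycles subspace_coboundaries coboundaries_subset])
  qed
  show ?thesis
    unfolding Gamma_basis_def I[symmetric]
  proof (intro conjI allI impI)
    show "\<forall>(\<epsilon>, \<alpha>)\<in>?I. Gamma_cocycles lam mu \<epsilon> \<alpha> \<noteq> {}" using C by fastforce
    fix \<Gamma> :: "('n \<Rightarrow> real) \<times> ('n \<Rightarrow> nat) \<Rightarrow> 'n cochain"
    assume "\<forall>(\<epsilon>, \<alpha>)\<in>?I. \<Gamma> (\<epsilon>, \<alpha>) \<in> Gamma_cocycles lam mu \<epsilon> \<alpha>"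
    then have eq: "H1_class lam mu (\<Gamma> s) = H1_class lam mu (basic_cocycle s)" if "s \<in> ?I" for s
      using class_eq[OF that, of "\<Gamma> s"] that by (cases s) auto
    show "inj_on (\<lambda>i. H1_class lam mu (\<Gamma> i)) ?I"
      using H1_diff_basis(1) by (simp add: inj_on_def eq)
    have "(\<lambda>i. H1_class lam mu (\<Gamma> i)) ` ?I = (\<lambda>s. H1_class lam mu (basic_cocycle s)) ` ?I"
      by (rule image_cong) (simp_all add: eq)
    then show "vectorspace.basis real_field (H1_diff lam mu) ((\<lambda>i. H1_class lam mu (\<Gamma> i)) ` ?I)"
      using H1_diff_basis(2) by simp
  qed
qed

end

section \<open>Counting the basic cocycles\<close>

text \<open>Stars and bars, transported along an enumeration of the index type to the count of lists
  with given length and sum.\<close>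

lemma card_sum_eq:
  "card {\<alpha> :: 'n::finite \<Rightarrow> nat. (\<Sum>i\<in>UNIV. \<alpha> i) = N} = (N + CARD('n) - 1) choose N"
proof -
  obtain f :: "nat \<Rightarrow> 'n" where f: "bij_betw f {..<CARD('n)} UNIV"
    using ex_bij_betw_nat_finite[of "UNIV :: 'n set"] by (auto simp: atLeast0LessThan)
  define g where "g = the_inv_into {..<CARD('n)} f"
  have g: "g (f i) = i" if "i < CARD('n)" for i
    using f that by (simp add: g_def the_inv_into_f_f bij_betw_imp_inj_on)
  have fg: "f (g x) = x" "g x < CARD('n)" for x
    using f_the_inv_into_f_bij_betw[OF f, of x] the_inv_into_into[of f "{..<CARD('n)}" x "{..<CARD('n)}"] f
    by (auto simp: g_def bij_betw_def)
  have sum: "sum_list (map (\<alpha> \<circ> f) [0..<CARD('n)]) = (\<Sum>i\<in>UNIV. \<alpha> i)" for \<alpha> :: "'n \<Rightarrow> nat"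
  proof -
    have "sum_list (map (\<alpha> \<circ> f) [0..<CARD('n)]) = (\<Sum>i<CARD('n). \<alpha> (f i))"
      by (simp add: interv_sum_list_conv_sum_set_nat atLeast0LessThan)
    also have "\<dots> = (\<Sum>i\<in>UNIV. \<alpha> i)" by (rule sum.reindex_bij_betw[OF f])
    finally show ?thesis .
  qed
  have "bij_betw (\<lambda>\<alpha>. map (\<alpha> \<circ> f) [0..<CARD('n)]) {\<alpha>. (\<Sum>i\<in>UNIV. \<alpha> i) = N}
    {l. length l = CARD('n) \<and> sum_list l = N}"
  proof (rule bij_betwI[where g = "\<lambda>l x. l ! g x"])
    show "(\<lambda>l x. l ! g x) \<in> {l. length l = CARD('n) \<and> sum_list l = N} \<rightarrow> {\<alpha>. (\<Sum>i\<in>UNIV. \<alpha> i) = N}"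
    proof safe
      fix l :: "nat list" assume l: "length l = CARD('n)" "N = sum_list l"
      have "map ((\<lambda>x. l ! g x) \<circ> f) [0..<CARD('n)] = l"
        by (rule nth_equalityI) (simp_all add: l g)
      then show "(\<Sum>i\<in>UNIV. l ! g i) = sum_list l" using sum[of "\<lambda>x. l ! g x"] by simp
    qed
    show "map ((\<lambda>x. l ! g x) \<circ> f) [0..<CARD('n)] = l" if "l \<in> {l. length l = CARD('n) \<and> sum_list l = N}" for l
      using that by (intro nth_equalityI) (simp_all add: g)
  qed (auto simp: sum fg)
  then show ?thesis using card_length_sum_list[of "CARD('n)" N] by (simp add: bij_betw_same_card)
qed

text \<open>A vector \<epsilon> is determined by its support.\<close>

lemma card_eps_parity:
  "card {\<epsilon> :: 'n::finite \<Rightarrow> real. \<epsilon> \<in> eps_set \<and> eps_parity \<epsilon> = m} = CARD('n) choose m"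
proof -
  have "bij_betw (\<lambda>\<epsilon>. {i. \<epsilon> i \<noteq> 0}) {\<epsilon> :: 'n \<Rightarrow> real. \<epsilon> \<in> eps_set \<and> eps_parity \<epsilon> = m} {K. K \<subseteq> UNIV \<and> card K = m}"
    by (rule bij_betwI[where g = "\<lambda>K i. if i \<in> K then 1/2 else 0"])
      (auto simp: eps_parity_def eps_set_def fun_eq_iff)
  then show ?thesis by (simp add: bij_betw_same_card n_subsets[of UNIV, simplified])
qed

text \<open>With \<delta> = k + e/2 an index has 2|\<epsilon>| = 2 r + e and |\<alpha>| = k - r for
  some r, so e = 0 and e = 1 cover the two formulas at once.\<close>

lemma card_basic_index:
  fixes lam :: "'n::{finite,linorder} \<Rightarrow> real"
  assumes d: "mu - (\<Sum>i\<in>UNIV. lam i) = real k + real e / 2" and e: "e \<le> 1"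
  shows "basic_index lam mu = {s \<in> basic_index lam mu. eps_parity (fst s) mod 2 = e}"
    and "card (basic_index lam mu) = (\<Sum>r = 0..(CARD('n) - e) div 2. (CARD('n) choose (2 * r + e)) *
      (if r \<le> k then (CARD('n) + k - r - 1) choose (k - r) else 0))"
proof -
  let ?n = "CARD('n)"
  \<comment> \<open>Doubling turns the weight equation into one between natural numbers.\<close>
  have mem: "s \<in> basic_index lam mu \<longleftrightarrow> fst s \<in> eps_set \<and>
      2 * k + e = eps_parity (fst s) + 2 * (\<Sum>i\<in>UNIV. snd s i)" for s
  proof (cases "fst s \<in> eps_set")
    case True
    have "weight lam (fst s) (snd s) = (\<Sum>i\<in>UNIV. lam i) + real (eps_parity (fst s)) / 2 + real (\<Sum>i\<in>UNIV. snd s i)"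
      by (simp add: weight_def sum.distrib eps_sum_UNIV[OF True])
    with True d have "s \<in> basic_index lam mu \<longleftrightarrow>
        real (2 * k + e) = real (eps_parity (fst s) + 2 * (\<Sum>i\<in>UNIV. snd s i))"
      by (auto simp: basic_index_def)
    with True show ?thesis by (simp only: of_nat_eq_iff simp_thms)
  qed (simp add: basic_index_def)
  have half: "\<exists>q. eps_parity (fst s) = 2 * q + e \<and> k = q + (\<Sum>i\<in>UNIV. snd s i)"
    if "s \<in> basic_index lam mu" for s
    using that e unfolding mem by (intro exI[of _ "k - (\<Sum>i\<in>UNIV. snd s i)"]) linarith
  have "eps_parity (fst s) mod 2 = e" if "s \<in> basic_index lam mu" for s
    using half[OF that] e by auto
  then show "basic_index lam mu = {s \<in> basic_index lam mu. eps_parity (fst s) mod 2 = e}" by blast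
  \<comment> \<open>The bound r \<le> k matters: truncated subtraction would give k - r = 0 beyond
    it and make \<open>J r\<close> count spurious pairs, where the binomial coefficient has to be
    0.\<close>
  define R where "R = {r \<in> {0..(?n - e) div 2}. r \<le> k}"
  define J where "J r = {\<epsilon> :: 'n \<Rightarrow> real. \<epsilon> \<in> eps_set \<and> eps_parity \<epsilon> = 2 * r + e}
    \<times> {\<alpha> :: 'n \<Rightarrow> nat. (\<Sum>i\<in>UNIV. \<alpha> i) = k - r}" for r
  have card_J: "card (J r) = (?n choose (2 * r + e)) * ((?n + k - r - 1) choose (k - r))" if "r \<le> k" for r
    using that unfolding J_def
    by (simp add: card_cartesian_product card_eps_parity card_sum_eq add.commute)
  have "basic_index lam mu = (\<Union>r\<in>R. J r)"
  proof (intro subset_antisym subsetI)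
    fix s assume s: "s \<in> basic_index lam mu"
    then obtain q where q: "eps_parity (fst s) = 2 * q + e" "k = q + (\<Sum>i\<in>UNIV. snd s i)"
      using half by blast
    have "eps_parity (fst s) \<le> ?n" unfolding eps_parity_def by (rule card_mono) auto
    then have "q \<le> (?n - e) div 2" using q(1) by linarith
    then have "q \<in> R" "s \<in> J q"
      using s q unfolding R_def J_def mem mem_Times_iff by simp_all
    then show "s \<in> (\<Union>r\<in>R. J r)" by blast
  next
    fix s assume "s \<in> (\<Union>r\<in>R. J r)"
    then show "s \<in> basic_index lam mu" unfolding mem R_def J_def by auto
  qed
  moreover have "finite (J r)" if "r \<in> R" for r
    using finite_basic_index[of lam mu] that calculation by (metis UN_upper finite_subset)
  moreover have "J r \<inter> J r' = {}" if "r \<noteq> r'" for r r' using that by (auto simp: J_def)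
  ultimately have "card (basic_index lam mu) = (\<Sum>r\<in>R. card (J r))"
    by (simp add: card_UN_disjoint R_def)
  also have "\<dots> = (\<Sum>r\<in>R. (?n choose (2 * r + e)) * ((?n + k - r - 1) choose (k - r)))"
    by (rule sum.cong) (auto simp: R_def card_J)
  also have "\<dots> = (\<Sum>r = 0..(?n - e) div 2. (?n choose (2 * r + e)) *
      (if r \<le> k then (?n + k - r - 1) choose (k - r) else 0))"
    unfolding R_def by (subst sum.inter_filter) (auto intro!: sum.cong)
  finally show "card (basic_index lam mu) = \<dots>" .
qed

lemma Gamma_basis_parity:
  fixes lam :: "'n::{finite,linorder} \<Rightarrow> real"
  assumes d: "mu - (\<Sum>i\<in>UNIV. lam i) = real k + real e / 2" and e: "e \<le> 1"
    and E: "E = {\<epsilon> \<in> eps_set. eps_parity \<epsilon> mod 2 = e}"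
  shows "Gamma_basis lam mu E"
proof (rule Gamma_basis_basic_index)
  show sub: "E \<subseteq> eps_set" using E by blast
  have "{s \<in> basic_index lam mu. fst s \<in> E} = {s \<in> basic_index lam mu. eps_parity (fst s) mod 2 = e}"
    by (auto simp: E basic_index_def)
  then show "basic_index lam mu = Gamma_index lam mu E"
    unfolding Gamma_index_eq[OF sub] using card_basic_index(1)[OF d e] by simp
qed

theorem theorem5p1:
  fixes lam :: "'n::{finite,linorder} \<Rightarrow> real" and mu \<delta> :: real and n :: nat
  assumes n: "n = CARD('n)"
    and delta: "\<delta> = mu - (\<Sum>i\<in>UNIV. lam i)"
  shows "vectorspace real_field (H1_diff lam mu)
    \<and> (2 * \<delta> \<notin> \<nat> \<longrightarrow> carrier (H1_diff lam mu) = {\<zero>\<^bsub>H1_diff lam mu\<^esub>})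
    \<and> (\<forall>k::nat. \<delta> = real k \<longrightarrow>
         vectorspace.fin_dim real_field (H1_diff lam mu)
       \<and> vectorspace.dim real_field (H1_diff lam mu) =
           (\<Sum>r=0..n div 2. (n choose (2 * r)) *
              (if r \<le> k then (n + k - r - 1) choose (k - r) else 0))
       \<and> Gamma_basis lam mu eps_even)
    \<and> (\<forall>k::nat. \<delta> = real k + 1/2 \<longrightarrow>
         vectorspace.fin_dim real_field (H1_diff lam mu)
       \<and> vectorspace.dim real_field (H1_diff lam mu) =
           (\<Sum>r=0..(n - 1) div 2. (n choose (2 * r + 1)) *
              (if r \<le> k then (n + k - r - 1) choose (k - r) else 0))
       \<and> Gamma_basis lam mu eps_odd)"
proof (intro conjI allI impI)
  note sub = subspace_cocycles[of lam mu] subspace_coboundaries[of lam mu] coboundaries_subset[of lam mu]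
  have nat_half: "real m / 2 \<in> \<nat> \<longleftrightarrow> even m" for m
  proof
    assume "real m / 2 \<in> \<nat>"
    then obtain j where "real m / 2 = real j" by (elim Nats_cases)
    then have "real m = real (2 * j)" by simp
    then show "even m" by (simp only: of_nat_eq_iff) simp
  qed (auto elim!: evenE)
  show "vectorspace real_field (H1_diff lam mu)"
    unfolding H1_diff_def by (rule vectorspace_quotient_space[OF sub])
  show "carrier (H1_diff lam mu) = {\<zero>\<^bsub>H1_diff lam mu\<^esub>}" if "2 * \<delta> \<notin> \<nat>"
  proof -
    have "basic_index lam mu = {}"
    proof (rule ccontr)
      assume "basic_index lam mu \<noteq> {}"
      then obtain s where s: "fst s \<in> eps_set" "weight lam (fst s) (snd s) = mu"
        by (auto simp: basic_index_def)
      \<comment> \<open>An index of weight mu forces 2 \<delta> = 2|\<epsilon>| + 2|\<alpha>|, a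
        natural number.\<close>
      then have "2 * \<delta> = real (eps_parity (fst s) + 2 * (\<Sum>i\<in>UNIV. snd s i))"
        by (auto simp: delta weight_def sum.distrib eps_sum_UNIV)
      then have "2 * \<delta> \<in> \<nat>" by (simp only: of_nat_in_Nats)
      with that show False ..
    qed
    then have "c \<in> coboundaries lam mu" if "c \<in> cocycles lam mu" for c
      using cocycles_generated[OF that] by simp
    then have "residue_class (coboundaries lam mu) ` cocycles lam mu = {residue_class (coboundaries lam mu) 0}"
      using residue_class_eq_iff[OF sub, of _ 0] subspace_0[OF sub(1)] by force
    then show ?thesis
      by (simp only: H1_diff_def quotient_space_carrier[OF sub] quotient_space_zero[OF sub])
  qed
  {
    fix k :: nat assume "\<delta> = real k"
    then have d: "mu - (\<Sum>i\<in>UNIV. lam i) = real k + real (0::nat) / 2" by (simp add: delta)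
    show "vectorspace.fin_dim real_field (H1_diff lam mu)" by (rule H1_diff_basis(3))
    show "vectorspace.dim real_field (H1_diff lam mu) =
           (\<Sum>r=0..n div 2. (n choose (2 * r)) *
              (if r \<le> k then (n + k - r - 1) choose (k - r) else 0))"
      unfolding n using H1_diff_basis(4)[of lam mu] card_basic_index(2)[OF d] by simp
    have "eps_even = {\<epsilon> \<in> eps_set. eps_parity \<epsilon> mod 2 = 0}"
      by (auto simp: eps_even_def eps_sum_UNIV nat_half even_iff_mod_2_eq_zero)
    then show "Gamma_basis lam mu eps_even"
      by (rule Gamma_basis_parity[OF d, rotated]) simp
  next
    fix k :: nat assume "\<delta> = real k + 1/2"
    then have d: "mu - (\<Sum>i\<in>UNIV. lam i) = real k + real (1::nat) / 2" by (simp add: delta)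
    show "vectorspace.fin_dim real_field (H1_diff lam mu)" by (rule H1_diff_basis(3))
    show "vectorspace.dim real_field (H1_diff lam mu) =
           (\<Sum>r=0..(n - 1) div 2. (n choose (2 * r + 1)) *
              (if r \<le> k then (n + k - r - 1) choose (k - r) else 0))"
      unfolding n using H1_diff_basis(4)[of lam mu] card_basic_index(2)[OF d] by simp
    have "eps_odd = {\<epsilon> \<in> eps_set. eps_parity \<epsilon> mod 2 = 1}"
      by (auto simp: eps_odd_def eps_sum_UNIV nat_half odd_iff_mod_2_eq_one)
    then show "Gamma_basis lam mu eps_odd"
      by (rule Gamma_basis_parity[OF d, rotated]) simp
  }
qed

end
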